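(* Assume (A1), (A2), (A3). Then there exists a function $m(\mu,\varepsilon)$ with $$m(\mu,\varepsilon)=-1+\mathcal O(\varepsilon)\qquad(\varepsilon\to0^+)$$ uniformly for $\mu$ in any closed interval $I\subset(0,A(0)]$, such that for $\mu\in I$, $\lambda=i\mu$ is an eigenvalue of $L$ if and only if $$m(\mu,\varepsilon)\,e^{2iS(\mu)/\varepsilon}=1.$$
   Context: Let $\varepsilon>0$ be a small parameter. For $\rho,\theta>0$ set $D(\rho,\theta)=\{x\in\mathbb C:\ |\mathrm{Im}\,x|<\max(\rho,(\tan\theta)|\mathrm{Re}\,x|)\}$. (A1): $A:\mathbb R\to\mathbb R$ is positive and smooth, extends holomorphically to $D_0=D(\rho_0,\theta_0)$ for some $\rho_0,\theta_0>0$, and there is $\tau>0$ with $A(x)=\mathcal O(|x|^{-1-\tau})$ as $|x|\to\infty$ in $D_0$. (A2): $A(-x)=A(x)$ and $A'(x)<0$ for $x>0$. (A3): $A''(0)<0$. $L=\begin{pmatrix}-\frac{\varepsilon}{i}\frac{d}{dx} & -iA(x)\\ -iA(x) & \frac{\varepsilon}{i}\frac{d}{dx}\end{pmatrix}$; $\lambda\in\mathbb C$ is an eigenvalue if $Lu=\lambda u$ has a nonzero solution $u\in L^2(\mathbb R)^2$. For $0<\mu<A(0)$, let $x^*(\mu)>0$ be the unique positive solution of $A(x)=\mu$ (so $\pm x^*(\mu)$ are the only real solutions), and define the action $S(\mu)=\int_{-x^*(\mu)}^{x^*(\mu)}\sqrt{A(x)^2-\mu^2}\,dx$ (with $S(A(0))=0$).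 *)

theory Defs
  imports "HOL-Analysis.Analysis"
begin

definition sectorD :: "real \<Rightarrow> real \<Rightarrow> complex set" where
  "sectorD \<rho> \<theta> = {z. \<bar>Im z\<bar> < max \<rho> (tan \<theta> * \<bar>Re z\<bar>)}"

definition is_eigenvalue :: "(real \<Rightarrow> real) \<Rightarrow> real \<Rightarrow> complex \<Rightarrow> bool" where
  "is_eigenvalue A \<epsilon> lam \<longleftrightarrow>
    (\<exists>u1 u2 v1 v2 :: real \<Rightarrow> complex.
       (\<forall>x. (u1 has_vector_derivative v1 x) (at x) \<and> (u2 has_vector_derivative v2 x) (at x) \<and>
            - (of_real \<epsilon> / \<i>) * v1 x - \<i> * of_real (A x) * u2 x = lam * u1 x \<and>
            - \<i> * of_real (A x) * u1 x + (of_real \<epsilon> / \<i>) * v2 x = lam * u2 x) \<and>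
       (\<lambda>x. (cmod (u1 x))\<^sup>2) integrable_on UNIV \<and>
       (\<lambda>x. (cmod (u2 x))\<^sup>2) integrable_on UNIV \<and>
       (\<exists>x. u1 x \<noteq> 0 \<or> u2 x \<noteq> 0))"

definition xstar :: "(real \<Rightarrow> real) \<Rightarrow> real \<Rightarrow> real" where
  "xstar A \<mu> = (THE x. 0 < x \<and> A x = \<mu>)"

definition action :: "(real \<Rightarrow> real) \<Rightarrow> real \<Rightarrow> real" where
  "action A \<mu> = (if \<mu> = A 0 then 0
     else integral {- xstar A \<mu> .. xstar A \<mu>} (\<lambda>x. sqrt ((A x)\<^sup>2 - \<mu>\<^sup>2)))"

end

theory Submission
  imports Defs "HOL-Complex_Analysis.Complex_Analysis"
begin

text \<open>
  As \<open>m\<close> may be any function, the theorem amounts to the bound \<open>\<bar>cos (S(\<mu>)/\<epsilon>)\<bar> = O(\<epsilon>)\<close> whenever \<open>\<i>\<mu>\<close> is an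
  eigenvalue: then \<open>exp (-2\<i>S/\<epsilon>)\<close> is an admissible value of \<open>m\<close>, and at other points a value near \<open>-1\<close>
  that violates the quantization condition will do.

  With \<open>p = u\<^sub>1 + u\<^sub>2\<close>, \<open>q = u\<^sub>1 - u\<^sub>2\<close> the eigenvalue equation reads \<open>\<epsilon>p' = (\<mu> - A)q\<close>, \<open>\<epsilon>q' = (\<mu> + A)p\<close>, and the
  eigenfunction can be taken real with \<open>pq\<close> odd, so that \<open>pq\<close> is purely imaginary on the imaginary axis.
  On a fixed horizontal line \<open>Im z = \<eta>\<close>, \<open>Re z \<ge> 0\<close>, the quantity \<open>\<mu>\<^sup>2 - A(z)\<^sup>2\<close> stays away from zero
  uniformly in \<open>\<mu>\<close>, even when the two turning points merge as \<open>\<mu> \<rightarrow> A(0)\<close>, and it has a square root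
  \<open>\<kappa>\<close> with nonnegative real part because \<open>Im A < 0\<close> there. Hence the WKB approximation of the solution
  recessive at \<open>+\<infinity>\<close> is valid along the whole line up to a relative error \<open>O(\<epsilon>)\<close>, and gives
  \<open>pq \<approx> const \<cdot> exp (-2\<Phi>/\<epsilon>)\<close> with \<open>\<Phi>' = \<kappa>\<close>. By Cauchy's theorem the imaginary part of \<open>\<Phi>\<close> at \<open>\<i>\<eta>\<close> is half of
  the action, so the real part of \<open>exp (\<i>S/\<epsilon>)\<close> must be \<open>O(\<epsilon>)\<close>.
\<close>

text \<open>The amplitudes of the two WKB modes are coupled by a term without a factor \<epsilon>,
  so a Gronwall bound alone leaves an error of order one; the change of variable by
  \<open>cor\<close> gains the missing power, because the two exponents differ by
  \<open>2 * kap / \<epsilon>\<close>. Square integrability is information on the real axis, while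
  the estimates live on the line. A vertical segment at abscissa \<open>X\<close> joins the two: as
  \<open>X\<close> grows with \<epsilon> fixed, \<open>f\<close> becomes negligible against
  \<epsilon>, and the segment merely rotates the recessive component by
  \<open>exp (- \<i> * \<mu> * \<eta> / \<epsilon>)\<close>. This rotation cancels the amount
  \<open>\<mu> * \<eta>\<close> that the same segment adds to the imaginary part of the phase, and
  the action is what remains. The modulus of the eigenfunction is never estimated: everything is
  measured relative to its value at \<open>X\<close>, of which only the phase matters. All constants
  depend on the lower end \<open>a\<close> of the range of \<mu>, through the height \<eta> and the
  lower bound \<open>d\<close> for the modulus of \<open>kap\<close>; that range always reaches up
  to \<open>A 0\<close>.\<close>

section \<open>Differential inequalities\<close>

text \<open>The product \<open>(E x + M) * exp (K x)\<close> is nondecreasing. The constant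
  \<open>M\<close> absorbs a source term, so that one lemma serves homogeneous and inhomogeneous
  inequalities.\<close>

lemma gronwall_backward:
  fixes E E' K k :: "real \<Rightarrow> real"
  assumes "a \<le> b" "continuous_on {a..b} E" "continuous_on {a..b} K"
    and E: "\<And>x. a < x \<Longrightarrow> x < b \<Longrightarrow> (E has_real_derivative E' x) (at x)"
    and K: "\<And>x. a < x \<Longrightarrow> x < b \<Longrightarrow> (K has_real_derivative k x) (at x)"
    and le: "\<And>x. a < x \<Longrightarrow> x < b \<Longrightarrow> - k x * (E x + M) \<le> E' x"
  shows "E a + M \<le> (E b + M) * exp (K b - K a)"
proof -
  have "(E a + M) * exp (K a) \<le> (E b + M) * exp (K b)"
  proof (rule DERIV_nonneg_imp_increasing_open[OF \<open>a \<le> b\<close>])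
    show "continuous_on {a..b} (\<lambda>x. (E x + M) * exp (K x))"
      by (intro continuous_intros assms)
    fix x assume x: "a < x" "x < b"
    have "((\<lambda>x. (E x + M) * exp (K x)) has_real_derivative (E' x + k x * (E x + M)) * exp (K x)) (at x)"
      by (rule derivative_eq_intros E K x refl | simp add: algebra_simps x)+
    moreover have "0 \<le> (E' x + k x * (E x + M)) * exp (K x)"
      using le[OF x] by simp
    ultimately show "\<exists>y. ((\<lambda>x. (E x + M) * exp (K x)) has_real_derivative y) (at x) \<and> 0 \<le> y"
      by blast
  qed
  then show ?thesis by (simp add: exp_diff field_simps)
qed

lemma gronwall_forward:
  fixes E E' K k :: "real \<Rightarrow> real"
  assumes "a \<le> b" "continuous_on {a..b} E" "continuous_on {a..b} K"
    and E: "\<And>x. a < x \<Longrightarrow> x < b \<Longrightarrow> (E has_real_derivative E' x) (at x)"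
    and K: "\<And>x. a < x \<Longrightarrow> x < b \<Longrightarrow> (K has_real_derivative k x) (at x)"
    and le: "\<And>x. a < x \<Longrightarrow> x < b \<Longrightarrow> E' x \<le> k x * E x"
  shows "E b \<le> E a * exp (K b - K a)"
proof -
  have "- E a + 0 \<le> (- E b + 0) * exp (- K b - - K a)"
    by (rule gronwall_backward[where E' = "\<lambda>x. - E' x" and k = "\<lambda>x. - k x"])
       (use assms in \<open>auto intro!: continuous_intros derivative_intros\<close>)
  then show ?thesis by (simp add: exp_diff exp_minus field_simps)
qed

lemma has_real_derivative_norm_power2:
  fixes f :: "real \<Rightarrow> complex"
  assumes "(f has_vector_derivative f') (at x)"
  shows "((\<lambda>x. (norm (f x))\<^sup>2) has_real_derivative 2 * (f x \<bullet> f')) (at x)"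
  unfolding power2_norm_eq_inner has_field_derivative_def
  using assms[unfolded has_vector_derivative_def]
  by (auto intro!: derivative_eq_intros simp: fun_eq_iff inner_commute algebra_simps)

lemma elementary_quadratic: "2 * (x\<^sup>2 + x * y) \<le> 3 * (x\<^sup>2 + y\<^sup>2)" for x y :: real
proof -
  have "3 * (x\<^sup>2 + y\<^sup>2) - 2 * (x\<^sup>2 + x * y) = (x - y)\<^sup>2 + 2 * y\<^sup>2"
    by (simp add: power2_eq_square algebra_simps)
  moreover have "0 \<le> (x - y)\<^sup>2 + 2 * y\<^sup>2" by simp
  ultimately show ?thesis by linarith
qed

text \<open>Integrated from \<open>b\<close> down to \<open>a\<close>, the term
  \<open>l x * u x\<close> can only decrease the norm of \<open>u\<close>, since
  \<open>Re (l x)\<close> is nonnegative; hence the constant depends on \<open>K0\<close> alone,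
  however large \<open>l\<close> is. The weights are graded: \<open>v\<close> acts on
  \<open>u\<close>, and on its own derivative, only with the factor \<open>e\<close>. A crude bound
  for both functions, a sharper one for \<open>u\<close> and an integration of \<open>h\<close>
  exploit this in turn.\<close>

lemma backward_connection:
  fixes u v l g h :: "real \<Rightarrow> complex" and K k :: "real \<Rightarrow> real"
  assumes "a < b" and cont: "continuous_on {a..b} u" "continuous_on {a..b} v" "continuous_on {a..b} K"
    and u: "\<And>x. a < x \<Longrightarrow> x < b \<Longrightarrow> (u has_vector_derivative l x * u x + g x) (at x)"
    and v: "\<And>x. a < x \<Longrightarrow> x < b \<Longrightarrow> (v has_vector_derivative h x) (at x)"
    and K: "\<And>x. a < x \<Longrightarrow> x < b \<Longrightarrow> (K has_real_derivative k x) (at x)"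
    and Re: "\<And>x. a < x \<Longrightarrow> x < b \<Longrightarrow> 0 \<le> Re (l x)"
    and g: "\<And>x. a < x \<Longrightarrow> x < b \<Longrightarrow> norm (g x) \<le> e * k x * (norm (u x) + norm (v x))"
    and h: "\<And>x. a < x \<Longrightarrow> x < b \<Longrightarrow> norm (h x) \<le> k x * (norm (u x) + e * norm (v x))"
    and k: "\<And>x. a < x \<Longrightarrow> x < b \<Longrightarrow> 0 \<le> k x"
    and e: "0 \<le> e" "e \<le> 1"
    and K0: "K b - K a \<le> K0"
  shows "norm (u a) \<le> (2 + 3 * K0) * exp (2 * K0) ^ 2 * (norm (u b) + e * norm (v b))"
    and "norm (v a - v b) \<le> (2 + 3 * K0) * exp (2 * K0) ^ 2 * (norm (u b) + e * norm (v b))"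
proof -
  define G where "G = exp (2 * K0)"
  define N where "N = G * (norm (u b) + norm (v b))"
  define D where "D = norm (u b) + e * norm (v b)"
  define U where "U = 2 * G\<^sup>2 * D"
  have Kmono: "K x \<le> K y" if "a \<le> x" "x \<le> y" "y \<le> b" for x y
  proof (rule DERIV_nonneg_imp_increasing_open[OF \<open>x \<le> y\<close>])
    show "continuous_on {x..y} K" using cont(3) by (rule continuous_on_subset) (use that in auto)
    fix z assume "x < z" "z < y"
    then show "\<exists>y. (K has_real_derivative y) (at z) \<and> 0 \<le> y"
      using K[of z] k[of z] that by auto
  qed
  have K00: "0 \<le> K0" using Kmono[of a b] \<open>a < b\<close> K0 by simp
  have G1: "1 \<le> G" unfolding G_def using K00 by simp
  have Dpos: "0 \<le> D" unfolding D_def using e by simp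
  have Kx: "0 \<le> K b - K x" "K b - K x \<le> K0" if "a \<le> x" "x \<le> b" for x
    using Kmono[of a x] Kmono[of x b] that K0 by auto
  have contx: "continuous_on {x..b} u" "continuous_on {x..b} v" "continuous_on {x..b} K" if "a \<le> x" for x
    using that by (auto intro: continuous_on_subset[OF cont(1)] continuous_on_subset[OF cont(2)] continuous_on_subset[OF cont(3)])
  \<comment> \<open>The energy of both functions together, with the small factor \<open>e\<close>
    bounded by 1.\<close>
  have N_bound: "norm (u x) \<le> N \<and> norm (v x) \<le> N" if x: "a \<le> x" "x \<le> b" for x
  proof -
    define E where "E = (\<lambda>x. (norm (u x))\<^sup>2 + (norm (v x))\<^sup>2)"
    have "E x + 0 \<le> (E b + 0) * exp (4 * K b - 4 * K x)"
    proof (rule gronwall_backward[where k = "\<lambda>x. 4 * k x" and K = "\<lambda>x. 4 * K x"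
          and E' = "\<lambda>x. 2 * (u x \<bullet> (l x * u x + g x)) + 2 * (v x \<bullet> h x)"])
      show "x \<le> b" by fact
      show "continuous_on {x..b} E" unfolding E_def
        by (intro continuous_intros contx x)
      show "continuous_on {x..b} (\<lambda>x. 4 * K x)"
        by (intro continuous_intros contx x)
      fix y assume y: "x < y" "y < b"
      then have y': "a < y" "y < b" using x by auto
      show "(E has_real_derivative 2 * (u y \<bullet> (l y * u y + g y)) + 2 * (v y \<bullet> h y)) (at y)"
        unfolding E_def by (intro DERIV_add has_real_derivative_norm_power2 u v y')
      show "((\<lambda>x. 4 * K x) has_real_derivative 4 * k y) (at y)"
        by (rule derivative_eq_intros K y' | simp)+
      \<comment> \<open>Only the real part of \<open>l y\<close> enters the energy, and its sign
        lets this term be dropped.\<close>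
      have 1: "u y \<bullet> (l y * u y) = Re (l y) * (norm (u y))\<^sup>2"
        unfolding inner_complex_def cmod_power2 by (simp add: algebra_simps power2_eq_square)
      have 2: "- (norm (u y) * norm (g y)) \<le> u y \<bullet> g y"
        using Cauchy_Schwarz_ineq2[of "u y" "g y"] by linarith
      have 3: "- (norm (v y) * norm (h y)) \<le> v y \<bullet> h y"
        using Cauchy_Schwarz_ineq2[of "v y" "h y"] by linarith
      have ek: "e * k y \<le> k y" "0 \<le> e * k y" using e k[OF y'] by (auto simp: mult_left_le_one_le)
      have 4: "norm (u y) * norm (g y) \<le> norm (u y) * (k y * (norm (u y) + norm (v y)))"
        using g[OF y'] mult_right_mono[OF ek(1), of "norm (u y) + norm (v y)"]
        by (intro mult_left_mono) auto
      have "norm (u y) + e * norm (v y) \<le> norm (u y) + norm (v y)"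
        using e by (simp add: mult_left_le_one_le)
      then have 5: "norm (v y) * norm (h y) \<le> norm (v y) * (k y * (norm (u y) + norm (v y)))"
        by (intro mult_left_mono order_trans[OF h[OF y']] k[OF y']) auto
      have 6: "2 * (norm (u y) * norm (v y)) \<le> (norm (u y))\<^sup>2 + (norm (v y))\<^sup>2"
        using sum_squares_bound[of "norm (u y)" "norm (v y)"] by simp
      have "norm (u y) * (k y * (norm (u y) + norm (v y))) + norm (v y) * (k y * (norm (u y) + norm (v y)))
        = k y * ((norm (u y))\<^sup>2 + (norm (v y))\<^sup>2 + 2 * (norm (u y) * norm (v y)))"
        by (simp add: algebra_simps power2_eq_square)
      also have "\<dots> \<le> k y * (2 * E y)"
        using 6 k[OF y'] unfolding E_def by (intro mult_left_mono) auto
      finally have 7: "norm (u y) * norm (g y) + norm (v y) * norm (h y) \<le> k y * (2 * E y)"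
        using 4 5 by linarith
      have 8: "0 \<le> Re (l y) * (norm (u y))\<^sup>2" using Re[OF y'] by simp
      have "u y \<bullet> (l y * u y + g y) + v y \<bullet> h y \<ge> - (k y * (2 * E y))"
        using 1 2 3 7 8 by (simp add: inner_add_right)
      then show "- (4 * k y) * (E y + 0) \<le> 2 * (u y \<bullet> (l y * u y + g y)) + 2 * (v y \<bullet> h y)"
        by (simp add: algebra_simps)
    qed
    also have "(E b + 0) * exp (4 * K b - 4 * K x) \<le> E b * G\<^sup>2"
    proof -
      have "exp (4 * K b - 4 * K x) \<le> G\<^sup>2" unfolding G_def power2_eq_square exp_add[symmetric]
        using Kx[OF x] by simp
      then show ?thesis unfolding E_def by (simp add: mult_left_mono)
    qed
    also have "\<dots> \<le> N\<^sup>2"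
      unfolding E_def N_def by (simp add: power_mult_distrib power2_sum mult.commute mult_left_mono)
    finally have "E x \<le> N\<^sup>2" by simp
    then have "(norm (u x))\<^sup>2 \<le> N\<^sup>2" "(norm (v x))\<^sup>2 \<le> N\<^sup>2"
      unfolding E_def by (smt (verit) zero_le_power2)+
    moreover have "0 \<le> N" unfolding N_def using G1 by simp
    ultimately show ?thesis using power2_le_imp_le by blast
  qed
  have N0: "0 \<le> N" using N_bound[of a] \<open>a < b\<close> by (smt (verit) norm_ge_zero)
  \<comment> \<open>Multiplied by \<open>e\<close>, the crude bound has the right size:
    \<open>v b\<close> regains its factor \<open>e\<close>, and the term in \<open>u b\<close> only
    shrinks.\<close>
  have eN: "e * N \<le> G * D"
  proof -
    have "e * N = G * (e * norm (u b) + e * norm (v b))" unfolding N_def by (simp add: algebra_simps)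
    also have "\<dots> \<le> G * D" unfolding D_def using e G1
      by (intro mult_left_mono) (auto simp: mult_left_le_one_le)
    finally show ?thesis .
  qed
  \<comment> \<open>Now \<open>v\<close> counts as a known source bounded by \<open>N\<close>; the
    shift \<open>M = (e * N)\<^sup>2\<close> closes the inequality for the energy of
    \<open>u\<close> alone.\<close>
  have U_bound: "norm (u x) \<le> U" if x: "a \<le> x" "x \<le> b" for x
  proof -
    define E where "E = (\<lambda>x. (norm (u x))\<^sup>2)"
    have "E x + (e * N)\<^sup>2 \<le> (E b + (e * N)\<^sup>2) * exp (3 * K b - 3 * K x)"
    proof (rule gronwall_backward[where k = "\<lambda>x. 3 * k x" and K = "\<lambda>x. 3 * K x"
          and E' = "\<lambda>x. 2 * (u x \<bullet> (l x * u x + g x))"])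
      show "x \<le> b" by fact
      show "continuous_on {x..b} E" unfolding E_def
        by (intro continuous_intros contx x)
      show "continuous_on {x..b} (\<lambda>x. 3 * K x)"
        by (intro continuous_intros contx x)
      fix y assume y: "x < y" "y < b"
      then have y': "a < y" "y < b" using x by auto
      show "(E has_real_derivative 2 * (u y \<bullet> (l y * u y + g y))) (at y)"
        unfolding E_def by (intro has_real_derivative_norm_power2 u y')
      show "((\<lambda>x. 3 * K x) has_real_derivative 3 * k y) (at y)"
        by (rule derivative_eq_intros K y' | simp)+
      have 1: "u y \<bullet> (l y * u y) = Re (l y) * (norm (u y))\<^sup>2"
        unfolding inner_complex_def cmod_power2 by (simp add: algebra_simps power2_eq_square)
      have 2: "- (norm (u y) * norm (g y)) \<le> u y \<bullet> g y"
        using Cauchy_Schwarz_ineq2[of "u y" "g y"] by linarith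
      have vN: "e * norm (v y) \<le> e * N" using N_bound[of y] y' e by (intro mult_left_mono) auto
      have "norm (g y) \<le> k y * (e * norm (u y) + e * norm (v y))"
        using g[OF y'] by (simp add: algebra_simps)
      also have "\<dots> \<le> k y * (norm (u y) + e * N)"
        using vN e k[OF y'] by (intro mult_left_mono add_mono vN) (auto simp: mult_left_le_one_le)
      finally have "norm (u y) * norm (g y) \<le> norm (u y) * (k y * (norm (u y) + e * N))"
        by (intro mult_left_mono) auto
      also have "\<dots> = k y * ((norm (u y))\<^sup>2 + norm (u y) * (e * N))"
        by (simp add: algebra_simps power2_eq_square)
      also have "2 * \<dots> \<le> k y * (3 * (E y + (e * N)\<^sup>2))"
      proof -
        have "2 * ((norm (u y))\<^sup>2 + norm (u y) * (e * N)) \<le> 3 * (E y + (e * N)\<^sup>2)"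
          using elementary_quadratic[of "norm (u y)" "e * N"] unfolding E_def by simp
        from mult_left_mono[OF this k[OF y']] show ?thesis by (simp add: algebra_simps)
      qed
      finally have 7: "2 * (norm (u y) * norm (g y)) \<le> k y * (3 * (E y + (e * N)\<^sup>2))" by simp
      have 8: "0 \<le> Re (l y) * (norm (u y))\<^sup>2" using Re[OF y'] by simp
      show "- (3 * k y) * (E y + (e * N)\<^sup>2) \<le> 2 * (u y \<bullet> (l y * u y + g y))"
        using 1 2 7 8 by (simp add: inner_add_right algebra_simps)
    qed
    also have "\<dots> \<le> (E b + (e * N)\<^sup>2) * G\<^sup>2"
    proof -
      have "exp (3 * K b - 3 * K x) \<le> G\<^sup>2" unfolding G_def power2_eq_square exp_add[symmetric]
        using Kx[OF x] by simp
      then show ?thesis unfolding E_def by (intro mult_left_mono) auto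
    qed
    also have "\<dots> \<le> (D\<^sup>2 + (G * D)\<^sup>2) * G\<^sup>2"
      unfolding E_def using e eN N0 unfolding D_def
      by (intro mult_right_mono add_mono power_mono) auto
    also have "\<dots> \<le> ((G * D)\<^sup>2 + (G * D)\<^sup>2) * G\<^sup>2"
      using Dpos mult_right_mono[OF G1 Dpos] by (intro mult_right_mono add_mono power_mono) auto
    also have "\<dots> \<le> U\<^sup>2" unfolding U_def by (simp add: power_mult_distrib algebra_simps)
    finally have "(norm (u x))\<^sup>2 \<le> U\<^sup>2"
      unfolding E_def by (smt (verit) zero_le_power2)
    moreover have "0 \<le> U" unfolding U_def using Dpos by simp
    ultimately show ?thesis using power2_le_imp_le by blast
  qed
  have GD: "G * D \<le> G\<^sup>2 * D" using G1 Dpos by (intro mult_right_mono) (auto simp: power2_eq_square)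
  have "norm (v b - v a) \<le> (U + G * D) * K b - (U + G * D) * K a"
  proof (rule differentiable_bound_general[OF \<open>a < b\<close> cont(2)])
    show "continuous_on {a..b} (\<lambda>x. (U + G * D) * K x)" by (intro continuous_intros cont)
    fix x assume x: "a < x" "x < b"
    show "(v has_vector_derivative h x) (at x)" by (intro v x)
    show "((\<lambda>x. (U + G * D) * K x) has_vector_derivative (U + G * D) * k x) (at x)"
      unfolding has_real_derivative_iff_has_vector_derivative[symmetric]
      by (rule derivative_eq_intros K x | simp)+
    have "e * norm (v x) \<le> e * N" using N_bound[of x] x e by (intro mult_left_mono) auto
    then have "norm (u x) + e * norm (v x) \<le> U + G * D" using U_bound[of x] eN x by auto
    then show "norm (h x) \<le> (U + G * D) * k x"
      using order_trans[OF h[OF x] mult_left_mono[OF _ k[OF x]], of "U + G * D"] by (simp add: mult.commute)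
  qed
  also have "\<dots> = (U + G * D) * (K b - K a)" by (simp add: algebra_simps)
  also have "\<dots> \<le> (U + G * D) * K0"
    using K0 G1 Dpos unfolding U_def by (intro mult_left_mono) auto
  also have "\<dots> \<le> (3 * G\<^sup>2 * D) * K0"
    using GD K00 unfolding U_def by (intro mult_right_mono) linarith+
  also have "\<dots> \<le> (2 + 3 * K0) * G\<^sup>2 * D" using Dpos by (simp add: algebra_simps)
  finally show "norm (v a - v b) \<le> (2 + 3 * K0) * exp (2 * K0) ^ 2 * (norm (u b) + e * norm (v b))"
    unfolding G_def D_def by (simp add: norm_minus_commute)
  have "norm (u a) \<le> U" using U_bound[of a] \<open>a < b\<close> by simp
  also have "\<dots> \<le> (2 + 3 * K0) * G\<^sup>2 * D" unfolding U_def using K00 Dpos by (simp add: algebra_simps)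
  finally show "norm (u a) \<le> (2 + 3 * K0) * exp (2 * K0) ^ 2 * (norm (u b) + e * norm (v b))"
    unfolding G_def D_def .
qed

section \<open>Linear systems in a convex complex domain\<close>

lemma linepath_primitive:
  assumes "open S" "convex S" "0 \<in> S" "h holomorphic_on S" "z \<in> S"
  shows "((\<lambda>z. contour_integral (linepath 0 z) h) has_field_derivative h z) (at z)"
proof -
  obtain g where g: "\<And>x. x \<in> S \<Longrightarrow> (g has_field_derivative h x) (at x within S)"
    using holomorphic_convex_primitive'[OF assms(2,1,4)] by blast
  have eq: "contour_integral (linepath 0 w) h = g w - g 0" if "w \<in> S" for w
  proof -
    have "closed_segment 0 w \<subseteq> S" using assms that by (simp add: closed_segment_subset)
    then have "path_image (linepath 0 w) \<subseteq> S" by simp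
    from contour_integral_primitive[OF g valid_path_linepath this]
    show ?thesis by (simp only: contour_integral_unique pathfinish_linepath pathstart_linepath)
  qed
  have "((\<lambda>z. g z - g 0) has_field_derivative h z) (at z)"
    using DERIV_diff[OF g[OF \<open>z \<in> S\<close>] DERIV_const[of "g 0"]] at_within_open[OF \<open>z \<in> S\<close> \<open>open S\<close>] by simp
  then show ?thesis
    by (rule has_field_derivative_transform_within_open[OF _ \<open>open S\<close> \<open>z \<in> S\<close>]) (simp add: eq)
qed

text \<open>Along the segment the integrand is at most a multiple of \<open>t ^ n\<close>, and
  integration yields the divisor \<open>Suc n\<close>; repeated, these divisors build the factorial
  of the Picard series.\<close>

lemma norm_linepath_integral_power_le:
  assumes "open S" "convex S" "0 \<in> S" "h holomorphic_on S" "z \<in> S"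
    and le: "\<And>w. w \<in> S \<Longrightarrow> norm (h w) \<le> C * norm w ^ n"
  shows "norm (contour_integral (linepath 0 z) h) \<le> C * norm z ^ Suc n / real (Suc n)"
proof -
  define J where "J = (\<lambda>z. contour_integral (linepath 0 z) h)"
  have seg: "of_real t * z \<in> S" if "0 \<le> t" "t \<le> 1" for t :: real
  proof -
    have "of_real t * z \<in> closed_segment 0 z" using that by (auto simp: closed_segment_def scaleR_conv_of_real)
    then show ?thesis using closed_segment_subset assms by blast
  qed
  have der: "((\<lambda>t. J (of_real t * z)) has_vector_derivative (z * h (of_real t * z))) (at t)"
    if "0 \<le> t" "t \<le> 1" for t :: real
  proof -
    have "((\<lambda>t. of_real t * z) has_vector_derivative z) (at t)"
      by (auto intro!: derivative_eq_intros simp: has_vector_derivative_def scaleR_conv_of_real)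
    from field_vector_diff_chain_at[OF this linepath_primitive[OF assms(1-4) seg[OF that]]]
    show ?thesis unfolding J_def o_def by simp
  qed
  have "norm (J (of_real 1 * z) - J (of_real 0 * z)) 
     \<le> C * norm z ^ Suc n / real (Suc n) * 1 ^ Suc n - C * norm z ^ Suc n / real (Suc n) * 0 ^ Suc n"
  proof (rule differentiable_bound_general[where f = "\<lambda>t. J (of_real t * z)" and \<phi> = "\<lambda>t. C * norm z ^ Suc n / real (Suc n) * t ^ Suc n"])
    show "continuous_on {0..1} (\<lambda>t. J (of_real t * z))"
      by (intro continuous_at_imp_continuous_on ballI has_vector_derivative_continuous[OF der]) auto
    show "continuous_on {0..1} (\<lambda>t. C * norm z ^ Suc n / real (Suc n) * t ^ Suc n)"
      by (intro continuous_intros)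
    fix t :: real assume t: "0 < t" "t < 1"
    show "((\<lambda>t. J (of_real t * z)) has_vector_derivative (z * h (of_real t * z))) (at t)"
      using der t by simp
    show "((\<lambda>t. C * norm z ^ Suc n / real (Suc n) * t ^ Suc n) has_vector_derivative C * norm z ^ Suc n * t ^ n) (at t)"
      unfolding has_real_derivative_iff_has_vector_derivative[symmetric]
      by (rule derivative_eq_intros refl | simp del: power_Suc)+
    have "norm (z * h (of_real t * z)) \<le> norm z * (C * norm (of_real t * z) ^ n)"
      unfolding norm_mult[of z] using t by (intro mult_left_mono le seg) auto
    then show "norm (z * h (of_real t * z)) \<le> C * norm z ^ Suc n * t ^ n"
      using t by (simp add: norm_mult power_mult_distrib algebra_simps)
  qed simp
  then show ?thesis by (simp add: J_def)
qed

text \<open>Picard iteration, summed as a series. The domain may be unbounded, but bounded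
  coefficients and the factorials in the denominators make the series converge locally uniformly, so
  that it can be differentiated term by term.\<close>

lemma holomorphic_linear_system:
  fixes a1 a2 :: "complex \<Rightarrow> complex"
  assumes S: "open S" "convex S" "0 \<in> S"
    and hol: "a1 holomorphic_on S" "a2 holomorphic_on S"
    and bound: "\<And>z. z \<in> S \<Longrightarrow> norm (a1 z) \<le> K" "\<And>z. z \<in> S \<Longrightarrow> norm (a2 z) \<le> K"
  obtains p q where "\<And>z. z \<in> S \<Longrightarrow> (p has_field_derivative a1 z * q z) (at z)"
    and "\<And>z. z \<in> S \<Longrightarrow> (q has_field_derivative a2 z * p z) (at z)"
    and "p 0 = p0" "q 0 = q0"
proof -
  \<comment> \<open>\<open>U n\<close> is the n-th increment of the iteration, not the n-th iterate;
    the solution is the sum over \<open>n\<close>.\<close>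
  define U where "U = rec_nat (\<lambda>_. p0, \<lambda>_. q0) 
    (\<lambda>n U. (\<lambda>z. contour_integral (linepath 0 z) (\<lambda>w. a1 w * snd U w), \<lambda>z. contour_integral (linepath 0 z) (\<lambda>w. a2 w * fst U w)))"
  have U0: "U 0 = (\<lambda>_. p0, \<lambda>_. q0)" and USuc: "U (Suc n) = (\<lambda>z. contour_integral (linepath 0 z) (\<lambda>w. a1 w * snd (U n) w), \<lambda>z. contour_integral (linepath 0 z) (\<lambda>w. a2 w * fst (U n) w))" for n
    unfolding U_def by simp_all
  define P where "P = (\<lambda>n. fst (U n))"
  define Q where "Q = (\<lambda>n. snd (U n))"
  define P' where "P' = (\<lambda>n z. case n of 0 \<Rightarrow> 0 | Suc n \<Rightarrow> a1 z * Q n z)"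
  define Q' where "Q' = (\<lambda>n z. case n of 0 \<Rightarrow> 0 | Suc n \<Rightarrow> a2 z * P n z)"
  define B where "B = norm p0 + norm q0"
  have K: "0 \<le> K" using bound(1)[OF S(3)] norm_ge_zero order_trans by blast
  have main: "P n holomorphic_on S \<and> Q n holomorphic_on S \<and> 
     (\<forall>z\<in>S. norm (P n z) \<le> B * (K * norm z) ^ n / fact n \<and> norm (Q n z) \<le> B * (K * norm z) ^ n / fact n)" for n
  proof (induction n)
    case 0
    show ?case by (simp add: P_def Q_def U0 B_def)
  next
    case (Suc n)
    have h1: "(\<lambda>w. a1 w * Q n w) holomorphic_on S" and h2: "(\<lambda>w. a2 w * P n w) holomorphic_on S"
      using Suc hol by (auto intro!: holomorphic_intros)
    have eq: "P (Suc n) = (\<lambda>z. contour_integral (linepath 0 z) (\<lambda>w. a1 w * Q n w))"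
       "Q (Suc n) = (\<lambda>z. contour_integral (linepath 0 z) (\<lambda>w. a2 w * P n w))"
      by (simp_all add: P_def Q_def USuc)
    have "P (Suc n) holomorphic_on S" "Q (Suc n) holomorphic_on S"
      unfolding eq using linepath_primitive[OF S h1] linepath_primitive[OF S h2] S(1)
      by (auto simp: holomorphic_on_open)
    moreover have "norm (P (Suc n) z) \<le> B * (K * norm z) ^ Suc n / fact (Suc n)" if "z \<in> S" for z
    proof -
      have "norm (a1 w * Q n w) \<le> K * (B * (K * norm w) ^ n / fact n)" if "w \<in> S" for w
        unfolding norm_mult using Suc that bound K by (intro mult_mono) auto
      then have "norm (a1 w * Q n w) \<le> (K * B * K ^ n / fact n) * norm w ^ n" if "w \<in> S" for w
        using that by (simp add: power_mult_distrib algebra_simps)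
      from norm_linepath_integral_power_le[OF S h1 that this]
      show ?thesis unfolding eq by (simp add: power_mult_distrib field_simps)
    qed
    moreover have "norm (Q (Suc n) z) \<le> B * (K * norm z) ^ Suc n / fact (Suc n)" if "z \<in> S" for z
    proof -
      have "norm (a2 w * P n w) \<le> K * (B * (K * norm w) ^ n / fact n)" if "w \<in> S" for w
        unfolding norm_mult using Suc that bound K by (intro mult_mono) auto
      then have "norm (a2 w * P n w) \<le> (K * B * K ^ n / fact n) * norm w ^ n" if "w \<in> S" for w
        using that by (simp add: power_mult_distrib algebra_simps)
      from norm_linepath_integral_power_le[OF S h2 that this]
      show ?thesis unfolding eq by (simp add: power_mult_distrib field_simps)
    qed
    ultimately show ?case by blast
  qed
  have derP: "(P n has_field_derivative P' n z) (at z)" if "z \<in> S" for n z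
  proof (cases n)
    case 0 then show ?thesis by (simp add: P_def U0 P'_def)
  next
    case (Suc m)
    have "(\<lambda>w. a1 w * Q m w) holomorphic_on S" using main[of m] hol by (auto intro!: holomorphic_intros)
    from linepath_primitive[OF S this that] show ?thesis
      unfolding Suc P'_def by (simp add: P_def Q_def USuc)
  qed
  have derQ: "(Q n has_field_derivative Q' n z) (at z)" if "z \<in> S" for n z
  proof (cases n)
    case 0 then show ?thesis by (simp add: Q_def U0 Q'_def)
  next
    case (Suc m)
    have "(\<lambda>w. a2 w * P m w) holomorphic_on S" using main[of m] hol by (auto intro!: holomorphic_intros)
    from linepath_primitive[OF S this that] show ?thesis
      unfolding Suc Q'_def by (simp add: P_def Q_def USuc)
  qed
  \<comment> \<open>A majorant valid on the whole unit ball around \<open>x\<close>, hence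
    \<open>norm x + 1\<close>. It is complex valued to fit the comparison theorem for series of
    holomorphic functions.\<close>
  define h where "h = (\<lambda>(x::complex) n. of_real (B * (K * (norm x + 1)) ^ n / fact n) :: complex)"
  have B0: "0 \<le> B" by (simp add: B_def)
  have hsum: "summable (h x)" and hpos: "range (h x) \<subseteq> \<real>\<^sub>\<ge>\<^sub>0" for x
  proof -
    have "summable (\<lambda>n. B * (inverse (fact n) * (K * (norm x + 1)) ^ n))"
      by (intro summable_mult summable_exp)
    then show "summable (h x)" unfolding h_def by (intro summable_of_real) (simp add: field_simps)
    show "range (h x) \<subseteq> \<real>\<^sub>\<ge>\<^sub>0" unfolding h_def using B0 K by (auto simp: nonneg_Reals_of_real_iff simp del: of_real_divide of_real_mult of_real_power of_real_add)
  qed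
  have hle: "B * (K * norm y) ^ n / fact n \<le> norm (h x n)" if "y \<in> ball x 1" for x y n
  proof -
    have "norm y \<le> norm x + 1" using that norm_triangle_ineq2[of y x] by (simp add: dist_norm norm_minus_commute)
    then have "B * (K * norm y) ^ n / fact n \<le> B * (K * (norm x + 1)) ^ n / fact n"
      using B0 K by (intro divide_right_mono mult_left_mono power_mono) auto
    also have "\<dots> = norm (h x n)" unfolding h_def using B0 K by (simp add: norm_mult norm_divide norm_power del: of_real_add) 
    finally show ?thesis .
  qed
  have "\<exists>g g'. \<forall>x \<in> S. ((\<lambda>n. P n x) sums g x) \<and> ((\<lambda>n. P' n x) sums g' x) \<and> (g has_field_derivative g' x) (at x)"
  proof (rule series_and_derivative_comparison_complex[OF S(1) derP])
    fix x assume "x \<in> S"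
    have "cmod (P n y) \<le> cmod (h x n)" if "y \<in> ball x 1 \<inter> S" for y n
      using that hle[of y x n] main[of n] by (auto intro: order_trans)
    then have "\<forall>\<^sub>F n in sequentially. \<forall>y\<in>ball x 1 \<inter> S. cmod (P n y) \<le> cmod (h x n)"
      by (simp add: always_eventually)
    then show "\<exists>d h. 0 < d \<and> summable h \<and> range h \<subseteq> \<real>\<^sub>\<ge>\<^sub>0 \<and> (\<forall>\<^sub>F n in sequentially. \<forall>y\<in>ball x d \<inter> S. cmod (P n y) \<le> cmod (h n))"
      using hsum[of x] hpos[of x] zero_less_one by blast
  qed
  then obtain p p' where p: "\<And>x. x \<in> S \<Longrightarrow> (\<lambda>n. P n x) sums p x" "\<And>x. x \<in> S \<Longrightarrow> (\<lambda>n. P' n x) sums p' x" 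
     "\<And>x. x \<in> S \<Longrightarrow> (p has_field_derivative p' x) (at x)" by blast
  have "\<exists>g g'. \<forall>x \<in> S. ((\<lambda>n. Q n x) sums g x) \<and> ((\<lambda>n. Q' n x) sums g' x) \<and> (g has_field_derivative g' x) (at x)"
  proof (rule series_and_derivative_comparison_complex[OF S(1) derQ])
    fix x assume "x \<in> S"
    have "cmod (Q n y) \<le> cmod (h x n)" if "y \<in> ball x 1 \<inter> S" for y n
      using that hle[of y x n] main[of n] by (auto intro: order_trans)
    then have "\<forall>\<^sub>F n in sequentially. \<forall>y\<in>ball x 1 \<inter> S. cmod (Q n y) \<le> cmod (h x n)"
      by (simp add: always_eventually)
    then show "\<exists>d h. 0 < d \<and> summable h \<and> range h \<subseteq> \<real>\<^sub>\<ge>\<^sub>0 \<and> (\<forall>\<^sub>F n in sequentially. \<forall>y\<in>ball x d \<inter> S. cmod (Q n y) \<le> cmod (h n))"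
      using hsum[of x] hpos[of x] zero_less_one by blast
  qed
  then obtain q q' where q: "\<And>x. x \<in> S \<Longrightarrow> (\<lambda>n. Q n x) sums q x" "\<And>x. x \<in> S \<Longrightarrow> (\<lambda>n. Q' n x) sums q' x" 
     "\<And>x. x \<in> S \<Longrightarrow> (q has_field_derivative q' x) (at x)" by blast
  have "p' x = a1 x * q x" if "x \<in> S" for x
  proof -
    \<comment> \<open>Differentiation lowers the index by one; the constant zeroth term has
      derivative 0, so the shifted series has the same sum.\<close>
    have "(\<lambda>n. P' (Suc n) x) sums (a1 x * q x)" using sums_mult[OF q(1)[OF that], of "a1 x"] by (simp add: P'_def)
    then have "(\<lambda>n. P' n x) sums (a1 x * q x)" by (subst (asm) sums_Suc_iff) (simp add: P'_def)
    then show ?thesis using p(2)[OF that] sums_unique2 by blast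
  qed
  moreover have "q' x = a2 x * p x" if "x \<in> S" for x
  proof -
    have "(\<lambda>n. Q' (Suc n) x) sums (a2 x * p x)" using sums_mult[OF p(1)[OF that], of "a2 x"] by (simp add: Q'_def)
    then have "(\<lambda>n. Q' n x) sums (a2 x * p x)" by (subst (asm) sums_Suc_iff) (simp add: Q'_def)
    then show ?thesis using q(2)[OF that] sums_unique2 by blast
  qed
  moreover have "p 0 = p0"
  proof -
    have "(\<lambda>n. P (Suc n) 0) sums 0" by (simp add: P_def USuc)
    then have "(\<lambda>n. P n 0) sums p0" by (subst (asm) sums_Suc_iff) (simp add: P_def U0)
    then show ?thesis using p(1)[OF S(3)] sums_unique2 by blast
  qed
  moreover have "q 0 = q0"
  proof -
    have "(\<lambda>n. Q (Suc n) 0) sums 0" by (simp add: Q_def USuc)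
    then have "(\<lambda>n. Q n 0) sums q0" by (subst (asm) sums_Suc_iff) (simp add: Q_def U0)
    then show ?thesis using q(1)[OF S(3)] sums_unique2 by blast
  qed
  ultimately show ?thesis using that[of p q] p(3) q(3) by simp
qed

section \<open>Holomorphic functions on a strip\<close>

abbreviation strip :: "real \<Rightarrow> complex set" where "strip \<rho> \<equiv> {z. \<bar>Im z\<bar> < \<rho>}"

lemma open_strip [simp]: "open (strip \<rho>)"
proof -
  have "strip \<rho> = {z. Im z < \<rho>} \<inter> {z. Im z > - \<rho>}" by auto
  then show ?thesis by (simp add: open_halfspace_Im_lt open_halfspace_Im_gt open_Int)
qed

lemma convex_strip [simp]: "convex (strip \<rho>)"
proof -
  have "strip \<rho> = {z. Im z < \<rho>} \<inter> {z. Im z > - \<rho>}" by auto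
  then show ?thesis by (simp add: convex_halfspace_Im_lt convex_halfspace_Im_gt convex_Int)
qed

lemma strip_subset_sectorD: "strip \<rho> \<subseteq> sectorD \<rho> \<theta>"
  by (auto simp: sectorD_def)

text \<open>Cauchy's inequality on discs of fixed radius. The hypothesis concerns large
  \<open>z\<close> only, and on a compact rectangle \<open>f\<close> is bounded anyway; the weight
  \<open>1 + \<bar>Re z\<bar>\<close> treats both regions at once. The strip shrinks to one half to
  have that rectangle inside the domain, and to a quarter to leave room for the discs.\<close>

lemma strip_derivative_decay:
  assumes \<rho>: "0 < \<rho>" and \<sigma>: "0 \<le> \<sigma>" and hol: "f holomorphic_on strip \<rho>"
    and decay: "\<And>z. z \<in> strip \<rho> \<Longrightarrow> R \<le> norm z \<Longrightarrow> norm (f z) \<le> C * norm z powr (-\<sigma>)"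
  shows "\<exists>C. \<forall>z \<in> strip (\<rho>/4). norm ((deriv ^^ n) f z) \<le> C * (1 + \<bar>Re z\<bar>) powr (-\<sigma>)"
proof -
  define R1 where "R1 = max 1 R"
  define S where "S = cbox (Complex (-R1) (-\<rho>/2)) (Complex R1 (\<rho>/2))"
  have "compact (f ` S)"
    by (rule compact_continuous_image[OF continuous_on_subset[OF holomorphic_on_imp_continuous_on[OF hol]]])
       (use \<rho> in \<open>auto simp: S_def in_cbox_complex_iff\<close>)
  then have "bounded (f ` S)" by (rule compact_imp_bounded)
  then obtain B where B: "\<And>z. z \<in> S \<Longrightarrow> norm (f z) \<le> B"
    unfolding bounded_iff by auto
  have R1: "1 \<le> R1" "R \<le> R1" by (auto simp: R1_def)
  have B0: "0 \<le> B"
    using R1 \<rho> by (intro order_trans[OF norm_ge_zero B[of 0]]) (auto simp: S_def in_cbox_complex_iff)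
  have shrink: "x powr (-\<sigma>) \<le> 2 powr \<sigma> * y powr (-\<sigma>)" if "0 < y" "y \<le> 2 * x" for x y :: real
  proof -
    have "x powr (-\<sigma>) \<le> (y / 2) powr (-\<sigma>)" using that \<sigma> by (intro powr_mono2') auto
    also have "\<dots> = 2 powr \<sigma> * y powr (-\<sigma>)" using that by (simp add: powr_divide powr_minus field_simps)
    finally show ?thesis .
  qed
  define C1 where "C1 = \<bar>C\<bar> * 2 powr \<sigma> + B * (1 + R1) powr \<sigma>"
  have C1: "0 \<le> C1" using B0 by (simp add: C1_def)
  have dec: "norm (f z) \<le> C1 * (1 + \<bar>Re z\<bar>) powr (-\<sigma>)" if z: "z \<in> strip (\<rho>/2)" for z
  proof (cases "\<bar>Re z\<bar> \<le> R1")
    case True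
    then have "z \<in> S" using z by (auto simp: S_def in_cbox_complex_iff)
    then have "norm (f z) \<le> B" by (rule B)
    also have "\<dots> = B * (1 + R1) powr \<sigma> * (1 + R1) powr (-\<sigma>)" using R1 by (simp add: powr_minus)
    also have "\<dots> \<le> C1 * (1 + \<bar>Re z\<bar>) powr (-\<sigma>)"
      using True \<sigma> B0 unfolding C1_def by (intro mult_mono powr_mono2') auto
    finally show ?thesis .
  next
    case False
    then have "norm z \<ge> R1" using abs_Re_le_cmod[of z] by linarith
    then have "norm (f z) \<le> C * norm z powr (-\<sigma>)" using decay[of z] z R1 \<rho> by auto
    also have "\<dots> \<le> \<bar>C\<bar> * norm z powr (-\<sigma>)" by (intro mult_right_mono) auto
    also have "\<dots> \<le> \<bar>C\<bar> * (2 powr \<sigma> * (1 + \<bar>Re z\<bar>) powr (-\<sigma>))"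
      using False R1 abs_Re_le_cmod[of z] by (intro mult_left_mono shrink) auto
    also have "\<dots> \<le> C1 * (1 + \<bar>Re z\<bar>) powr (-\<sigma>)"
      using B0 unfolding C1_def by (simp add: algebra_simps)
    finally show ?thesis .
  qed
  \<comment> \<open>Radius at most \<open>\<rho>/4\<close> keeps the disc inside the strip of half
    the width; radius at most 1/2 changes the weight by a factor of at most 2, at the cost of
    \<open>2 powr \<sigma>\<close>.\<close>
  define r where "r = min (\<rho>/4) (1/2)"
  have r: "0 < r" "r \<le> \<rho>/4" "r \<le> 1/2" using \<rho> by (auto simp: r_def)
  show ?thesis
  proof (intro exI ballI)
    fix z assume z: "z \<in> strip (\<rho>/4)"
    have sub: "cball z r \<subseteq> strip (\<rho>/2)"
    proof
      fix w assume "w \<in> cball z r"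
      then have "norm (w - z) \<le> r" by (simp add: dist_norm norm_minus_commute)
      then have "\<bar>Im w - Im z\<bar> \<le> r" using abs_Im_le_cmod[of "w - z"] by simp
      then show "w \<in> strip (\<rho>/2)" using z r by auto
    qed
    have "norm ((deriv ^^ n) f z) \<le> fact n * (C1 * (2 powr \<sigma> * (1 + \<bar>Re z\<bar>) powr (-\<sigma>))) / r ^ n"
    proof (rule Cauchy_inequality[OF _ _ r(1)])
      show "f holomorphic_on ball z r"
        by (rule holomorphic_on_subset[OF hol]) (use sub ball_subset_cball[of z r] \<rho> in fastforce)
      show "continuous_on (cball z r) f"
        by (rule continuous_on_subset[OF holomorphic_on_imp_continuous_on[OF hol]]) (use sub \<rho> in fastforce)
      fix w assume w: "norm (z - w) = r"
      then have "w \<in> strip (\<rho>/2)" using sub by (auto simp: dist_norm)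
      from dec[OF this] have "norm (f w) \<le> C1 * (1 + \<bar>Re w\<bar>) powr (-\<sigma>)" .
      also have "\<dots> \<le> C1 * (2 powr \<sigma> * (1 + \<bar>Re z\<bar>) powr (-\<sigma>))"
      proof (intro mult_left_mono[OF _ C1] shrink)
        have "\<bar>Re z - Re w\<bar> \<le> 1/2" using w r abs_Re_le_cmod[of "z - w"] by simp
        then show "1 + \<bar>Re z\<bar> \<le> 2 * (1 + \<bar>Re w\<bar>)"
          using abs_triangle_ineq2[of "Re z" "Re w"] abs_ge_zero[of "Re w"] by (smt (verit) field_sum_of_halves)
      qed auto
      finally show "norm (f w) \<le> C1 * (2 powr \<sigma> * (1 + \<bar>Re z\<bar>) powr (-\<sigma>))" .
    qed
    then show "norm ((deriv ^^ n) f z) \<le> (fact n * C1 * 2 powr \<sigma> / r ^ n) * (1 + \<bar>Re z\<bar>) powr (-\<sigma>)"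
      by (simp add: algebra_simps)
  qed
qed

text \<open>The identity theorem: the real axis accumulates at 0, a point of the connected
  strip.\<close>

lemma strip_identity:
  assumes "0 < \<rho>" "g holomorphic_on strip \<rho>" "h holomorphic_on strip \<rho>"
    and eq: "\<And>x. g (of_real x) = h (of_real x)" and "z \<in> strip \<rho>"
  shows "g z = h z"
proof -
  have "g z - h z = 0"
  proof (rule analytic_continuation[where f = "\<lambda>z. g z - h z" and w = z and S = "strip \<rho>" and U = "range of_real" and \<xi> = 0])
    show "(\<lambda>z. g z - h z) holomorphic_on strip \<rho>" using assms by (intro holomorphic_intros)
    show "connected (strip \<rho>)" by (simp add: convex_connected)
    show "(0::complex) islimpt range of_real"
      unfolding islimpt_def
    proof (intro allI impI)
      fix T :: "complex set" assume "0 \<in> T" "open T"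
      then obtain e where e: "0 < e" "ball 0 e \<subseteq> T" using open_contains_ball by blast
      then show "\<exists>y\<in>range of_real. y \<in> T \<and> y \<noteq> 0"
        by (intro bexI[of _ "of_real (e/2)"]) (auto simp: subset_eq simp del: of_real_divide)
    qed
  qed (use assms in auto)
  then show ?thesis by simp
qed

lemma cnj_symmetric_holomorphic:
  assumes "f holomorphic_on strip \<rho>"
  shows "(\<lambda>z. cnj (f (cnj z))) holomorphic_on strip \<rho>"
proof -
  have "((\<lambda>z. cnj (f (cnj z))) has_field_derivative cnj (deriv f (cnj z))) (at z)" if "z \<in> strip \<rho>" for z
    using has_field_derivative_cnj_cnj[of f "deriv f (cnj z)" z] holomorphic_derivI[OF assms open_strip, of "cnj z"] that
    by (simp add: o_def)
  then show ?thesis by (auto simp: holomorphic_on_open)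
qed

text \<open>Schwarz reflection: \<open>cnj (f (cnj z))\<close> is holomorphic and agrees with
  \<open>f\<close> on the real axis.\<close>

lemma strip_cnj:
  assumes "0 < \<rho>" "f holomorphic_on strip \<rho>" "\<And>x. f (of_real x) = of_real (B x)" "z \<in> strip \<rho>"
  shows "f (cnj z) = cnj (f z)"
proof -
  have "cnj (f (cnj z)) = f z"
    by (rule strip_identity[OF assms(1) cnj_symmetric_holomorphic[OF assms(2)] assms(2) _ assms(4)]) (simp add: assms(3))
  then show ?thesis by (metis complex_cnj_cnj)
qed

lemma holomorphic_minus_arg: "f holomorphic_on strip \<rho> \<Longrightarrow> (\<lambda>z. f (- z)) holomorphic_on strip \<rho>"
  using holomorphic_on_compose_gen[of uminus "strip \<rho>" f "strip \<rho>", OF holomorphic_on_minus[OF holomorphic_on_ident]]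
  by (simp add: o_def image_subset_iff)

lemma strip_even:
  assumes "0 < \<rho>" "f holomorphic_on strip \<rho>" "\<And>x. f (of_real x) = of_real (B x)" "\<And>x. B (-x) = B x" "z \<in> strip \<rho>"
  shows "f (- z) = f z"
proof (rule strip_identity[OF assms(1) holomorphic_minus_arg[OF assms(2)] assms(2) _ assms(5)])
  show "f (- of_real x) = f (of_real x)" for x
    using assms(3)[of "-x"] by (simp add: assms(3,4))
qed

lemma strip_odd:
  assumes "0 < \<rho>" "f holomorphic_on strip \<rho>" "\<And>x. f (of_real x) = of_real (B x)" "\<And>x. B (-x) = - B x" "z \<in> strip \<rho>"
  shows "f (- z) = - f z"
proof (rule strip_identity[OF assms(1) holomorphic_minus_arg[OF assms(2)] _ _ assms(5), where h = "\<lambda>z. - f z"])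
  show "(\<lambda>z. - f z) holomorphic_on strip \<rho>" using assms by (intro holomorphic_intros)
  show "f (- of_real x) = - f (of_real x)" for x
    using assms(3)[of "-x"] by (simp add: assms(3,4))
qed

lemma deriv_real_on_reals:
  assumes "0 < \<rho>" "f holomorphic_on strip \<rho>" and real: "\<And>x. f (of_real x) = of_real (B x)"
  shows "(B has_real_derivative Re (deriv f (of_real x))) (at x)"
    and "deriv f (of_real x) = of_real (deriv B x)"
proof -
  have "(f has_field_derivative deriv f (of_real x)) (at (of_real x))"
    by (rule holomorphic_derivI[OF assms(2) open_strip]) (use assms in simp)
  from field_vector_diff_chain_at[where f = of_real and f' = 1, OF _ this]
  have "((\<lambda>x. f (of_real x)) has_vector_derivative deriv f (of_real x)) (at x)"
    by (simp add: o_def has_vector_derivative_def scaleR_conv_of_real bounded_linear_imp_has_derivative bounded_linear_of_real)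
  then have v: "((\<lambda>x. of_real (B x) :: complex) has_vector_derivative deriv f (of_real x)) (at x)"
    by (simp add: real)
  have "((\<lambda>x. Re (of_real (B x))) has_vector_derivative Re (deriv f (of_real x))) (at x)"
    by (rule bounded_linear.has_vector_derivative[OF bounded_linear_Re v])
  then show d: "(B has_real_derivative Re (deriv f (of_real x))) (at x)"
    by (simp add: has_real_derivative_iff_has_vector_derivative)
  have "((\<lambda>x. Im (of_real (B x))) has_vector_derivative Im (deriv f (of_real x))) (at x)"
    by (rule bounded_linear.has_vector_derivative[OF bounded_linear_Im v])
  then have "((\<lambda>x. 0) has_vector_derivative Im (deriv f (of_real x))) (at x)" by simp
  from vector_derivative_unique_at[OF this has_vector_derivative_const]
  have "Im (deriv f (of_real x)) = 0" .
  then show "deriv f (of_real x) = of_real (deriv B x)"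
    using DERIV_imp_deriv[OF d] by (simp add: complex_eq_iff)
qed

section \<open>Mean value theorems on horizontal and vertical lines\<close>

lemma holomorphic_horizontal_derivative:
  assumes "g holomorphic_on strip \<rho>" "\<bar>y\<bar> < \<rho>"
  shows "((\<lambda>x. g (Complex x y)) has_vector_derivative deriv g (Complex x y)) (at x)"
proof -
  have "((\<lambda>x. Complex x y) has_vector_derivative 1) (at x)"
    unfolding Complex_eq has_vector_derivative_def by (auto intro!: derivative_eq_intros simp: scaleR_conv_of_real)
  from field_vector_diff_chain_at[OF this holomorphic_derivI[OF assms(1) open_strip]]
  show ?thesis using assms by (simp add: o_def)
qed

lemma holomorphic_vertical_derivative:
  assumes "g holomorphic_on strip \<rho>" "\<bar>y\<bar> < \<rho>"
  shows "((\<lambda>y. g (Complex x y)) has_vector_derivative \<i> * deriv g (Complex x y)) (at y)"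
proof -
  have "((\<lambda>y. Complex x y) has_vector_derivative \<i>) (at y)"
    unfolding Complex_eq has_vector_derivative_def by (auto intro!: derivative_eq_intros simp: scaleR_conv_of_real)
  from field_vector_diff_chain_at[OF this holomorphic_derivI[OF assms(1) open_strip]]
  show ?thesis using assms by (simp add: o_def)
qed

lemma mvt_horizontal_Im:
  assumes "g holomorphic_on strip \<rho>" "\<bar>y\<bar> < \<rho>" "x1 < x2"
  obtains \<xi> where "x1 < \<xi>" "\<xi> < x2" "Im (g (Complex x2 y)) - Im (g (Complex x1 y)) = (x2 - x1) * Im (deriv g (Complex \<xi> y))"
proof -
  have "((\<lambda>x. Im (g (Complex x y))) has_real_derivative Im (deriv g (Complex x y))) (at x)" for x
    using bounded_linear.has_vector_derivative[OF bounded_linear_Im holomorphic_horizontal_derivative[OF assms(1,2)]]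
    by (simp add: has_real_derivative_iff_has_vector_derivative)
  from MVT2[OF assms(3) this] that show ?thesis by blast
qed

text \<open>By the Cauchy-Riemann equations, moving upwards changes the imaginary part at the rate
  \<open>Re (deriv g)\<close> and the real part at the rate \<open>- Im (deriv g)\<close>. Each
  component has its own intermediate point.\<close>

lemma mvt_vertical:
  assumes "g holomorphic_on strip \<rho>" "- \<rho> < y1" "y1 < y2" "y2 < \<rho>"
  obtains \<xi> \<zeta> where "y1 < \<xi>" "\<xi> < y2" "Im (g (Complex x y2)) - Im (g (Complex x y1)) = (y2 - y1) * Re (deriv g (Complex x \<xi>))"
    "y1 < \<zeta>" "\<zeta> < y2" "Re (g (Complex x y2)) - Re (g (Complex x y1)) = - (y2 - y1) * Im (deriv g (Complex x \<zeta>))"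
proof -
  have "((\<lambda>y. Im (g (Complex x y))) has_real_derivative Re (deriv g (Complex x y))) (at y)" if "y1 \<le> y" "y \<le> y2" for y
    using bounded_linear.has_vector_derivative[OF bounded_linear_Im holomorphic_vertical_derivative[OF assms(1), of y x]] that assms
    by (simp add: has_real_derivative_iff_has_vector_derivative)
  from MVT2[OF assms(3) this] obtain \<xi> where 1: "y1 < \<xi>" "\<xi> < y2" "Im (g (Complex x y2)) - Im (g (Complex x y1)) = (y2 - y1) * Re (deriv g (Complex x \<xi>))"
    by blast
  have "((\<lambda>y. Re (g (Complex x y))) has_real_derivative - Im (deriv g (Complex x y))) (at y)" if "y1 \<le> y" "y \<le> y2" for y
    using bounded_linear.has_vector_derivative[OF bounded_linear_Re holomorphic_vertical_derivative[OF assms(1), of y x]] that assms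
    by (simp add: has_real_derivative_iff_has_vector_derivative)
  from MVT2[OF assms(3) this] obtain \<zeta> where "y1 < \<zeta>" "\<zeta> < y2" "Re (g (Complex x y2)) - Re (g (Complex x y1)) = (y2 - y1) * - Im (deriv g (Complex x \<zeta>))"
    by blast
  then have "Re (g (Complex x y2)) - Re (g (Complex x y1)) = - (y2 - y1) * Im (deriv g (Complex x \<zeta>))" by (simp add: algebra_simps)
  from that[OF 1 \<open>y1 < \<zeta>\<close> \<open>\<zeta> < y2\<close> this] show ?thesis .
qed

text \<open>On the compact segment \<open>Re g\<close> stays below some \<open>- e\<close>, and
  uniform continuity on a rectangle preserves the sign up to a common height.\<close>

lemma negative_Re_tube:
  assumes "0 < \<rho>" "continuous_on (strip \<rho>) g" "s \<le> t"
    and neg: "\<And>x. s \<le> x \<Longrightarrow> x \<le> t \<Longrightarrow> Re (g (of_real x)) < 0"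
  obtains \<delta> where "0 < \<delta>" "\<delta> < \<rho>" "\<And>x y. s \<le> x \<Longrightarrow> x \<le> t \<Longrightarrow> \<bar>y\<bar> \<le> \<delta> \<Longrightarrow> Re (g (Complex x y)) < 0"
proof -
  define S where "S = cbox (Complex s (-\<rho>/2)) (Complex t (\<rho>/2))"
  have cont: "continuous_on S g"
    using assms(2) by (rule continuous_on_subset) (use assms(1) in \<open>auto simp: S_def in_cbox_complex_iff\<close>)
  have uc: "uniformly_continuous_on S g"
    by (rule compact_uniformly_continuous[OF cont]) (simp add: S_def)
  have mem: "Complex x y \<in> S" if "s \<le> x" "x \<le> t" "\<bar>y\<bar> \<le> \<rho>/2" for x y
    using that by (auto simp: S_def in_cbox_complex_iff)
  have "continuous_on {s..t} (\<lambda>x. Re (g (of_real x)))"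
    by (intro continuous_intros continuous_on_compose2[OF cont]) (use mem[of _ 0] assms(1) in \<open>auto simp: complex_of_real_def\<close>)
  then obtain m where m: "m \<in> {s..t}" "\<And>x. x \<in> {s..t} \<Longrightarrow> Re (g (of_real x)) \<le> Re (g (of_real m))"
    using continuous_attains_sup[of "{s..t}" "\<lambda>x. Re (g (of_real x))"] assms(3)
    by (metis atLeastatMost_empty_iff compact_Icc linorder_not_le)
  define e where "e = - Re (g (of_real m))"
  have e: "0 < e" using neg m(1) by (auto simp: e_def)
  obtain d where d: "0 < d" "\<And>x x'. x \<in> S \<Longrightarrow> x' \<in> S \<Longrightarrow> dist x' x < d \<Longrightarrow> dist (g x') (g x) < e"
    using uc e unfolding uniformly_continuous_on_def by metis
  show ?thesis
  proof (rule that[of "min (\<rho>/2) (d/2)"])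
    fix x y assume xy: "s \<le> x" "x \<le> t" "\<bar>y\<bar> \<le> min (\<rho>/2) (d/2)"
    have "dist (Complex x y) (Complex x 0) = \<bar>y\<bar>" by (simp add: dist_norm cmod_def)
    then have "dist (g (Complex x y)) (g (Complex x 0)) < e"
      using xy d(1) assms(1) by (intro d(2) mem) auto
    then have "\<bar>Re (g (Complex x y) - g (Complex x 0))\<bar> < e"
      using abs_Re_le_cmod order_le_less_trans unfolding dist_norm by blast
    moreover have "Re (g (Complex x 0)) \<le> - e" using m(2)[of x] xy by (simp add: e_def complex_of_real_def)
    ultimately show "Re (g (Complex x y)) < 0" by simp
  qed (use assms(1) d in auto)
qed

section \<open>A square root continuous across the negative real axis\<close>

text \<open>The square root with branch cut along the negative imaginary axis: unlike \<^const>\<open>csqrt\<close> it is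
  holomorphic near the negative real axis, which \<open>\<mu>\<^sup>2 - A(z)\<^sup>2\<close> meets inside the well.\<close>

definition rt :: "complex \<Rightarrow> complex" where
  "rt w = Complex (1 / sqrt 2) (1 / sqrt 2) * csqrt (- \<i> * w)"

text \<open>The values of \<open>symb\<close> on the closed half-strip will lie here. The branch cut
  meets this set only in 0, the value at a turning point; there \<open>rt\<close> is continuous
  without being differentiable.\<close>

abbreviation rt_dom :: "complex set" where
  "rt_dom \<equiv> {w. 0 \<le> Im w \<or> 0 < Re w}"

lemma eighth_root_of_unity: "Complex (1 / sqrt 2) (1 / sqrt 2) * Complex (1 / sqrt 2) (1 / sqrt 2) = \<i>"
  by (simp add: complex_eq_iff)

lemma rt_power2 [simp]: "(rt w)\<^sup>2 = w"
  by (simp add: rt_def power_mult_distrib) (simp add: power2_eq_square eighth_root_of_unity)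

lemma rt_eq_0_iff [simp]: "rt w = 0 \<longleftrightarrow> w = 0"
  by (metis rt_power2 power_zero_numeral zero_eq_power2)

lemma norm_rt: "norm (rt w) = sqrt (norm w)"
  by (metis rt_power2 norm_power norm_ge_zero real_sqrt_unique)

lemma rt_parts:
  shows "Re (rt w) = (Re (csqrt (- \<i> * w)) - Im (csqrt (- \<i> * w))) / sqrt 2"
    and "Im (rt w) = (Re (csqrt (- \<i> * w)) + Im (csqrt (- \<i> * w))) / sqrt 2"
  by (simp_all add: rt_def diff_divide_distrib add_divide_distrib del: csqrt.simps)

text \<open>\<open>rt w\<close> is \<open>x = csqrt (- \<i> * w)\<close> turned by 45 degrees. From
  \<open>x\<^sup>2 = - \<i> * w\<close>, a nonnegative \<open>Im w\<close> means
  \<open>\<bar>Im x\<bar> \<le> Re x\<close>, while \<open>Re w > 0\<close> with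
  \<open>Im w < 0\<close> forces \<open>Im x < 0\<close>; either way the turned value has
  nonnegative real part.\<close>

lemma Im_rt_nonneg: "0 \<le> Im w \<Longrightarrow> 0 \<le> Im (rt w)" and Re_rt_nonneg: "w \<in> rt_dom \<Longrightarrow> 0 \<le> Re (rt w)"
proof -
  define x where "x = csqrt (- \<i> * w)"
  have sq: "x\<^sup>2 = - \<i> * w" unfolding x_def by (rule power2_csqrt)
  have re: "(Re x)\<^sup>2 - (Im x)\<^sup>2 = Im w" and im: "2 * Re x * Im x = - Re w"
    using arg_cong[OF sq, of Re] arg_cong[OF sq, of Im] by (simp_all add: Re_power2 Im_power2)
  have x0: "0 \<le> Re x" unfolding x_def by (rule Re_csqrt)
  have abs: "\<bar>Im x\<bar> \<le> Re x" if "0 \<le> Im w"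
    using re that x0 by (metis abs_le_square_iff abs_of_nonneg diff_ge_0_iff_ge)
  show "0 \<le> Im (rt w)" if "0 \<le> Im w"
    using abs[OF that] unfolding rt_parts x_def[symmetric] by simp
  show "0 \<le> Re (rt w)" if "w \<in> rt_dom"
  proof (cases "0 \<le> Im w")
    case True then show ?thesis using abs unfolding rt_parts x_def[symmetric] by simp
  next
    case False
    then have "Re x * Im x < 0" using that im by auto
    then have "Im x < 0" using x0 by (simp add: mult_less_0_iff)
    then show ?thesis using x0 unfolding rt_parts x_def[symmetric] by simp
  qed
qed

text \<open>The square fixes the value up to sign, and the half-plane containing the root decides
  the sign. On negative reals the root is \<open>\<i>\<close> times a positive number; this makes
  the imaginary part of the phase equal to plus half the action.\<close>

lemma rt_of_real: "rt (of_real r) = (if 0 \<le> r then of_real (sqrt r) else \<i> * of_real (sqrt (- r)))"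
proof (cases "0 \<le> r")
  case True
  have "(rt (of_real r))\<^sup>2 = (of_real (sqrt r))\<^sup>2" using True unfolding rt_power2 of_real_power[symmetric] by simp
  then have "rt (of_real r) = of_real (sqrt r) \<or> rt (of_real r) = - of_real (sqrt r)" by (rule iffD1[OF power2_eq_iff])
  moreover have "0 \<le> Re (rt (of_real r))" by (rule Re_rt_nonneg) simp
  ultimately show ?thesis using True by auto
next
  case False
  have "(rt (of_real r))\<^sup>2 = (\<i> * of_real (sqrt (- r)))\<^sup>2" using False unfolding rt_power2 power_mult_distrib of_real_power[symmetric] by simp
  then have "rt (of_real r) = \<i> * of_real (sqrt (-r)) \<or> rt (of_real r) = - (\<i> * of_real (sqrt (-r)))" by (rule iffD1[OF power2_eq_iff])
  moreover have "0 \<le> Im (rt (of_real r))" by (rule Im_rt_nonneg) simp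
  ultimately show ?thesis using False by auto
qed

lemma rt_dom_slit: "w \<in> rt_dom \<Longrightarrow> w \<noteq> 0 \<Longrightarrow> - \<i> * w \<notin> \<real>\<^sub>\<le>\<^sub>0"
  by (auto simp: complex_nonpos_Reals_iff complex_eq_iff)

lemma has_field_derivative_rt:
  assumes "w \<in> rt_dom" "w \<noteq> 0"
  shows "(rt has_field_derivative 1 / (2 * rt w)) (at w)"
proof -
  have "(rt has_field_derivative Complex (1 / sqrt 2) (1 / sqrt 2) * (- \<i> / (2 * csqrt (- \<i> * w)))) (at w)"
    unfolding rt_def[abs_def] using rt_dom_slit[OF assms]
    by (auto intro!: derivative_eq_intros)
  moreover have "Complex (1 / sqrt 2) (1 / sqrt 2) * (- \<i> / (2 * csqrt (- \<i> * w))) = 1 / (2 * rt w)"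
  proof -
    have "Complex (1 / sqrt 2) (1 / sqrt 2) * - \<i> * Complex (1 / sqrt 2) (1 / sqrt 2) = 1"
      using eighth_root_of_unity by (simp add: algebra_simps)
    moreover have "Complex (1 / sqrt 2) (1 / sqrt 2) \<noteq> 0" by (simp add: complex_eq_iff)
    moreover define r where "r = Complex (1 / sqrt 2) (1 / sqrt 2)"
    ultimately have "r * - \<i> * r = 1" "r \<noteq> 0" by simp_all
    then have "r * - \<i> = 1 / r" by (simp add: field_simps)
    then have "r * (- \<i> / (2 * csqrt (- \<i> * w))) = 1 / r / (2 * csqrt (- \<i> * w))"
      by (metis times_divide_eq_right)
    then show ?thesis unfolding rt_def r_def[symmetric] by (simp add: algebra_simps)
  qed
  ultimately show ?thesis by simp
qed

lemma continuous_on_rt: "continuous_on rt_dom rt"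
proof (intro continuous_at_imp_continuous_on ballI)
  fix w assume w: "w \<in> rt_dom"
  show "isCont rt w"
  proof (cases "w = 0")
    case False
    then show ?thesis using has_field_derivative_rt[of w] w DERIV_isCont by blast
  next
    \<comment> \<open>At the branch point continuity follows from the norm, which is the square root
      of \<open>norm w\<close> and tends to 0.\<close>
    case True
    have "((\<lambda>w::complex. sqrt (norm w)) \<longlongrightarrow> sqrt (norm (0::complex))) (at 0)"
      by (intro tendsto_real_sqrt tendsto_norm[OF tendsto_ident_at])
    then have "((\<lambda>w. norm (rt w)) \<longlongrightarrow> 0) (at 0)" by (simp add: norm_rt)
    then have "(rt \<longlongrightarrow> 0) (at 0)" using tendsto_norm_zero_iff by blast
    then show ?thesis using True by (simp add: isCont_def rt_def)
  qed
qed

section \<open>The analytic well\<close>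

text \<open>In the application \<sigma> is \<open>1 + \<tau>\<close>; being larger than 1, it makes
  the bounds integrable along horizontal lines. Bounds on two derivatives are included because
  \<open>deriv f\<close> enters the coupling of the WKB amplitudes and
  \<open>deriv (deriv f)\<close> the derivative of its correction.\<close>

locale analytic_well =
  fixes A :: "real \<Rightarrow> real" and f :: "complex \<Rightarrow> complex" and \<rho> \<sigma> C :: real
  assumes \<rho>: "0 < \<rho>" and \<sigma>: "1 < \<sigma>"
    and hol: "f holomorphic_on strip \<rho>"
    and f_real: "f (of_real x) = of_real (A x)"
    and f_le: "z \<in> strip \<rho> \<Longrightarrow> norm (f z) \<le> C * (1 + \<bar>Re z\<bar>) powr (-\<sigma>)"
    and f1_le: "z \<in> strip \<rho> \<Longrightarrow> norm (deriv f z) \<le> C * (1 + \<bar>Re z\<bar>) powr (-\<sigma>)"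
    and f2_le: "z \<in> strip \<rho> \<Longrightarrow> norm (deriv (deriv f) z) \<le> C * (1 + \<bar>Re z\<bar>) powr (-\<sigma>)"
    and A_pos: "0 < A x" and A_even: "A (- x) = A x"
    and A_decr: "0 < x \<Longrightarrow> deriv A x < 0" and A_2: "deriv (deriv A) 0 < 0"
begin

lemma hol1: "deriv f holomorphic_on strip \<rho>"
  by (rule holomorphic_deriv[OF hol open_strip])

lemma f1_real: "deriv f (of_real x) = of_real (deriv A x)"
  by (rule deriv_real_on_reals(2)[OF \<rho> hol f_real])

lemma f2_real: "deriv (deriv f) (of_real x) = of_real (deriv (deriv A) x)"
  by (rule deriv_real_on_reals(2)[OF \<rho> hol1 f1_real])

lemma DERIV_A: "(A has_real_derivative deriv A x) (at x)"
  using deriv_real_on_reals[OF \<rho> hol f_real, of x] by simp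

lemma A_cont: "continuous_on S A"
  using DERIV_A DERIV_isCont continuous_at_imp_continuous_on by blast

lemma A_strict: "0 \<le> x \<Longrightarrow> x < y \<Longrightarrow> A y < A x"
proof (rule DERIV_neg_imp_decreasing_open[of x y A])
  show "\<exists>y. (A has_real_derivative y) (at z) \<and> y < 0" if "0 \<le> x" "x < z" for z
    using DERIV_A[of z] A_decr[of z] that by auto
qed (auto intro: A_cont)

lemma A_abs: "A x = A \<bar>x\<bar>"
  using A_even[of x] by (simp add: abs_if)

lemma A_le_A0: "A x \<le> A 0"
  using A_strict[of 0 "\<bar>x\<bar>"] A_abs[of x] by (cases "x = 0") auto

lemma C_pos: "0 < C"
  using f_le[of 0] f_real[of 0] A_pos[of 0] \<rho> by simp

lemma f_cnj: "z \<in> strip \<rho> \<Longrightarrow> f (cnj z) = cnj (f z)"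
  by (rule strip_cnj[OF \<rho> hol f_real])

lemma f_minus: "z \<in> strip \<rho> \<Longrightarrow> f (- z) = f z"
  by (rule strip_even[OF \<rho> hol f_real A_even])

text \<open>Reflection and evenness together: on this axis \<open>cnj z = - z\<close>.\<close>

lemma f_imaginary_axis: "\<bar>y\<bar> < \<rho> \<Longrightarrow> Im (f (Complex 0 y)) = 0"
proof -
  assume y: "\<bar>y\<bar> < \<rho>"
  have "cnj (Complex 0 y) = - Complex 0 y" by (simp add: complex_eq_iff)
  then have "cnj (f (Complex 0 y)) = f (Complex 0 y)" using f_cnj[of "Complex 0 y"] f_minus[of "Complex 0 y"] y by simp
  then show ?thesis by (metis cnj.sel(2) neg_equal_zero)
qed

lemma f_real_Complex: "f (Complex x 0) = of_real (A x)"
  using f_real[of x] by (simp add: complex_of_real_def)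

lemma decay_tendsto: "((\<lambda>x. C * (1 + x) powr (-\<sigma>)) \<longlongrightarrow> 0) at_top"
  by (intro tendsto_mult_right_zero tendsto_neg_powr filterlim_tendsto_add_at_top[OF tendsto_const] filterlim_ident) (use \<sigma> in auto)

lemma small_far:
  assumes "0 < e"
  obtains R where "0 < R" "\<And>z. z \<in> strip \<rho> \<Longrightarrow> R \<le> \<bar>Re z\<bar> \<Longrightarrow> norm (f z) \<le> e"
proof -
  have "eventually (\<lambda>x. C * (1 + x) powr (-\<sigma>) < e) at_top"
    using order_tendstoD(2)[OF decay_tendsto assms] .
  then obtain R where R: "\<And>x. R \<le> x \<Longrightarrow> C * (1 + x) powr (-\<sigma>) < e"
    unfolding eventually_at_top_linorder by blast
  show ?thesis
  proof (rule that[of "max R 1"])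
    fix z assume "z \<in> strip \<rho>" "max R 1 \<le> \<bar>Re z\<bar>"
    then show "norm (f z) \<le> e" using f_le[of z] R[of "\<bar>Re z\<bar>"] by auto
  qed simp
qed

text \<open>The sign of \<open>Im f\<close> comes from \<open>A' < 0\<close> away from the origin, and near it, where \<open>A'\<close> vanishes,
  from \<open>A''(0) < 0\<close> and \<open>Im f = 0\<close> on the imaginary axis.\<close>

lemma quadrant_sign:
  assumes "0 < R"
  obtains \<eta> where "0 < \<eta>" "\<eta> < \<rho>"
    "\<And>x y. 0 < x \<Longrightarrow> x \<le> R \<Longrightarrow> 0 < y \<Longrightarrow> y \<le> \<eta> \<Longrightarrow> Im (f (Complex x y)) < 0"
    "\<And>x y. 0 \<le> x \<Longrightarrow> x \<le> R \<Longrightarrow> 0 \<le> y \<Longrightarrow> y \<le> \<eta> \<Longrightarrow> 0 < Re (f (Complex x y))"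
    "\<And>y. 0 < y \<Longrightarrow> y \<le> \<eta> \<Longrightarrow> A 0 < Re (f (Complex 0 y))"
proof -
  have hol2: "deriv (deriv f) holomorphic_on strip \<rho>" by (rule holomorphic_deriv[OF hol1 open_strip])
  have c0: "continuous_on (strip \<rho>) f" and c1: "continuous_on (strip \<rho>) (deriv f)" and c2: "continuous_on (strip \<rho>) (deriv (deriv f))"
    using hol hol1 hol2 holomorphic_on_imp_continuous_on by blast+
  have "isCont (deriv (deriv f)) 0"
    using c2 \<rho> by (simp add: continuous_on_eq_continuous_at)
  then have "isCont (\<lambda>z. Re (deriv (deriv f) z)) 0" by (rule isCont_Re)
  then have "((\<lambda>z. Re (deriv (deriv f) z)) \<longlongrightarrow> Re (deriv (deriv f) 0)) (nhds 0)"
    unfolding isCont_def by (rule tendsto_at_iff_tendsto_nhds[THEN iffD1])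
  moreover have "Re (deriv (deriv f) 0) < 0" using f2_real[of 0] A_2 by simp
  ultimately have "eventually (\<lambda>z. Re (deriv (deriv f) z) < 0) (nhds 0)"
    by (rule order_tendstoD(2))
  then obtain d where d: "0 < d" "\<And>z. dist z 0 < d \<Longrightarrow> Re (deriv (deriv f) z) < 0"
    unfolding eventually_nhds_metric by blast
  \<comment> \<open>Up to \<open>s\<close> the sign of \<open>Im f\<close> will come from the second
    derivative, from \<open>s\<close> to \<open>R\<close> from the first.\<close>
  define s where "s = min (d/2) R"
  have s: "0 < s" "s \<le> R" "s < d" using d assms by (auto simp: s_def)
  obtain e2 where e2: "0 < e2" "e2 < \<rho>" "\<And>x y. 0 \<le> x \<Longrightarrow> x \<le> s \<Longrightarrow> \<bar>y\<bar> \<le> e2 \<Longrightarrow> Re (deriv (deriv f) (Complex x y)) < 0"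
    by (rule negative_Re_tube[OF \<rho> c2, of 0 s]) (use s d in auto)
  obtain e1 where e1: "0 < e1" "e1 < \<rho>" "\<And>x y. s \<le> x \<Longrightarrow> x \<le> R \<Longrightarrow> \<bar>y\<bar> \<le> e1 \<Longrightarrow> Re (deriv f (Complex x y)) < 0"
    by (rule negative_Re_tube[OF \<rho> c1, of s R]) (use s A_decr in \<open>auto simp: f1_real\<close>)
  obtain e0 where e0: "0 < e0" "e0 < \<rho>" "\<And>x y. 0 \<le> x \<Longrightarrow> x \<le> R \<Longrightarrow> \<bar>y\<bar> \<le> e0 \<Longrightarrow> Re (- f (Complex x y)) < 0"
    by (rule negative_Re_tube[OF \<rho> continuous_on_minus[OF c0], of 0 R]) (use s A_pos in \<open>auto simp: f_real\<close>)
  define \<eta> where "\<eta> = min e2 (min e1 e0)"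
  have \<eta>: "0 < \<eta>" "\<eta> < \<rho>" "\<eta> \<le> e2" "\<eta> \<le> e1" "\<eta> \<le> e0" using e0 e1 e2 by (auto simp: \<eta>_def)
  \<comment> \<open>\<open>deriv f\<close> is real on the real axis, so its imaginary part at height
    \<open>y\<close> is \<open>y\<close> times a value of
    \<open>Re (deriv (deriv f))\<close>.\<close>
  have f1neg: "Im (deriv f (Complex x y)) < 0" if xy: "0 \<le> x" "x \<le> s" "0 < y" "y \<le> \<eta>" for x y
  proof -
    obtain \<xi> \<zeta> where "0 < \<xi>" "\<xi> < y" "Im (deriv f (Complex x y)) - Im (deriv f (Complex x 0)) = (y - 0) * Re (deriv (deriv f) (Complex x \<xi>))"
      by (rule mvt_vertical[OF hol1, of 0 y x]) (use xy \<eta> \<rho> in auto)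
    moreover have "Im (deriv f (Complex x 0)) = 0" using f1_real[of x] by (simp add: complex_of_real_def)
    moreover have "Re (deriv (deriv f) (Complex x \<xi>)) < 0" using e2(3)[of x \<xi>] xy \<eta> calculation by auto
    ultimately show ?thesis using xy by (simp add: mult_pos_neg)
  qed
  show ?thesis
  proof (rule that[OF \<eta>(1,2)])
    fix x y assume xy: "0 < x" "x \<le> R" "0 < y" "y \<le> \<eta>"
    show "Im (f (Complex x y)) < 0"
    proof (cases "x \<le> s")
      case True
      obtain \<xi> where "0 < \<xi>" "\<xi> < x" "Im (f (Complex x y)) - Im (f (Complex 0 y)) = (x - 0) * Im (deriv f (Complex \<xi> y))"
        by (rule mvt_horizontal_Im[OF hol, of y 0 x]) (use xy \<eta> in auto)
      moreover have "Im (f (Complex 0 y)) = 0" using f_imaginary_axis xy \<eta> by simp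
      moreover have "Im (deriv f (Complex \<xi> y)) < 0" using f1neg[of \<xi> y] calculation xy True by simp
      ultimately show ?thesis using xy by (simp add: mult_pos_neg)
    next
      case False
      obtain \<xi> \<zeta> where "0 < \<xi>" "\<xi> < y" "Im (f (Complex x y)) - Im (f (Complex x 0)) = (y - 0) * Re (deriv f (Complex x \<xi>))"
        by (rule mvt_vertical[OF hol, of 0 y x]) (use xy \<eta> \<rho> in auto)
      moreover have "Im (f (Complex x 0)) = 0" by (simp add: f_real_Complex)
      moreover have "Re (deriv f (Complex x \<xi>)) < 0" using e1(3)[of x \<xi>] calculation xy \<eta> False by simp
      ultimately show ?thesis using xy by (simp add: mult_pos_neg)
    qed
  next
    fix x y assume "0 \<le> x" "x \<le> R" "0 \<le> y" "y \<le> \<eta>"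
    then show "0 < Re (f (Complex x y))" using e0(3)[of x y] \<eta> by simp
  next
    fix y assume y: "0 < y" "y \<le> \<eta>"
    \<comment> \<open>Above the origin \<open>Re f\<close> increases because
      \<open>Im (deriv f)\<close> is negative there; on the imaginary axis \<open>f\<close> thus
      exceeds every admissible \<mu>.\<close>
    obtain \<xi> \<zeta> where "0 < \<zeta>" "\<zeta> < y" "Re (f (Complex 0 y)) - Re (f (Complex 0 0)) = - (y - 0) * Im (deriv f (Complex 0 \<zeta>))"
      by (rule mvt_vertical[OF hol, of 0 y 0]) (use y \<eta> \<rho> in auto)
    moreover have "Im (deriv f (Complex 0 \<zeta>)) < 0" using f1neg[of 0 \<zeta>] calculation y s by simp
    moreover have "Re (f (Complex 0 0)) = A 0" by (simp add: f_real_Complex)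
    ultimately show "A 0 < Re (f (Complex 0 y))" using y mult_pos_neg[of y "Im (deriv f (Complex 0 \<zeta>))"] by simp
  qed
qed

end

section \<open>The symbol, its square root, and a line free of turning points\<close>

context analytic_well begin

definition symb :: "real \<Rightarrow> complex \<Rightarrow> complex" where
  "symb \<mu> z = (of_real \<mu>)\<^sup>2 - (f z)\<^sup>2"

text \<open>Plus and minus \<open>kap \<mu> z / \<epsilon>\<close> are the eigenvalues of the
  coefficient matrix of the system for \<open>p\<close> and \<open>q\<close>. The nonnegative real
  part of \<open>rt\<close> on \<open>rt_dom\<close> decides once and for all which one is
  dominant.\<close>

definition kap :: "real \<Rightarrow> complex \<Rightarrow> complex" where
  "kap \<mu> z = rt (symb \<mu> z)"

lemma kap_power2: "(kap \<mu> z)\<^sup>2 = symb \<mu> z" by (simp add: kap_def)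

lemma symb_factor: "symb \<mu> z = (of_real \<mu> - f z) * (of_real \<mu> + f z)"
  by (simp add: symb_def power2_eq_square algebra_simps)

lemma DERIV_f: "z \<in> strip \<rho> \<Longrightarrow> (f has_field_derivative deriv f z) (at z)"
  by (rule holomorphic_derivI[OF hol open_strip])

lemma DERIV_f1: "z \<in> strip \<rho> \<Longrightarrow> (deriv f has_field_derivative deriv (deriv f) z) (at z)"
  by (rule holomorphic_derivI[OF hol1 open_strip])

lemma DERIV_symb: "z \<in> strip \<rho> \<Longrightarrow> (symb \<mu> has_field_derivative - 2 * f z * deriv f z) (at z)"
  unfolding symb_def[abs_def] by (auto intro!: derivative_eq_intros DERIV_f)

lemma DERIV_kap:
  assumes "z \<in> strip \<rho>" "symb \<mu> z \<in> rt_dom" "symb \<mu> z \<noteq> 0"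
  shows "(kap \<mu> has_field_derivative - f z * deriv f z / kap \<mu> z) (at z)"
proof -
  have "(kap \<mu> has_field_derivative 1 / (2 * rt (symb \<mu> z)) * (- 2 * f z * deriv f z)) (at z)"
    unfolding kap_def[abs_def]
    by (rule DERIV_chain2[OF has_field_derivative_rt[OF assms(2,3)] DERIV_symb[OF assms(1)]])
  then show ?thesis by (simp add: kap_def)
qed

end

text \<open>\<open>symb_dom\<close> makes \<open>kap\<close> continuous with nonnegative real part
  up to the edges of the half-strip, and \<open>symb_nz\<close> makes it holomorphic inside, turning
  points being left to the real edge. \<open>symb_low\<close> is the uniform distance from turning
  points on the upper edge. \<open>axis\<close> makes \<open>kap\<close> imaginary on the left edge,
  and \<open>right\<close> fixes the branch of the amplitude.\<close>

locale wkb_line = analytic_well +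
  fixes a \<eta> d :: real
  assumes a: "0 < a" and \<eta>: "0 < \<eta>" "\<eta> < \<rho>" and d: "0 < d"
    and symb_dom: "0 \<le> Re z \<Longrightarrow> 0 \<le> Im z \<Longrightarrow> Im z \<le> \<eta> \<Longrightarrow> a \<le> \<mu> \<Longrightarrow> \<mu> \<le> A 0 \<Longrightarrow> symb \<mu> z \<in> rt_dom"
    and symb_nz: "0 < Re z \<Longrightarrow> 0 < Im z \<Longrightarrow> Im z \<le> \<eta> \<Longrightarrow> a \<le> \<mu> \<Longrightarrow> \<mu> \<le> A 0 \<Longrightarrow> symb \<mu> z \<noteq> 0"
    and symb_low: "0 \<le> x \<Longrightarrow> a \<le> \<mu> \<Longrightarrow> \<mu> \<le> A 0 \<Longrightarrow> d\<^sup>2 \<le> norm (symb \<mu> (Complex x \<eta>))"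
    and axis: "0 \<le> y \<Longrightarrow> y \<le> \<eta> \<Longrightarrow> A 0 \<le> Re (f (Complex 0 y))"
    and right: "0 \<le> x \<Longrightarrow> a \<le> \<mu> \<Longrightarrow> \<mu> \<le> A 0 \<Longrightarrow> 0 < Re (of_real \<mu> + f (Complex x \<eta>))"

text \<open>Far out the norm of \<open>f\<close> is at most \<open>a / 2\<close> and
  \<open>symb\<close> lies in the right half-plane; over the bounded part \<open>Re f > 0\<close>
  and \<open>Im f \<le> 0\<close> put it in the closed upper half-plane. The two pieces of
  \<open>rt_dom\<close> are these two regimes.\<close>

lemma (in analytic_well) wkb_line_exists:
  assumes a: "0 < a" "a \<le> A 0"
  obtains \<eta> d where "wkb_line A f \<rho> \<sigma> C a \<eta> d"
proof -
  obtain R where R: "0 < R" "\<And>z. z \<in> strip \<rho> \<Longrightarrow> R \<le> \<bar>Re z\<bar> \<Longrightarrow> norm (f z) \<le> a / 2"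
    using small_far[of "a/2"] a by auto
  obtain \<eta> where \<eta>: "0 < \<eta>" "\<eta> < \<rho>"
    and neg: "\<And>x y. 0 < x \<Longrightarrow> x \<le> R \<Longrightarrow> 0 < y \<Longrightarrow> y \<le> \<eta> \<Longrightarrow> Im (f (Complex x y)) < 0"
    and pos: "\<And>x y. 0 \<le> x \<Longrightarrow> x \<le> R \<Longrightarrow> 0 \<le> y \<Longrightarrow> y \<le> \<eta> \<Longrightarrow> 0 < Re (f (Complex x y))"
    and axis: "\<And>y. 0 < y \<Longrightarrow> y \<le> \<eta> \<Longrightarrow> A 0 < Re (f (Complex 0 y))"
    using quadrant_sign[OF R(1)] by blast
  have far: "a\<^sup>2 / 2 \<le> Re (symb \<mu> z)" if "R \<le> Re z" "z \<in> strip \<rho>" "a \<le> \<mu>" for \<mu> z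
  proof -
    have "norm (f z) \<le> a / 2" using R that by auto
    then have "(norm (f z))\<^sup>2 \<le> (a/2)\<^sup>2" by (intro power_mono) auto
    then have "Re ((f z)\<^sup>2) \<le> (a/2)\<^sup>2" using complex_Re_le_cmod[of "(f z)\<^sup>2"] by (simp add: norm_power)
    moreover have "a\<^sup>2 \<le> \<mu>\<^sup>2" using that a by (intro power_mono) auto
    moreover have "Re (symb \<mu> z) = \<mu>\<^sup>2 - Re ((f z)\<^sup>2)" by (simp add: symb_def flip: of_real_power)
    moreover have "(a / 2)\<^sup>2 = a\<^sup>2 / 4" "0 \<le> a\<^sup>2" by (simp_all add: power_divide)
    ultimately show ?thesis by linarith
  qed
  have Imsymb: "Im (symb \<mu> z) = - 2 * Re (f z) * Im (f z)" for \<mu> z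
    by (simp add: symb_def Im_power2 flip: of_real_power)
  have Im_le: "Im (f z) \<le> 0" if z: "0 \<le> Re z" "Re z \<le> R" "0 \<le> Im z" "Im z \<le> \<eta>" for z
  proof -
    consider "Re z = 0" | "Im z = 0" | "0 < Re z" "0 < Im z" using z by fastforce
    then show ?thesis
    proof cases
      case 1 then have "z = Complex 0 (Im z)" by (simp add: complex_eq_iff)
      then show ?thesis using f_imaginary_axis[of "Im z"] z \<eta> by auto
    next
      case 2 then have "z = Complex (Re z) 0" by (simp add: complex_eq_iff)
      then show ?thesis using f_real_Complex[of "Re z"] by simp
    next
      case 3 then show ?thesis using neg[of "Re z" "Im z"] z by simp
    qed
  qed
  have nz: "symb \<mu> z \<noteq> 0" if z: "0 \<le> Re z" "0 < Im z" "Im z \<le> \<eta>" and \<mu>: "a \<le> \<mu>" "\<mu> \<le> A 0" for z \<mu>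
  proof (cases "R \<le> Re z")
    case True
    then have "a\<^sup>2 / 2 \<le> Re (symb \<mu> z)" using far[of z \<mu>] z \<eta> \<mu> by auto
    moreover have "0 < a\<^sup>2 / 2" using a by simp
    ultimately show ?thesis by (metis linorder_not_less zero_complex.sel(1))
  next
    case False
    show ?thesis
    proof (cases "Re z = 0")
      case True
      then have z0: "z = Complex 0 (Im z)" by (simp add: complex_eq_iff)
      have "A 0 < Re (f z)" "Im (f z) = 0" using axis[of "Im z"] f_imaginary_axis[of "Im z"] z \<eta> z0 by auto
      then have "Re (symb \<mu> z) = \<mu>\<^sup>2 - (Re (f z))\<^sup>2" by (simp add: symb_def Re_power2 flip: of_real_power)
      moreover have "\<mu>\<^sup>2 < (Re (f z))\<^sup>2" using \<mu> a \<open>A 0 < Re (f z)\<close> by (intro power_strict_mono) auto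
      ultimately show ?thesis by auto
    next
      case F: False
      then have "Im (f z) < 0" "0 < Re (f z)" using neg[of "Re z" "Im z"] pos[of "Re z" "Im z"] z False by auto
      then have "0 < Im (symb \<mu> z)" unfolding Imsymb by (simp add: mult_pos_neg)
      then show ?thesis by auto
    qed
  qed
  \<comment> \<open>Compactness in \<open>x\<close> and \<mu> jointly: the parameter range is closed
    at \<open>A 0\<close>, so the lower bound survives the merging of the turning points.\<close>
  define S where "S = {0..R} \<times> {a..A 0}"
  have "continuous_on S (\<lambda>p. Complex (fst p) \<eta>)" unfolding Complex_eq by (intro continuous_intros)
  then have "continuous_on S (\<lambda>p. f (Complex (fst p) \<eta>))"
    by (rule continuous_on_compose2[OF holomorphic_on_imp_continuous_on[OF hol]]) (use \<eta> in auto)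
  then have "continuous_on S (\<lambda>(x, \<mu>). norm (symb \<mu> (Complex x \<eta>)))"
    unfolding symb_def split_beta by (intro continuous_intros)
  then obtain p where p: "p \<in> S" "\<And>q. q \<in> S \<Longrightarrow> (\<lambda>(x, \<mu>). norm (symb \<mu> (Complex x \<eta>))) p \<le> (\<lambda>(x, \<mu>). norm (symb \<mu> (Complex x \<eta>))) q"
    using continuous_attains_inf[of S "\<lambda>(x, \<mu>). norm (symb \<mu> (Complex x \<eta>))"] R(1) a by (auto simp: S_def compact_Times)
  define b where "b = norm (symb (snd p) (Complex (fst p) \<eta>))"
  have b: "0 < b" using nz[of "Complex (fst p) \<eta>" "snd p"] p(1) \<eta> by (auto simp: b_def S_def)
  have b_le: "b \<le> norm (symb \<mu> (Complex x \<eta>))" if "0 \<le> x" "x \<le> R" "a \<le> \<mu>" "\<mu> \<le> A 0" for x \<mu>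
    using p(2)[of "(x, \<mu>)"] that by (auto simp: S_def b_def split_beta)
  \<comment> \<open>\<open>d\<close> will bound \<open>kap\<close>, whose square is
    \<open>symb\<close>, hence the square root; the entry \<open>a\<^sup>2 / 2\<close> covers the
    far region.\<close>
  define d where "d = sqrt (min b (a\<^sup>2 / 2))"
  have d: "0 < d" "d\<^sup>2 \<le> b" "d\<^sup>2 \<le> a\<^sup>2/2" using b a by (auto simp: d_def)
  have "wkb_line A f \<rho> \<sigma> C a \<eta> d"
  proof
    fix z \<mu> assume z: "0 \<le> Re z" "0 \<le> Im z" "Im z \<le> \<eta>" and \<mu>: "a \<le> \<mu>" "\<mu> \<le> A 0"
    show "symb \<mu> z \<in> rt_dom"
    proof (cases "R \<le> Re z")
      case True
      have "0 < a\<^sup>2/2" using a by simp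
      moreover have "a\<^sup>2 / 2 \<le> Re (symb \<mu> z)" using far[of z \<mu>] z \<mu> \<eta> True by auto
      ultimately have "0 < Re (symb \<mu> z)" by linarith
      then show ?thesis by simp
    next
      case False
      then have "0 \<le> Im (symb \<mu> z)" unfolding Imsymb
        using Im_le[of z] pos[of "Re z" "Im z"] z by (simp add: mult_nonneg_nonpos)
      then show ?thesis by simp
    qed
  next
    fix x \<mu> :: real assume x: "0 \<le> x" and \<mu>: "a \<le> \<mu>" "\<mu> \<le> A 0"
    show "d\<^sup>2 \<le> norm (symb \<mu> (Complex x \<eta>))"
    proof (cases "R \<le> x")
      case True
      then show ?thesis using far[of "Complex x \<eta>" \<mu>] \<mu> \<eta> d complex_Re_le_cmod[of "symb \<mu> (Complex x \<eta>)"] by auto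
    next
      case False
      then show ?thesis using b_le[of x \<mu>] x \<mu> d by simp
    qed
    show "0 < Re (of_real \<mu> + f (Complex x \<eta>))"
    proof (cases "R \<le> x")
      case True
      then have "norm (f (Complex x \<eta>)) \<le> a/2" using R(2)[of "Complex x \<eta>"] \<eta> by auto
      then show ?thesis using abs_Re_le_cmod[of "f (Complex x \<eta>)"] \<mu> a by simp
    next
      case False
      then show ?thesis using pos[of x \<eta>] x \<eta> \<mu> a by simp
    qed
  next
    fix y :: real assume "0 \<le> y" "y \<le> \<eta>"
    then show "A 0 \<le> Re (f (Complex 0 y))"
      using axis[of y] by (cases "y = 0") (auto simp: f_real_Complex)
  qed (use a \<eta> d nz in auto)
  then show ?thesis by (rule that)
qed

section \<open>The WKB decomposition on a horizontal line\<close>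

context wkb_line begin

text \<open>A fourth root of \<open>(\<mu> - f z) / (\<mu> + f z)\<close>, written through
  \<open>kap\<close> so that its branch is inherited from \<open>rt\<close>.\<close>

definition amp :: "real \<Rightarrow> complex \<Rightarrow> complex" where
  "amp \<mu> z = csqrt (kap \<mu> z / (of_real \<mu> + f z))"

text \<open>The logarithmic derivative of \<open>amp\<close>, read off from its fourth power. It is
  the coefficient that couples the two WKB amplitudes.\<close>

definition cpl :: "real \<Rightarrow> complex \<Rightarrow> complex" where
  "cpl \<mu> z = - of_real \<mu> * deriv f z / (2 * symb \<mu> z)"

text \<open>Adding \<open>\<epsilon> cor\<close> times the recessive amplitude to the dominant one removes the coupling term of
  order \<open>\<epsilon>\<^sup>0\<close> from its equation. This replaces an integration by parts against the oscillating factor.\<close>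

definition cor :: "real \<Rightarrow> complex \<Rightarrow> complex" where
  "cor \<mu> z = cpl \<mu> z / (2 * kap \<mu> z)"

definition decay :: "real \<Rightarrow> real" where
  "decay x = C * (1 + x) powr (-\<sigma>)"

lemma line_in_strip: "Complex x \<eta> \<in> strip \<rho>"
  using \<eta> by simp

lemma decay_nonneg: "0 \<le> decay x" and decay_le: "0 \<le> x \<Longrightarrow> decay x \<le> C"
proof -
  show "0 \<le> decay x" using C_pos by (simp add: decay_def)
  assume "0 \<le> x"
  then have "(1 + x) powr (-\<sigma>) \<le> (1 + x) powr 0" using \<sigma> by (intro powr_mono) auto
  then show "decay x \<le> C" using C_pos \<open>0 \<le> x\<close> by (simp add: decay_def mult_left_le)
qed

lemma line_bounds:
  assumes "0 \<le> x"
  shows "norm (f (Complex x \<eta>)) \<le> C" "norm (deriv f (Complex x \<eta>)) \<le> decay x"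
    "norm (deriv (deriv f) (Complex x \<eta>)) \<le> decay x" "norm (deriv f (Complex x \<eta>)) \<le> C"
  using f_le[OF line_in_strip, of x] f1_le[OF line_in_strip, of x] f2_le[OF line_in_strip, of x] decay_le[OF assms] assms
  by (auto simp: decay_def)

context
  fixes \<mu> :: real
  assumes \<mu>: "a \<le> \<mu>" "\<mu> \<le> A 0"
begin

lemma kap_ge: "0 \<le> x \<Longrightarrow> d \<le> norm (kap \<mu> (Complex x \<eta>))"
  using symb_low[of x \<mu>] \<mu> d by (simp add: kap_def norm_rt real_le_rsqrt)

lemma kap_nz: "0 \<le> x \<Longrightarrow> kap \<mu> (Complex x \<eta>) \<noteq> 0"
  using kap_ge d by fastforce

lemma symb_line: "0 \<le> x \<Longrightarrow> symb \<mu> (Complex x \<eta>) \<in> rt_dom" "0 \<le> x \<Longrightarrow> symb \<mu> (Complex x \<eta>) \<noteq> 0"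
proof -
  show "symb \<mu> (Complex x \<eta>) \<in> rt_dom" if "0 \<le> x"
    by (rule symb_dom) (use that \<mu> \<eta> in auto)
  show "symb \<mu> (Complex x \<eta>) \<noteq> 0" if "0 \<le> x"
    using kap_nz[OF that] unfolding kap_def by simp
qed

lemma Re_kap_nonneg: "0 \<le> x \<Longrightarrow> 0 \<le> Re (kap \<mu> (Complex x \<eta>))"
  unfolding kap_def by (intro Re_rt_nonneg symb_line)

lemma denom_nz: "0 \<le> x \<Longrightarrow> of_real \<mu> + f (Complex x \<eta>) \<noteq> 0"
  using right[of x \<mu>] \<mu> by (metis less_irrefl zero_complex.simps(1))

text \<open>The ratio is nonzero, and a negative value \<open>r\<close> would give
  \<open>kap\<close> the real part \<open>r * Re (\<mu> + f)\<close>, which is negative by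
  \<open>right\<close>, whereas \<open>kap\<close> lies in the closed right half-plane.\<close>

lemma amp_slit:
  assumes "0 \<le> x"
  shows "kap \<mu> (Complex x \<eta>) / (of_real \<mu> + f (Complex x \<eta>)) \<notin> \<real>\<^sub>\<le>\<^sub>0"
proof
  define g where "g = of_real \<mu> + f (Complex x \<eta>)"
  assume "kap \<mu> (Complex x \<eta>) / (of_real \<mu> + f (Complex x \<eta>)) \<in> \<real>\<^sub>\<le>\<^sub>0"
  then obtain r where r: "r \<le> 0" "kap \<mu> (Complex x \<eta>) / g = of_real r"
    unfolding g_def by (auto elim: nonpos_Reals_cases)
  then have "kap \<mu> (Complex x \<eta>) = of_real r * g" using denom_nz[OF assms] unfolding g_def by (simp add: field_simps)
  then have "r * Re g \<ge> 0" and "r \<noteq> 0" using Re_kap_nonneg[OF assms] kap_nz[OF assms] by auto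
  then show False using r right[OF assms \<mu>] unfolding g_def[symmetric]
    by (simp add: zero_le_mult_iff)
qed

lemma amp_power2: "(amp \<mu> z)\<^sup>2 = kap \<mu> z / (of_real \<mu> + f z)"
  by (simp add: amp_def)

lemma amp_nz: "0 \<le> x \<Longrightarrow> amp \<mu> (Complex x \<eta>) \<noteq> 0"
  using kap_nz denom_nz by (simp add: amp_def)

lemma DERIV_amp:
  assumes x: "0 \<le> x"
  defines "z \<equiv> Complex x \<eta>"
  shows "(amp \<mu> has_field_derivative cpl \<mu> z * amp \<mu> z) (at z)"
proof -
  let ?k = "kap \<mu> z" and ?g = "of_real \<mu> + f z"
  have k: "?k \<noteq> 0" and g: "?g \<noteq> 0" and c: "amp \<mu> z \<noteq> 0"
    using kap_nz[OF x] denom_nz[OF x] amp_nz[OF x] by (simp_all add: z_def)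
  have zs: "z \<in> strip \<rho>" using line_in_strip by (simp add: z_def)
  have dk: "(kap \<mu> has_field_derivative - f z * deriv f z / ?k) (at z)"
    using DERIV_kap[OF zs] symb_line[OF x] by (simp add: z_def)
  have "((\<lambda>z. kap \<mu> z / (of_real \<mu> + f z)) has_field_derivative
      (- f z * deriv f z / ?k * ?g - ?k * deriv f z) / (?g * ?g)) (at z)"
    by (rule DERIV_cong[OF DERIV_divide[OF dk DERIV_add[OF DERIV_const DERIV_f[OF zs]] g]]) simp
  then have "(amp \<mu> has_field_derivative
      (- f z * deriv f z / ?k * ?g - ?k * deriv f z) / (?g * ?g) / (2 * amp \<mu> z)) (at z)"
    unfolding amp_def[abs_def] by (rule has_field_derivative_csqrt') (use amp_slit[OF x] in \<open>simp add: z_def\<close>)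
  moreover have "(- f z * deriv f z / ?k * ?g - ?k * deriv f z) / (?g * ?g) / (2 * amp \<mu> z) = cpl \<mu> z * amp \<mu> z"
  proof -
    have k2: "?k * ?k = (of_real \<mu> - f z) * ?g" using kap_power2[of \<mu> z] by (simp add: symb_factor power2_eq_square)
    have c2: "amp \<mu> z * amp \<mu> z = ?k / ?g" using amp_power2[of z] by (simp add: power2_eq_square)
    have "- f z * deriv f z / ?k * ?g - ?k * deriv f z = - deriv f z * (f z * ?g + ?k * ?k) / ?k"
      using k by (simp add: field_simps)
    \<comment> \<open>\<open>?k * ?k\<close> is \<open>(\<mu> - f z) * ?g\<close>, so the terms with
      \<open>f z\<close> cancel; this is the origin of the factor \<mu> in
      \<open>cpl\<close>.\<close>
    also have "f z * ?g + ?k * ?k = of_real \<mu> * ?g" unfolding k2 by (simp add: algebra_simps)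
    finally have N: "- f z * deriv f z / ?k * ?g - ?k * deriv f z = - deriv f z * (of_real \<mu> * ?g) / ?k" .
    have "(- D * (m * h) / l) / (h * h) = - (m * D) / (l * h)" if "h \<noteq> 0" for D m h l :: complex
      using that by (simp add: field_simps)
    from this[OF g] have "(- f z * deriv f z / ?k * ?g - ?k * deriv f z) / (?g * ?g) = - (of_real \<mu> * deriv f z) / (?k * ?g)"
      unfolding N .
    then have *: "(- f z * deriv f z / ?k * ?g - ?k * deriv f z) / (?g * ?g) / (2 * amp \<mu> z)
        = - (of_real \<mu> * deriv f z) / (?k * ?g) / (2 * amp \<mu> z)" by simp
    have "- M / (l * h) / (2 * b) = - M / (2 * (l * l)) * (l / h) / b" if "l \<noteq> 0" "h \<noteq> 0" "b \<noteq> 0" for M l h b :: complex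
      using that by (simp add: field_simps)
    from this[OF k g c] have "- (of_real \<mu> * deriv f z) / (?k * ?g) / (2 * amp \<mu> z)
       = - (of_real \<mu> * deriv f z) / (2 * (?k * ?k)) * (?k / ?g) / amp \<mu> z" .
    also have "\<dots> = - (of_real \<mu> * deriv f z) / (2 * symb \<mu> z) * amp \<mu> z"
      unfolding c2[symmetric] using c kap_power2[of \<mu> z] by (simp add: power2_eq_square)
    finally show ?thesis using * by (simp add: cpl_def)
  qed
  ultimately show ?thesis by simp
qed

text \<open>Each term contains \<open>deriv (deriv f)\<close> or the square of
  \<open>deriv f\<close>, so the derivative of the correction is integrable along the line.\<close>

lemma DERIV_cor:
  assumes x: "0 \<le> x"
  defines "z \<equiv> Complex x \<eta>"
  shows "(cor \<mu> has_field_derivative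
    - of_real \<mu> * (deriv (deriv f) z / (4 * kap \<mu> z ^ 3) + 3 * deriv f z * (f z * deriv f z) / (4 * kap \<mu> z ^ 5))) (at z)"
proof -
  let ?k = "kap \<mu> z"
  have k: "?k \<noteq> 0" using kap_nz[OF x] by (simp add: z_def)
  have zs: "z \<in> strip \<rho>" using line_in_strip by (simp add: z_def)
  have dk: "(kap \<mu> has_field_derivative - f z * deriv f z / ?k) (at z)"
    using DERIV_kap[OF zs] symb_line[OF x] by (simp add: z_def)
  have "cor \<mu> = (\<lambda>z. - of_real \<mu> * deriv f z / (4 * kap \<mu> z ^ 3))"
    by (rule ext) (simp add: cor_def cpl_def kap_power2[symmetric] power2_eq_square power3_eq_cube)
  moreover have "((\<lambda>z. - of_real \<mu> * deriv f z / (4 * kap \<mu> z ^ 3)) has_field_derivative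
     ((- of_real \<mu> * deriv (deriv f) z) * (4 * ?k ^ 3) - (- of_real \<mu> * deriv f z) * (4 * (3 * ?k ^ 2 * (- f z * deriv f z / ?k)))) / ((4 * ?k ^ 3) * (4 * ?k ^ 3))) (at z)"
    by (rule DERIV_cong[OF DERIV_divide[OF DERIV_cmult[OF DERIV_f1[OF zs]] DERIV_cmult[OF DERIV_power[OF dk, of 3]]]])
      (use k in simp_all)
  moreover have "((- of_real \<mu> * deriv (deriv f) z) * (4 * ?k ^ 3) - (- of_real \<mu> * deriv f z) * (4 * (3 * ?k ^ 2 * (- f z * deriv f z / ?k)))) / ((4 * ?k ^ 3) * (4 * ?k ^ 3))
    = - of_real \<mu> * (deriv (deriv f) z / (4 * ?k ^ 3) + 3 * deriv f z * (f z * deriv f z) / (4 * ?k ^ 5))"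
    using k by (simp add: field_simps power_numeral_reduce)
  ultimately show ?thesis by simp
qed

text \<open>The factor \<^term>\<open>amp \<mu>\<close> is chosen so that \<open>p q\<close> is the difference of the squares of the two
  amplitudes, with no further prefactor.\<close>

lemma wkb_system:
  fixes p q :: "complex \<Rightarrow> complex" and \<epsilon> :: real
  assumes x: "0 \<le> x" and \<epsilon>: "0 < \<epsilon>"
  defines "z \<equiv> Complex x \<eta>"
  assumes p: "(p has_field_derivative (of_real \<mu> - f z) / of_real \<epsilon> * q z) (at z)"
    and q: "(q has_field_derivative (of_real \<mu> + f z) / of_real \<epsilon> * p z) (at z)"
  shows "((\<lambda>z. (amp \<mu> z * q z + p z / amp \<mu> z) / 2) has_field_derivative
      kap \<mu> z / of_real \<epsilon> * ((amp \<mu> z * q z + p z / amp \<mu> z) / 2) + cpl \<mu> z * ((amp \<mu> z * q z - p z / amp \<mu> z) / 2)) (at z)"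
    and "((\<lambda>z. (amp \<mu> z * q z - p z / amp \<mu> z) / 2) has_field_derivative
      - kap \<mu> z / of_real \<epsilon> * ((amp \<mu> z * q z - p z / amp \<mu> z) / 2) + cpl \<mu> z * ((amp \<mu> z * q z + p z / amp \<mu> z) / 2)) (at z)"
proof -
  let ?c = "amp \<mu> z" and ?k = "kap \<mu> z" and ?g = "of_real \<mu> + f z" and ?m = "cpl \<mu> z"
  have k: "?k \<noteq> 0" and g: "?g \<noteq> 0" and c: "?c \<noteq> 0"
    using kap_nz[OF x] denom_nz[OF x] amp_nz[OF x] by (simp_all add: z_def)
  have c': "(amp \<mu> has_field_derivative ?m * ?c) (at z)" using DERIV_amp[OF x] by (simp add: z_def)
  have c2: "?c * ?c = ?k / ?g" using amp_power2[of z] by (simp add: power2_eq_square)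
  have k2: "?k * ?k = (of_real \<mu> - f z) * ?g" using kap_power2[of \<mu> z] by (simp add: symb_factor power2_eq_square)
  \<comment> \<open>This identity and the next diagonalise the leading part: for the pair
    \<open>amp * q\<close> and \<open>p / amp\<close> both off-diagonal coefficients become
    \<open>kap / \<epsilon>\<close>, so sum and difference separate up to
    \<open>cpl\<close>.\<close>
  have e1: "?c * ?g = ?k / ?c"
  proof -
    have "?c * ?c * ?g = ?k" using c2 g by simp
    then show ?thesis using c by (simp add: field_simps)
  qed
  have e2: "(of_real \<mu> - f z) / ?c = ?k * ?c"
  proof -
    have "?k * (?c * ?c) = of_real \<mu> - f z" unfolding c2 using k2 g by (simp add: field_simps)
    then show ?thesis using c by (simp add: field_simps)
  qed
  have d1: "((\<lambda>z. amp \<mu> z * q z) has_field_derivative ?m * (?c * q z) + ?k / of_real \<epsilon> * (p z / ?c)) (at z)"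
  proof -
    have "((\<lambda>z. amp \<mu> z * q z) has_field_derivative ?m * ?c * q z + (?g / of_real \<epsilon> * p z) * ?c) (at z)"
      by (rule DERIV_mult[OF c' q])
    moreover have "(?g / of_real \<epsilon> * p z) * ?c = (?c * ?g) / of_real \<epsilon> * p z" by simp
    ultimately show ?thesis unfolding e1 by (simp add: mult.commute mult.left_commute)
  qed
  have d2: "((\<lambda>z. p z / amp \<mu> z) has_field_derivative ?k / of_real \<epsilon> * (?c * q z) - ?m * (p z / ?c)) (at z)"
  proof -
    have "((\<lambda>z. p z / amp \<mu> z) has_field_derivative (((of_real \<mu> - f z) / of_real \<epsilon> * q z) * ?c - p z * (?m * ?c)) / (?c * ?c)) (at z)"
      by (rule DERIV_divide[OF p c' c])
    moreover have "(((of_real \<mu> - f z) / of_real \<epsilon> * q z) * ?c - p z * (?m * ?c)) / (?c * ?c)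
      = ((of_real \<mu> - f z) / ?c) / of_real \<epsilon> * q z - ?m * (p z / ?c)"
      using c \<epsilon> by (simp add: field_simps)
    ultimately show ?thesis unfolding e2 by (simp add: mult.commute mult.left_commute)
  qed
  have alg: "(m * R + k / e * P + (k / e * R - m * P)) / 2 = k / e * ((R + P) / 2) + m * ((R - P) / 2)"
    "(m * R + k / e * P - (k / e * R - m * P)) / 2 = - k / e * ((R - P) / 2) + m * ((R + P) / 2)"
    for m R k e P :: complex
    by (cases "e = 0"; simp add: field_simps)+
  show "((\<lambda>z. (amp \<mu> z * q z + p z / amp \<mu> z) / 2) has_field_derivative
      kap \<mu> z / of_real \<epsilon> * ((amp \<mu> z * q z + p z / amp \<mu> z) / 2) + cpl \<mu> z * ((amp \<mu> z * q z - p z / amp \<mu> z) / 2)) (at z)"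
    by (rule DERIV_cong[OF DERIV_cdivide[OF DERIV_add[OF d1 d2]]]) (rule alg(1))
  show "((\<lambda>z. (amp \<mu> z * q z - p z / amp \<mu> z) / 2) has_field_derivative
      - kap \<mu> z / of_real \<epsilon> * ((amp \<mu> z * q z - p z / amp \<mu> z) / 2) + cpl \<mu> z * ((amp \<mu> z * q z + p z / amp \<mu> z) / 2)) (at z)"
    by (rule DERIV_cong[OF DERIV_cdivide[OF DERIV_diff[OF d1 d2]]]) (rule alg(2))
qed

end

end

text \<open>Derivatives are taken within sets because the primitive of \<open>kap\<close> lives on
  the closed half-strip, whose edges serve as integration paths.\<close>

lemma horizontal_chain:
  assumes "(g has_field_derivative g') (at (Complex x y) within S)" "(\<lambda>x. Complex x y) ` T \<subseteq> S"
  shows "((\<lambda>x. g (Complex x y)) has_vector_derivative g') (at x within T)"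
proof -
  have "((\<lambda>x. Complex x y) has_vector_derivative 1) (at x within T)"
    unfolding Complex_eq has_vector_derivative_def by (auto intro!: derivative_eq_intros simp: scaleR_conv_of_real)
  from field_vector_diff_chain_within[OF this DERIV_subset[OF assms]]
  show ?thesis by (simp add: o_def)
qed

lemma vertical_chain:
  assumes "(g has_field_derivative g') (at (Complex x y) within S)" "(\<lambda>y. Complex x y) ` T \<subseteq> S"
  shows "((\<lambda>y. g (Complex x y)) has_vector_derivative \<i> * g') (at y within T)"
proof -
  have "((\<lambda>y. Complex x y) has_vector_derivative \<i>) (at y within T)"
    unfolding Complex_eq has_vector_derivative_def by (auto intro!: derivative_eq_intros simp: scaleR_conv_of_real)
  from field_vector_diff_chain_within[OF this DERIV_subset[OF assms]]
  show ?thesis by (simp add: o_def)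
qed

section \<open>Uniform constants and the connection estimate along the line\<close>

context wkb_line begin

definition halfstrip :: "complex set" where
  "halfstrip = {z. 0 \<le> Re z \<and> 0 \<le> Im z \<and> Im z \<le> \<eta>}"

text \<open>\<open>B1\<close>, \<open>B2\<close> and \<open>B3\<close> bound \<open>cpl\<close>,
  \<open>cor\<close> and the derivative of \<open>cor\<close>, the first and the last relative to
  \<open>decay\<close>. They arise by replacing \<mu> by \<open>A 0\<close>, \<open>kap\<close> by
  \<open>d\<close> and remaining factors by \<open>C\<close>, which frees them of \<mu> and
  \<epsilon>.\<close>

definition B1 :: real where "B1 = A 0 / (2 * d\<^sup>2)"
definition B2 :: real where "B2 = A 0 * C / (4 * d ^ 3)"
definition B3 :: real where "B3 = A 0 * (1 / (4 * d ^ 3) + 3 * C\<^sup>2 / (4 * d ^ 5))"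
text \<open>A common bound for the coefficients that appear when \<open>ap\<close> is expressed by
  \<open>u\<close> and \<open>am\<close> in \<open>connection\<close>: each of the four summands
  occurs in one of the two estimates there.\<close>

definition DD :: real where "DD = B1 + B3 + B1 * B2 + B1 * B2\<^sup>2"
text \<open>The integral of \<open>DD * decay\<close> over the half-line, finite because \<sigma>
  exceeds 1.\<close>

definition K0 :: real where "K0 = DD * C / (\<sigma> - 1)"
definition K1 :: real where "K1 = (2 + 3 * K0) * exp (2 * K0) ^ 2"
text \<open>The bound \<open>K1\<close> after passing from \<open>ap\<close> to \<open>u\<close> at
  \<open>X\<close> and back from \<open>u\<close> to \<open>ap\<close> at 0; each passage costs a
  term in \<open>B2\<close>.\<close>

definition GG :: real where "GG = (1 + B2) * (K1 * (1 + B2)) + B2"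

lemma constants_nonneg: "0 \<le> B1" "0 \<le> B2" "0 \<le> B3" "0 \<le> DD" "0 \<le> K0" "0 \<le> K1" "0 \<le> GG"
proof -
  show 1: "0 \<le> B1" "0 \<le> B2" "0 \<le> B3" using d C_pos A_pos[of 0] by (simp_all add: B1_def B2_def B3_def)
  show 2: "0 \<le> DD" unfolding DD_def using 1 by simp
  show 3: "0 \<le> K0" unfolding K0_def using 2 C_pos \<sigma> by simp
  show 4: "0 \<le> K1" unfolding K1_def using 3 by simp
  show "0 \<le> GG" unfolding GG_def using 4 1 by simp
qed

lemma coefficient_bounds:
  assumes \<mu>: "a \<le> \<mu>" "\<mu> \<le> A 0" and x: "0 \<le> x"
  defines "z \<equiv> Complex x \<eta>"
  shows "norm (cpl \<mu> z) \<le> B1 * decay x"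
    and "norm (cor \<mu> z) \<le> B2"
    and "norm (- of_real \<mu> * (deriv (deriv f) z / (4 * kap \<mu> z ^ 3) + 3 * deriv f z * (f z * deriv f z) / (4 * kap \<mu> z ^ 5))) \<le> B3 * decay x"
proof -
  have mu0: "0 < \<mu>" using \<mu> a by linarith
  have k: "d \<le> norm (kap \<mu> z)" using kap_ge[OF \<mu> x] by (simp add: z_def)
  have lb: "norm (f z) \<le> C" "norm (deriv f z) \<le> decay x" "norm (deriv (deriv f) z) \<le> decay x" "norm (deriv f z) \<le> C"
    using line_bounds[OF x] by (simp_all add: z_def)
  have dec: "0 \<le> decay x" by (rule decay_nonneg)
  have pw: "d ^ j \<le> norm (kap \<mu> z) ^ j" "0 < d ^ j" for j using k d by (auto intro: power_mono)
  have "norm (cpl \<mu> z) = \<mu> * norm (deriv f z) / (2 * norm (kap \<mu> z) ^ 2)"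
    using mu0 by (simp add: cpl_def kap_power2[symmetric] norm_mult norm_divide norm_power)
  also have "\<dots> \<le> A 0 * decay x / (2 * d ^ 2)"
    using \<mu> mu0 lb dec pw[of 2] A_pos[of 0] by (intro frac_le mult_mono mult_nonneg_nonneg) auto
  finally show c1: "norm (cpl \<mu> z) \<le> B1 * decay x" by (simp add: B1_def)
  have "norm (cor \<mu> z) = \<mu> * norm (deriv f z) / (4 * norm (kap \<mu> z) ^ 3)"
    using mu0 by (simp add: cor_def cpl_def kap_power2[symmetric] norm_mult norm_divide norm_power power2_eq_square power3_eq_cube)
  also have "\<dots> \<le> A 0 * C / (4 * d ^ 3)"
    using \<mu> mu0 lb dec pw[of 3] A_pos[of 0] C_pos by (intro frac_le mult_mono mult_nonneg_nonneg) auto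
  finally show "norm (cor \<mu> z) \<le> B2" by (simp add: B2_def)
  have "norm (deriv (deriv f) z / (4 * kap \<mu> z ^ 3)) \<le> decay x / (4 * d ^ 3)"
    unfolding norm_divide norm_mult norm_power using lb dec pw[of 3] by (intro frac_le) auto
  moreover have "norm (3 * deriv f z * (f z * deriv f z) / (4 * kap \<mu> z ^ 5)) \<le> 3 * decay x * (C * C) / (4 * d ^ 5)"
    unfolding norm_divide norm_mult norm_power using lb dec pw[of 5] C_pos
    by (intro frac_le mult_mono mult_nonneg_nonneg) auto
  ultimately have "norm (deriv (deriv f) z / (4 * kap \<mu> z ^ 3) + 3 * deriv f z * (f z * deriv f z) / (4 * kap \<mu> z ^ 5))
     \<le> decay x / (4 * d ^ 3) + 3 * decay x * (C * C) / (4 * d ^ 5)" (is "norm ?E \<le> ?F") by (rule norm_triangle_mono)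
  then have "\<mu> * norm ?E \<le> A 0 * ?F" using \<mu> mu0 by (intro mult_mono) auto
  also have "A 0 * ?F = B3 * decay x" by (simp add: B3_def power2_eq_square algebra_simps)
  finally show "norm (- of_real \<mu> * ?E) \<le> B3 * decay x" using mu0 by (simp add: norm_mult)
qed

text \<open>Multiplication by \<open>E\<close> freezes the recessive amplitude up to the coupling:
  \<open>am\<close> has derivative \<open>m * ap\<close>, whereas \<open>ap\<close> has derivative
  \<open>2 * k * ap + m * am\<close> with \<open>Re k \<ge> 0\<close>. Going back from
  \<open>X\<close> to 0 is therefore the stable direction, and the constant is independent of
  \<open>X\<close>, which may tend to infinity.\<close>

lemma connection:
  fixes p q \<Phi> :: "complex \<Rightarrow> complex" and \<epsilon> :: real
  assumes \<mu>: "a \<le> \<mu>" "\<mu> \<le> A 0" and \<epsilon>: "0 < \<epsilon>" "\<epsilon> \<le> 1"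
    and p: "\<And>z. z \<in> strip \<rho> \<Longrightarrow> (p has_field_derivative (of_real \<mu> - f z) / of_real \<epsilon> * q z) (at z)"
    and q: "\<And>z. z \<in> strip \<rho> \<Longrightarrow> (q has_field_derivative (of_real \<mu> + f z) / of_real \<epsilon> * p z) (at z)"
    and \<Phi>: "\<And>z. z \<in> halfstrip \<Longrightarrow> (\<Phi> has_field_derivative kap \<mu> z) (at z within halfstrip)"
    and X: "0 < X"
  defines "E \<equiv> \<lambda>x. exp ((\<Phi> (Complex x \<eta>) - \<Phi> (Complex 0 \<eta>)) / of_real \<epsilon>)"
  defines "ap \<equiv> \<lambda>x. E x * ((amp \<mu> (Complex x \<eta>) * q (Complex x \<eta>) + p (Complex x \<eta>) / amp \<mu> (Complex x \<eta>)) / 2)"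
  defines "am \<equiv> \<lambda>x. E x * ((amp \<mu> (Complex x \<eta>) * q (Complex x \<eta>) - p (Complex x \<eta>) / amp \<mu> (Complex x \<eta>)) / 2)"
  shows "norm (ap 0) \<le> GG * (norm (ap X) + \<epsilon> * norm (am X))"
    and "norm (am 0 - am X) \<le> GG * (norm (ap X) + \<epsilon> * norm (am X))"
proof -
  define k where "k = (\<lambda>x. kap \<mu> (Complex x \<eta>) / of_real \<epsilon>)"
  define m where "m = (\<lambda>x. cpl \<mu> (Complex x \<eta>))"
  define n where "n = (\<lambda>x. cor \<mu> (Complex x \<eta>))"
  define n' where "n' = (\<lambda>x. let z = Complex x \<eta> in - of_real \<mu> * (deriv (deriv f) z / (4 * kap \<mu> z ^ 3) + 3 * deriv f z * (f z * deriv f z) / (4 * kap \<mu> z ^ 5)))"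
  have E: "(E has_vector_derivative k x * E x) (at x within {0..})" if "0 \<le> x" for x
  proof -
    have "((\<lambda>z. exp ((\<Phi> z - \<Phi> (Complex 0 \<eta>)) / of_real \<epsilon>)) has_field_derivative
       exp ((\<Phi> (Complex x \<eta>) - \<Phi> (Complex 0 \<eta>)) / of_real \<epsilon>) * ((kap \<mu> (Complex x \<eta>) - 0) / of_real \<epsilon>)) (at (Complex x \<eta>) within halfstrip)"
      by (rule DERIV_chain2[OF DERIV_exp DERIV_cdivide[OF DERIV_diff[OF \<Phi> DERIV_const]]]) (use that \<eta> in \<open>simp add: halfstrip_def\<close>)
    moreover have "(\<lambda>x. Complex x \<eta>) ` {0..} \<subseteq> halfstrip" using \<eta> by (auto simp: halfstrip_def)
    ultimately show ?thesis
      using horizontal_chain by (fastforce simp: E_def k_def mult.commute)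
  qed
  have ap: "(ap has_vector_derivative 2 * k x * ap x + m x * am x) (at x within {0..})" if "0 \<le> x" for x
  proof -
    note w = horizontal_chain[OF wkb_system(1)[OF \<mu> that \<epsilon>(1) p[OF line_in_strip] q[OF line_in_strip]], of "{0..}"]
    have "(ap has_vector_derivative E x * (kap \<mu> (Complex x \<eta>) / of_real \<epsilon> * ((amp \<mu> (Complex x \<eta>) * q (Complex x \<eta>) + p (Complex x \<eta>) / amp \<mu> (Complex x \<eta>)) / 2) + cpl \<mu> (Complex x \<eta>) * ((amp \<mu> (Complex x \<eta>) * q (Complex x \<eta>) - p (Complex x \<eta>) / amp \<mu> (Complex x \<eta>)) / 2))
       + k x * E x * ((amp \<mu> (Complex x \<eta>) * q (Complex x \<eta>) + p (Complex x \<eta>) / amp \<mu> (Complex x \<eta>)) / 2)) (at x within {0..})"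
      unfolding ap_def by (rule has_vector_derivative_mult[OF E[OF that] w]) simp
    then show ?thesis
      by (rule has_vector_derivative_eq_rhs) (simp only: ap_def am_def k_def m_def ring_distribs mult_ac mult_2 add_ac)
  qed
  have am: "(am has_vector_derivative m x * ap x) (at x within {0..})" if "0 \<le> x" for x
  proof -
    note w = horizontal_chain[OF wkb_system(2)[OF \<mu> that \<epsilon>(1) p[OF line_in_strip] q[OF line_in_strip]], of "{0..}"]
    have "(am has_vector_derivative E x * (- kap \<mu> (Complex x \<eta>) / of_real \<epsilon> * ((amp \<mu> (Complex x \<eta>) * q (Complex x \<eta>) - p (Complex x \<eta>) / amp \<mu> (Complex x \<eta>)) / 2) + cpl \<mu> (Complex x \<eta>) * ((amp \<mu> (Complex x \<eta>) * q (Complex x \<eta>) + p (Complex x \<eta>) / amp \<mu> (Complex x \<eta>)) / 2))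
       + k x * E x * ((amp \<mu> (Complex x \<eta>) * q (Complex x \<eta>) - p (Complex x \<eta>) / amp \<mu> (Complex x \<eta>)) / 2)) (at x within {0..})"
      unfolding am_def by (rule has_vector_derivative_mult[OF E[OF that] w]) simp
    moreover have "e * (- kk / ee * V + c * U) + kk / ee * e * V = c * (e * U)" for e kk ee V c U :: complex
      by (simp add: algebra_simps)
    ultimately show ?thesis unfolding k_def ap_def am_def m_def by (simp only:)
  qed
  have n: "(n has_vector_derivative n' x) (at x within {0..})" if "0 \<le> x" for x
    using horizontal_chain[OF DERIV_cor[OF \<mu> that], of "{0..}"] by (simp add: n_def n'_def Let_def)
  \<comment> \<open>The multiple of \<open>am\<close> is chosen so that \<open>2 * k * u\<close>
    reproduces the term \<open>m * am\<close>; every term of the remainder \<open>g\<close> carries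
    the factor \<epsilon>.\<close>
  define u where "u = (\<lambda>x. ap x + of_real \<epsilon> * n x * am x)"
  define g where "g = (\<lambda>x. of_real \<epsilon> * n' x * am x + of_real \<epsilon> * n x * (m x * ap x))"
  have knm: "2 * k x * (of_real \<epsilon> * n x) = m x" if "0 \<le> x" for x
    using kap_nz[OF \<mu> that] \<epsilon> by (simp add: k_def n_def m_def cor_def)
  have u: "(u has_vector_derivative (2 * k x) * u x + g x) (at x within {0..})" if "0 \<le> x" for x
  proof -
    have "((\<lambda>x. of_real \<epsilon> * n x) has_vector_derivative of_real \<epsilon> * n' x) (at x within {0..})"
      by (rule has_vector_derivative_mult_right[OF n[OF that]])
    from has_vector_derivative_add[OF ap[OF that] has_vector_derivative_mult[OF this am[OF that]]]
    have "(u has_vector_derivative (2 * k x * ap x + m x * am x) + (of_real \<epsilon> * n x * (m x * ap x) + of_real \<epsilon> * n' x * am x)) (at x within {0..})"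
      by (simp add: u_def)
    moreover have "(2 * k x * ap x + m x * am x) + (of_real \<epsilon> * n x * (m x * ap x) + of_real \<epsilon> * n' x * am x) = (2 * k x) * u x + g x"
      unfolding u_def g_def distrib_left knm[OF that, symmetric] by (simp add: mult_ac add_ac)
    ultimately show ?thesis by simp
  qed
  have toat: "(F has_vector_derivative F') (at x)" if "(F has_vector_derivative F') (at x within {0..})" "0 < x" for F :: "real \<Rightarrow> complex" and F' x
    using that at_within_interior[of x "{0..}"] by (simp add: interior_real_atLeast)
  have cont: "continuous_on {0..X} F" if "\<And>x. 0 \<le> x \<Longrightarrow> (F has_vector_derivative F' x) (at x within {0..})" for F F' :: "real \<Rightarrow> complex"
    by (rule continuous_on_subset[of "{0..}"]) (auto simp: continuous_on_eq_continuous_within intro!: has_vector_derivative_continuous that)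
  \<comment> \<open>An antiderivative of \<open>DD * decay\<close> that starts at
    \<open>- K0\<close> and increases towards 0, so its total increase is at most
    \<open>K0\<close>.\<close>
  define Kf where "Kf = (\<lambda>x. - (DD * C / (\<sigma> - 1)) * (1 + x) powr (1 - \<sigma>))"
  have Kf: "(Kf has_real_derivative DD * decay x) (at x)" if "0 \<le> x" for x
  proof -
    have "((\<lambda>x. (1 + x) powr (1 - \<sigma>)) has_real_derivative (1 - \<sigma>) * (1 + x) powr (-\<sigma>)) (at x)"
      using that by (auto intro!: derivative_eq_intros)
    from DERIV_cmult[OF this, of "- (DD * C / (\<sigma> - 1))"]
    have "(Kf has_real_derivative - (DD * C / (\<sigma> - 1)) * ((1 - \<sigma>) * (1 + x) powr (-\<sigma>))) (at x)"
      by (simp add: Kf_def)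
    moreover have "- (D / (s - 1)) * ((1 - s) * y) = D * y" if "1 < s" for D s y :: real
      using that by (simp add: field_simps)
    from this[OF \<sigma>] have "- (DD * C / (\<sigma> - 1)) * ((1 - \<sigma>) * (1 + x) powr (-\<sigma>)) = DD * decay x"
      by (simp only: decay_def mult.assoc)
    ultimately show ?thesis by simp
  qed
  have contK: "continuous_on {0..X} Kf"
    by (intro continuous_at_imp_continuous_on ballI DERIV_isCont[OF Kf]) auto
  have KX: "Kf X - Kf 0 \<le> K0"
  proof -
    have "0 \<le> DD * C / (\<sigma> - 1) * (1 + X) powr (1 - \<sigma>)" using constants_nonneg C_pos \<sigma> by simp
    then show ?thesis by (simp add: Kf_def K0_def)
  qed
  have bounds: "norm (m x) \<le> B1 * decay x" "norm (n x) \<le> B2" "norm (n' x) \<le> B3 * decay x" if "0 \<le> x" for x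
    using coefficient_bounds[OF \<mu> that] by (simp_all add: m_def n_def n'_def Let_def)
  have ap_le: "norm (ap x) \<le> norm (u x) + \<epsilon> * (B2 * norm (am x))" if "0 \<le> x" for x
  proof -
    have "ap x = u x - of_real \<epsilon> * (n x * am x)" by (simp add: u_def)
    also have "norm \<dots> \<le> norm (u x) + \<epsilon> * (norm (n x) * norm (am x))"
      using norm_triangle_ineq4[of "u x" "of_real \<epsilon> * (n x * am x)"] \<epsilon> by (simp add: norm_mult)
    also have "\<dots> \<le> norm (u x) + \<epsilon> * (B2 * norm (am x))"
      using bounds[OF that] \<epsilon> by (intro add_left_mono mult_left_mono mult_right_mono) auto
    finally show ?thesis .
  qed
  have g_le: "norm (g x) \<le> \<epsilon> * (DD * decay x) * (norm (u x) + norm (am x))" if "0 \<le> x" for x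
  proof -
    have "g x = of_real \<epsilon> * (n' x * am x + n x * m x * ap x)" by (simp add: g_def algebra_simps)
    then have "norm (g x) = \<epsilon> * norm (n' x * am x + n x * m x * ap x)" using \<epsilon> by (simp add: norm_mult)
    also have "norm (n' x * am x + n x * m x * ap x) \<le> norm (n' x) * norm (am x) + norm (n x) * norm (m x) * norm (ap x)"
      using norm_triangle_ineq[of "n' x * am x" "n x * m x * ap x"] by (simp add: norm_mult)
    also have "\<dots> \<le> B3 * decay x * norm (am x) + B2 * (B1 * decay x) * (norm (u x) + B2 * norm (am x))"
    proof (intro add_mono mult_mono bounds that mult_nonneg_nonneg constants_nonneg decay_nonneg norm_ge_zero)
      have "\<epsilon> * (B2 * norm (am x)) \<le> 1 * (B2 * norm (am x))" using \<epsilon> constants_nonneg by (intro mult_right_mono) auto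
      then show "norm (ap x) \<le> norm (u x) + B2 * norm (am x)" using ap_le[OF that] by simp
    qed auto
    also have "\<dots> \<le> DD * decay x * (norm (u x) + norm (am x))"
    proof -
      have "DD * decay x * (norm (u x) + norm (am x)) - (B3 * decay x * norm (am x) + B2 * (B1 * decay x) * (norm (u x) + B2 * norm (am x)))
        = decay x * ((B1 + B3 + B1 * B2\<^sup>2) * norm (u x) + (B1 + B1 * B2) * norm (am x))"
        by (simp add: DD_def power2_eq_square algebra_simps)
      moreover have "0 \<le> \<dots>" using constants_nonneg by (intro mult_nonneg_nonneg decay_nonneg add_nonneg_nonneg) auto
      ultimately show ?thesis by linarith
    qed
    finally show ?thesis using \<epsilon> by (simp add: mult_left_mono)
  qed
  have h_le: "norm (m x * ap x) \<le> DD * decay x * (norm (u x) + \<epsilon> * norm (am x))" if "0 \<le> x" for x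
  proof -
    have "norm (m x * ap x) \<le> B1 * decay x * (norm (u x) + \<epsilon> * (B2 * norm (am x)))"
      unfolding norm_mult by (intro mult_mono bounds that ap_le mult_nonneg_nonneg constants_nonneg decay_nonneg) auto
    also have "\<dots> \<le> DD * decay x * (norm (u x) + \<epsilon> * norm (am x))"
    proof -
      have "DD * decay x * (norm (u x) + \<epsilon> * norm (am x)) - B1 * decay x * (norm (u x) + \<epsilon> * (B2 * norm (am x)))
        = decay x * ((B3 + B1 * B2 + B1 * B2\<^sup>2) * norm (u x) + (B1 + B3 + B1 * B2\<^sup>2) * (\<epsilon> * norm (am x)))"
        by (simp add: DD_def power2_eq_square algebra_simps)
      moreover have "0 \<le> \<dots>" using constants_nonneg \<epsilon> by (intro mult_nonneg_nonneg decay_nonneg add_nonneg_nonneg) auto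
      ultimately show ?thesis by linarith
    qed
    finally show ?thesis .
  qed
  have Re_k: "0 \<le> Re (2 * k x)" if "0 \<le> x" for x
    using Re_kap_nonneg[OF \<mu> that] \<epsilon> by (simp add: k_def)
  have conn: "norm (u 0) \<le> K1 * (norm (u X) + \<epsilon> * norm (am X))" "norm (am 0 - am X) \<le> K1 * (norm (u X) + \<epsilon> * norm (am X))"
    unfolding K1_def
    by (rule backward_connection[OF X cont[OF u] cont[OF am] contK, where l = "\<lambda>x. 2 * k x" and g = g and h = "\<lambda>x. m x * ap x" and k = "\<lambda>x. DD * decay x" and e = \<epsilon>];
       use u am toat Kf Re_k g_le h_le constants_nonneg decay_nonneg \<epsilon> KX in \<open>force\<close>)+
  define T where "T = norm (ap X) + \<epsilon> * norm (am X)"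
  have T0: "0 \<le> T" "\<epsilon> * norm (am X) \<le> T" using \<epsilon> by (simp_all add: T_def)
  have "norm (u X) \<le> norm (ap X) + norm (of_real \<epsilon> * n X * am X)" unfolding u_def by (rule norm_triangle_ineq)
  also have "norm (of_real \<epsilon> * n X * am X) \<le> B2 * (\<epsilon> * norm (am X))"
    using mult_right_mono[OF bounds(2), of X "\<epsilon> * norm (am X)"] X \<epsilon> by (simp add: norm_mult mult_ac)
  also have "B2 * (\<epsilon> * norm (am X)) \<le> B2 * T" using T0 constants_nonneg by (intro mult_left_mono)
  finally have "norm (u X) + \<epsilon> * norm (am X) \<le> (1 + B2) * T" by (simp add: T_def algebra_simps)
  then have L: "K1 * (norm (u X) + \<epsilon> * norm (am X)) \<le> K1 * (1 + B2) * T"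
    using constants_nonneg mult_left_mono[of _ _ K1] by (simp add: mult.assoc)
  define L1 where "L1 = K1 * (1 + B2)"
  have L1: "0 \<le> L1" using constants_nonneg by (simp add: L1_def)
  have u0: "norm (u 0) \<le> L1 * T" and am0: "norm (am 0 - am X) \<le> L1 * T" using conn L by (auto simp: L1_def)
  have GG: "GG = (1 + B2) * L1 + B2" by (simp add: GG_def L1_def)
  have "L1 * T \<le> GG * T" unfolding GG using T0 constants_nonneg L1 by (intro mult_right_mono) (simp_all add: algebra_simps)
  then show "norm (am 0 - am X) \<le> GG * (norm (ap X) + \<epsilon> * norm (am X))" using am0 by (simp add: T_def)
  \<comment> \<open>Returning from \<open>u\<close> to \<open>ap\<close> at 0 costs a multiple of
    \<epsilon> times \<open>am 0\<close>, and \<open>am 0\<close> differs from \<open>am X\<close>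
    by the bound just obtained.\<close>
  have "norm (am 0) \<le> norm (am X) + L1 * T" using am0 norm_triangle_ineq2[of "am 0" "am X"] by simp
  then have "\<epsilon> * norm (am 0) \<le> \<epsilon> * (norm (am X) + L1 * T)" using \<epsilon> by (intro mult_left_mono) auto
  also have "\<dots> \<le> T + L1 * T"
    using T0 \<epsilon> L1 mult_right_mono[of \<epsilon> 1 "L1 * T"] by (simp add: distrib_left)
  finally have "B2 * (\<epsilon> * norm (am 0)) \<le> B2 * (T + L1 * T)" using constants_nonneg by (intro mult_left_mono)
  then have "norm (ap 0) \<le> L1 * T + B2 * (T + L1 * T)" using ap_le[of 0] u0 by (simp add: mult.left_commute)
  also have "\<dots> = GG * T" by (simp add: GG algebra_simps)
  finally show "norm (ap 0) \<le> GG * (norm (ap X) + \<epsilon> * norm (am X))" by (simp add: T_def)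
qed

end

section \<open>Eigenfunctions\<close>

text \<open>In the derivative of the energy the contributions of \<open>B\<close> cancel, since
  \<open>B\<close> enters the two equations with opposite signs; the growth rate is controlled by
  \<open>c\<close> alone.\<close>

lemma zero_solution_unique:
  fixes p q :: "real \<Rightarrow> complex" and B :: "real \<Rightarrow> real"
  assumes p: "\<And>x. (p has_vector_derivative of_real (c - B x) * q x) (at x)"
    and q: "\<And>x. (q has_vector_derivative of_real (c + B x) * p x) (at x)"
    and c: "0 \<le> c" and zero: "p x0 = 0" "q x0 = 0"
  shows "p x = 0 \<and> q x = 0"
proof -
  define E where "E = (\<lambda>x. (norm (p x))\<^sup>2 + (norm (q x))\<^sup>2)"
  define E' where "E' = (\<lambda>x. 2 * (p x \<bullet> (of_real (c - B x) * q x)) + 2 * (q x \<bullet> (of_real (c + B x) * p x)))"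
  have E: "(E has_real_derivative E' x) (at x)" for x
    unfolding E_def E'_def by (intro DERIV_add has_real_derivative_norm_power2 p q)
  have E'_eq: "E' x = 4 * c * (p x \<bullet> q x)" for x
    unfolding E'_def by (simp add: inner_complex_def algebra_simps)
  have bound: "\<bar>E' x\<bar> \<le> 2 * c * E x" for x
  proof -
    have "\<bar>p x \<bullet> q x\<bar> \<le> norm (p x) * norm (q x)" by (rule Cauchy_Schwarz_ineq2)
    moreover have "2 * (norm (p x) * norm (q x)) \<le> E x"
      using sum_squares_bound[of "norm (p x)" "norm (q x)"] by (simp add: E_def)
    ultimately have "4 * c * \<bar>p x \<bullet> q x\<bar> \<le> 2 * c * E x" using c
      mult_left_mono[of "2 * \<bar>p x \<bullet> q x\<bar>" "E x" "2 * c"] by simp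
    then show ?thesis using c by (simp add: E'_eq abs_mult)
  qed
  have contE: "continuous_on S E" for S by (intro continuous_at_imp_continuous_on ballI DERIV_isCont[OF E])
  have "E x \<le> 0"
  proof (cases "x0 \<le> x")
    case True
    have "E x \<le> E x0 * exp (2 * c * x - 2 * c * x0)"
    proof (rule gronwall_forward[OF True contE _ E])
      show "((\<lambda>x. 2 * c * x) has_real_derivative 2 * c) (at y)" for y by (auto intro!: derivative_eq_intros)
      show "E' y \<le> 2 * c * E y" for y using bound[of y] by simp
    qed (intro continuous_intros)
    then show ?thesis using zero by (simp add: E_def)
  next
    case False
    then have "x \<le> x0" by simp
    have "E x + 0 \<le> (E x0 + 0) * exp (2 * c * x0 - 2 * c * x)"
    proof (rule gronwall_backward[OF \<open>x \<le> x0\<close> contE _ E])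
      show "((\<lambda>x. 2 * c * x) has_real_derivative 2 * c) (at y)" for y by (auto intro!: derivative_eq_intros)
      show "- (2 * c) * (E y + 0) \<le> E' y" for y using bound[of y] by simp
    qed (intro continuous_intros)
    then show ?thesis using zero by (simp add: E_def)
  qed
  moreover have "0 \<le> (norm (p x))\<^sup>2" "0 \<le> (norm (q x))\<^sup>2" by simp_all
  ultimately have "(norm (p x))\<^sup>2 = 0" "(norm (q x))\<^sup>2 = 0" unfolding E_def by linarith+
  then show ?thesis by simp
qed

lemma has_vector_derivative_complex_of_real:
  "(f has_real_derivative f') (at x) \<Longrightarrow> ((\<lambda>x. complex_of_real (f x)) has_vector_derivative of_real f') (at x)"
  by (simp add: has_vector_derivative_of_real has_real_derivative_iff_has_vector_derivative)

context analytic_well begin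

definition real_system :: "real \<Rightarrow> real \<Rightarrow> (real \<Rightarrow> real) \<Rightarrow> (real \<Rightarrow> real) \<Rightarrow> bool" where
  "real_system \<mu> \<epsilon> P Q \<longleftrightarrow> (\<forall>x. (P has_real_derivative (\<mu> - A x) / \<epsilon> * Q x) (at x) \<and>
      (Q has_real_derivative (\<mu> + A x) / \<epsilon> * P x) (at x))"

lemma real_system_nonzero:
  assumes sys: "real_system \<mu> \<epsilon> P Q" and "0 < \<epsilon>" "0 < \<mu>" and nz: "P x0 \<noteq> 0 \<or> Q x0 \<noteq> 0"
  shows "P x \<noteq> 0 \<or> Q x \<noteq> 0"
proof (rule ccontr)
  assume z: "\<not> (P x \<noteq> 0 \<or> Q x \<noteq> 0)"
  have "complex_of_real (P x0) = 0 \<and> complex_of_real (Q x0) = 0"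
  proof (rule zero_solution_unique[where c = "\<mu> / \<epsilon>" and B = "\<lambda>x. A x / \<epsilon>" and ?x0.0 = x and x = x0
        and p = "\<lambda>x. complex_of_real (P x)" and q = "\<lambda>x. complex_of_real (Q x)"])
    show "((\<lambda>x. complex_of_real (P x)) has_vector_derivative of_real (\<mu> / \<epsilon> - A y / \<epsilon>) * of_real (Q y)) (at y)" for y
      using has_vector_derivative_complex_of_real sys unfolding real_system_def
      by (metis diff_divide_distrib of_real_mult)
    show "((\<lambda>x. complex_of_real (Q x)) has_vector_derivative of_real (\<mu> / \<epsilon> + A y / \<epsilon>) * of_real (P y)) (at y)" for y
      using has_vector_derivative_complex_of_real sys unfolding real_system_def
      by (metis add_divide_distrib of_real_mult)
  qed (use z assms in auto)
  then show False using nz by simp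
qed

text \<open>The system for \<open>u1 + u2\<close> and \<open>u1 - u2\<close> has real coefficients,
  so the real or the imaginary part is a nonzero real solution. Reflection turns a solution
  \<open>p x\<close>, \<open>q x\<close> into \<open>p (- x)\<close>, \<open>- q (- x)\<close>;
  adding or subtracting the two gives components of opposite parity. Square integrability survives
  as one bound \<open>M\<close> for all \<open>X\<close>.\<close>

lemma eigenfunction_real_symmetric:
  assumes "is_eigenvalue A \<epsilon> (\<i> * of_real \<mu>)" and \<epsilon>: "0 < \<epsilon>"
  obtains P Q M x0 where "real_system \<mu> \<epsilon> P Q" "P x0 \<noteq> 0 \<or> Q x0 \<noteq> 0"
    "\<And>x. P (- x) * Q (- x) = - (P x * Q x)" "\<And>X. 0 \<le> X \<Longrightarrow> integral {0..X} (\<lambda>x. (P x)\<^sup>2 + (Q x)\<^sup>2) \<le> M"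
proof -
  obtain u1 u2 v1 v2 :: "real \<Rightarrow> complex" where
    du1: "\<And>x. (u1 has_vector_derivative v1 x) (at x)" and du2: "\<And>x. (u2 has_vector_derivative v2 x) (at x)"
    and e1: "\<And>x. - (of_real \<epsilon> / \<i>) * v1 x - \<i> * of_real (A x) * u2 x = \<i> * of_real \<mu> * u1 x"
    and e2: "\<And>x. - \<i> * of_real (A x) * u1 x + (of_real \<epsilon> / \<i>) * v2 x = \<i> * of_real \<mu> * u2 x"
    and int1: "(\<lambda>x. (cmod (u1 x))\<^sup>2) integrable_on UNIV" and int2: "(\<lambda>x. (cmod (u2 x))\<^sup>2) integrable_on UNIV"
    and nz: "\<exists>x. u1 x \<noteq> 0 \<or> u2 x \<noteq> 0"
    using assms(1) unfolding is_eigenvalue_def by blast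
  have v1: "v1 x = (of_real \<mu> * u1 x + of_real (A x) * u2 x) / of_real \<epsilon>" for x
  proof -
    have "\<i> * (of_real \<epsilon> * v1 x) = \<i> * (of_real \<mu> * u1 x + of_real (A x) * u2 x)"
      using e1[of x] by (simp add: algebra_simps)
    then have "of_real \<epsilon> * v1 x = of_real \<mu> * u1 x + of_real (A x) * u2 x" by simp
    then show ?thesis using \<epsilon> by (simp add: field_simps)
  qed
  have v2: "v2 x = - (of_real \<mu> * u2 x + of_real (A x) * u1 x) / of_real \<epsilon>" for x
  proof -
    have "\<i> * (- of_real \<epsilon> * v2 x) = \<i> * (of_real \<mu> * u2 x + of_real (A x) * u1 x)"
      using e2[of x] by (simp add: algebra_simps)
    then have "- of_real \<epsilon> * v2 x = of_real \<mu> * u2 x + of_real (A x) * u1 x" by (subst (asm) mult_left_cancel) simp_all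
    then have "- (- of_real \<epsilon> * v2 x) = - (of_real \<mu> * u2 x + of_real (A x) * u1 x)" by (simp only:)
    then have "v2 x * of_real \<epsilon> = - (of_real \<mu> * u2 x + of_real (A x) * u1 x)" by (simp add: mult.commute)
    then show ?thesis using \<epsilon> by (subst eq_divide_eq) simp
  qed
  define p0 where "p0 = (\<lambda>x. u1 x + u2 x)"
  define q0 where "q0 = (\<lambda>x. u1 x - u2 x)"
  have dp0: "(p0 has_vector_derivative of_real ((\<mu> - A x) / \<epsilon>) * q0 x) (at x)" for x
    unfolding p0_def by (rule has_vector_derivative_eq_rhs[OF has_vector_derivative_add[OF du1 du2]])
      (use \<epsilon> in \<open>simp add: v1 v2 q0_def field_simps\<close>)
  have dq0: "(q0 has_vector_derivative of_real ((\<mu> + A x) / \<epsilon>) * p0 x) (at x)" for x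
    unfolding q0_def by (rule has_vector_derivative_eq_rhs[OF has_vector_derivative_diff[OF du1 du2]])
      (use \<epsilon> in \<open>simp add: v1 v2 p0_def field_simps\<close>)
  define F where "F = (\<lambda>x. (cmod (u1 x))\<^sup>2 + (cmod (u2 x))\<^sup>2)"
  have Fint: "F integrable_on UNIV" unfolding F_def by (rule integrable_add[OF int1 int2])
  have Fpq: "(cmod (p0 x))\<^sup>2 + (cmod (q0 x))\<^sup>2 = 2 * F x" for x
    unfolding p0_def q0_def F_def cmod_power2 by (simp add: power2_eq_square algebra_simps)
  have sysRe: "real_system \<mu> \<epsilon> (\<lambda>x. Re (p0 x)) (\<lambda>x. Re (q0 x))"
    unfolding real_system_def has_real_derivative_iff_has_vector_derivative
    using bounded_linear.has_vector_derivative[OF bounded_linear_Re dp0] bounded_linear.has_vector_derivative[OF bounded_linear_Re dq0]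
    by simp
  have sysIm: "real_system \<mu> \<epsilon> (\<lambda>x. Im (p0 x)) (\<lambda>x. Im (q0 x))"
    unfolding real_system_def has_real_derivative_iff_has_vector_derivative
    using bounded_linear.has_vector_derivative[OF bounded_linear_Im dp0] bounded_linear.has_vector_derivative[OF bounded_linear_Im dq0]
    by simp
  obtain x1 where x1: "p0 x1 \<noteq> 0 \<or> q0 x1 \<noteq> 0"
  proof -
    obtain x where "u1 x \<noteq> 0 \<or> u2 x \<noteq> 0" using nz by blast
    then have "0 < F x" unfolding F_def by (auto simp: add_pos_nonneg add_nonneg_pos)
    then have "p0 x \<noteq> 0 \<or> q0 x \<noteq> 0" using Fpq[of x] by auto
    then show ?thesis by (rule that)
  qed
  have "\<exists>p q. real_system \<mu> \<epsilon> p q \<and> (p x1 \<noteq> 0 \<or> q x1 \<noteq> 0) \<and> (\<forall>x. (p x)\<^sup>2 + (q x)\<^sup>2 \<le> 2 * F x)"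
  proof (cases "Re (p0 x1) \<noteq> 0 \<or> Re (q0 x1) \<noteq> 0")
    case True
    have "(Re (p0 x))\<^sup>2 + (Re (q0 x))\<^sup>2 \<le> 2 * F x" for x
      unfolding Fpq[symmetric] cmod_power2 by simp
    then show ?thesis using True sysRe by blast
  next
    case False
    then have "Im (p0 x1) \<noteq> 0 \<or> Im (q0 x1) \<noteq> 0" using x1 by (auto simp: complex_eq_iff)
    moreover have "(Im (p0 x))\<^sup>2 + (Im (q0 x))\<^sup>2 \<le> 2 * F x" for x
      unfolding Fpq[symmetric] cmod_power2 by simp
    ultimately show ?thesis using sysIm by blast
  qed
  then obtain p q where sys: "real_system \<mu> \<epsilon> p q" and pq1: "p x1 \<noteq> 0 \<or> q x1 \<noteq> 0" and pqF: "\<And>x. (p x)\<^sup>2 + (q x)\<^sup>2 \<le> 2 * F x"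
    by blast
  have dp: "(p has_real_derivative (\<mu> - A x) / \<epsilon> * q x) (at x)" and dq: "(q has_real_derivative (\<mu> + A x) / \<epsilon> * p x) (at x)" for x
    using sys unfolding real_system_def by auto
  have dpm: "((\<lambda>x. p (- x)) has_real_derivative - ((\<mu> - A x) / \<epsilon> * q (- x))) (at x)" for x
    using DERIV_chain2[OF dp[of "-x"] DERIV_minus[OF DERIV_ident]] by (simp add: A_even)
  have dqm: "((\<lambda>x. q (- x)) has_real_derivative - ((\<mu> + A x) / \<epsilon> * p (- x))) (at x)" for x
    using DERIV_chain2[OF dq[of "-x"] DERIV_minus[OF DERIV_ident]] by (simp add: A_even)
  have sym: "real_system \<mu> \<epsilon> (\<lambda>x. p x + s * p (- x)) (\<lambda>x. q x - s * q (- x))" for s :: real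
    unfolding real_system_def
  proof (intro allI conjI)
    show "((\<lambda>x. p x + s * p (- x)) has_real_derivative (\<mu> - A x) / \<epsilon> * (q x - s * q (- x))) (at x)" for x
      by (rule DERIV_cong[OF DERIV_add[OF dp DERIV_cmult[OF dpm]]]) (simp add: algebra_simps)
    show "((\<lambda>x. q x - s * q (- x)) has_real_derivative (\<mu> + A x) / \<epsilon> * (p x + s * p (- x))) (at x)" for x
      by (rule DERIV_cong[OF DERIV_diff[OF dq DERIV_cmult[OF dqm]]]) (simp add: algebra_simps)
  qed
  \<comment> \<open>The combinations for \<open>s = 1\<close> and \<open>s = -1\<close> add up to
    \<open>2 * p x1\<close> and \<open>2 * q x1\<close>, so at least one choice is nonzero at
    \<open>x1\<close>.\<close>
  obtain s :: real where s: "s = 1 \<or> s = -1" and snz: "p x1 + s * p (- x1) \<noteq> 0 \<or> q x1 - s * q (- x1) \<noteq> 0"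
  proof -
    have "(p x1 + 1 * p (- x1) \<noteq> 0 \<or> q x1 - 1 * q (- x1) \<noteq> 0) \<or> (p x1 + (-1) * p (- x1) \<noteq> 0 \<or> q x1 - (-1) * q (- x1) \<noteq> 0)"
      using pq1 by auto
    then show ?thesis using that by blast
  qed
  have s2: "s * s = 1" using s by auto
  show ?thesis
  proof (rule that[OF sym[of s] snz])
    fix x
    have "p (- x) + s * p (- (- x)) = s * (p x + s * p (- x))" "q (- x) - s * q (- (- x)) = - s * (q x - s * q (- x))"
      using s2 by (simp_all add: algebra_simps)
    then have "(p (- x) + s * p (- (- x))) * (q (- x) - s * q (- (- x))) = - ((s * s) * ((p x + s * p (- x)) * (q x - s * q (- x))))"
      by (simp add: mult_ac)
    then show "(p (- x) + s * p (- (- x))) * (q (- x) - s * q (- (- x))) = - ((p x + s * p (- x)) * (q x - s * q (- x)))"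
      unfolding s2 by simp
  next
    fix X :: real assume X: "0 \<le> X"
    have le: "(p x + s * p (- x))\<^sup>2 + (q x - s * q (- x))\<^sup>2 \<le> 4 * (F x + F (- x))" for x
    proof -
      have sq: "(b + t)\<^sup>2 \<le> 2 * (b\<^sup>2 + t\<^sup>2)" for b t :: real
        using sum_squares_bound[of b t] by (simp add: power2_sum)
      have "(p x + s * p (- x))\<^sup>2 \<le> 2 * ((p x)\<^sup>2 + (p (-x))\<^sup>2)"
        using sq[of "p x" "s * p (- x)"] s by auto
      moreover have "(q x - s * q (- x))\<^sup>2 \<le> 2 * ((q x)\<^sup>2 + (q (-x))\<^sup>2)"
        using sq[of "q x" "- s * q (- x)"] s by auto
      ultimately show ?thesis using pqF[of x] pqF[of "-x"] unfolding distrib_left by linarith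
    qed
    have cu: "continuous_on S u1" "continuous_on S u2" for S
      by (auto intro!: continuous_at_imp_continuous_on has_vector_derivative_continuous[OF du1] has_vector_derivative_continuous[OF du2])
    have cF: "continuous_on S F" for S unfolding F_def by (intro continuous_intros cu)
    have cFm: "continuous_on S (\<lambda>x. F (- x))" for S by (rule continuous_on_compose2[OF cF[of UNIV] continuous_on_minus[OF continuous_on_id]]) auto
    have cpq: "continuous_on S p" "continuous_on S q" for S
      by (auto intro!: continuous_at_imp_continuous_on DERIV_isCont[OF dp] DERIV_isCont[OF dq])
    have cpqm: "continuous_on S (\<lambda>x. p (- x))" "continuous_on S (\<lambda>x. q (- x))" for S
      by (auto intro!: continuous_at_imp_continuous_on DERIV_isCont[OF dpm] DERIV_isCont[OF dqm])
    have F0: "0 \<le> F x" for x by (simp add: F_def)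
    have "integral {0..X} (\<lambda>x. (p x + s * p (- x))\<^sup>2 + (q x - s * q (- x))\<^sup>2) \<le> integral {0..X} (\<lambda>x. 4 * (F x + F (- x)))"
      by (intro integral_le integrable_continuous_interval continuous_intros cF cFm cpq cpqm le)
    also have "\<dots> = 4 * (integral {0..X} F + integral {0..X} (\<lambda>x. F (- x)))"
      by (simp add: integral_add integrable_continuous_interval cF cFm)
    also have "integral {0..X} (\<lambda>x. F (- x)) = integral {-X..0} F"
      using Henstock_Kurzweil_Integration.integral_reflect_real[of 0 "- X" F] by simp
    also have "integral {0..X} F \<le> integral UNIV F"
      by (rule integral_subset_le) (auto intro: integrable_continuous_interval cF Fint F0)
    also have "integral {-X..0} F \<le> integral UNIV F"
      by (rule integral_subset_le) (auto intro: integrable_continuous_interval cF Fint F0)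
    finally show "integral {0..X} (\<lambda>x. (p x + s * p (- x))\<^sup>2 + (q x - s * q (- x))\<^sup>2) \<le> 8 * integral UNIV F" by simp
  qed
qed

lemma A_eventually_small:
  assumes "0 < e" obtains R where "0 < R" "\<And>x. R \<le> x \<Longrightarrow> A x \<le> e"
proof -
  obtain R where R: "0 < R" "\<And>z. z \<in> strip \<rho> \<Longrightarrow> R \<le> \<bar>Re z\<bar> \<Longrightarrow> norm (f z) \<le> e"
    using small_far[OF assms] by blast
  have "A x \<le> e" if "R \<le> x" for x
    using R(2)[of "of_real x"] R(1) that \<rho> A_pos[of x] by (simp add: f_real)
  with R(1) that show ?thesis by blast
qed

text \<open>For \<open>A = 0\<close> the functions \<open>P + Q\<close> and \<open>P - Q\<close>
  would be the growing and the decaying mode. Where \<open>A\<close> is small against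
  \<open>\<delta> * \<mu>\<close>, the quantity \<open>G\<close> is nondecreasing: once positive it
  keeps \<open>P + Q\<close> away from 0, which contradicts the integral bound.\<close>

lemma recessive_ratio:
  assumes sys: "real_system \<mu> \<epsilon> P Q" and pos: "0 < \<epsilon>" "0 < \<mu>"
    and int: "\<And>X. 0 \<le> X \<Longrightarrow> integral {0..X} (\<lambda>x. (P x)\<^sup>2 + (Q x)\<^sup>2) \<le> M"
    and \<delta>: "0 < \<delta>" "\<delta> \<le> 1"
  shows "eventually (\<lambda>x. \<bar>P x + Q x\<bar> \<le> \<delta> * \<bar>P x - Q x\<bar>) at_top"
proof -
  define u where "u = (\<lambda>x. P x + Q x)"
  define v where "v = (\<lambda>x. P x - Q x)"
  have dP: "(P has_real_derivative (\<mu> - A x) / \<epsilon> * Q x) (at x)" and dQ: "(Q has_real_derivative (\<mu> + A x) / \<epsilon> * P x) (at x)" for x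
    using sys unfolding real_system_def by auto
  have du: "(u has_real_derivative (\<mu> * u x + A x * v x) / \<epsilon>) (at x)" for x
    unfolding u_def by (rule DERIV_cong[OF DERIV_add[OF dP dQ]]) (use pos in \<open>simp add: v_def field_simps\<close>)
  have dv: "(v has_real_derivative - (\<mu> * v x + A x * u x) / \<epsilon>) (at x)" for x
    unfolding v_def by (rule DERIV_cong[OF DERIV_diff[OF dP dQ]]) (use pos in \<open>simp add: u_def field_simps\<close>)
  define G where "G = (\<lambda>x. (u x)\<^sup>2 - \<delta>\<^sup>2 * (v x)\<^sup>2)"
  define G' where "G' = (\<lambda>x. 2 / \<epsilon> * (\<mu> * ((u x)\<^sup>2 + \<delta>\<^sup>2 * (v x)\<^sup>2) + (1 + \<delta>\<^sup>2) * A x * (u x * v x)))"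
  have dG: "(G has_real_derivative G' x) (at x)" for x
    unfolding G_def
    by (rule derivative_eq_intros du dv refl)+ (use pos in \<open>simp add: G'_def field_simps power2_eq_square\<close>)
  \<comment> \<open>The threshold matches \<open>1 + \<delta>\<^sup>2 \<le> 2\<close> and the
    inequality between the product and the squares of \<open>\<bar>u x\<bar>\<close> and
    \<open>\<delta> * \<bar>v x\<bar>\<close>.\<close>
  obtain R where R: "0 < R" "\<And>x. R \<le> x \<Longrightarrow> A x \<le> \<delta> * \<mu> / 2"
    using A_eventually_small[of "\<delta> * \<mu> / 2"] \<delta> pos by auto
  have G'_nonneg: "0 \<le> G' x" if "R \<le> x" for x
  proof -
    have "\<bar>(1 + \<delta>\<^sup>2) * A x * (u x * v x)\<bar> = (1 + \<delta>\<^sup>2) * A x * (\<bar>u x\<bar> * \<bar>v x\<bar>)"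
      using A_pos[of x] by (simp add: abs_mult)
    also have "\<dots> \<le> 2 * (\<delta> * \<mu> / 2) * (\<bar>u x\<bar> * \<bar>v x\<bar>)"
    proof (intro mult_right_mono mult_mono)
      show "1 + \<delta>\<^sup>2 \<le> 2" using \<delta> by (simp add: power_le_one)
    qed (use R(2)[OF that] A_pos[of x] in \<open>auto simp: less_imp_le\<close>)
    also have "\<dots> = \<mu> * (\<bar>u x\<bar> * (\<delta> * \<bar>v x\<bar>))" by simp
    also have "\<bar>u x\<bar> * (\<delta> * \<bar>v x\<bar>) \<le> (u x)\<^sup>2 + \<delta>\<^sup>2 * (v x)\<^sup>2"
    proof -
      have "2 * (\<bar>u x\<bar> * (\<delta> * \<bar>v x\<bar>)) \<le> (u x)\<^sup>2 + \<delta>\<^sup>2 * (v x)\<^sup>2"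
        using sum_squares_bound[of "\<bar>u x\<bar>" "\<delta> * \<bar>v x\<bar>"] by (simp add: power_mult_distrib)
      moreover have "0 \<le> (u x)\<^sup>2 + \<delta>\<^sup>2 * (v x)\<^sup>2" by simp
      ultimately show ?thesis by linarith
    qed
    finally have "\<bar>(1 + \<delta>\<^sup>2) * A x * (u x * v x)\<bar> \<le> \<mu> * ((u x)\<^sup>2 + \<delta>\<^sup>2 * (v x)\<^sup>2)"
      using pos by (simp add: mult_left_mono)
    then have "0 \<le> \<mu> * ((u x)\<^sup>2 + \<delta>\<^sup>2 * (v x)\<^sup>2) + (1 + \<delta>\<^sup>2) * A x * (u x * v x)" by linarith
    then show ?thesis using pos by (simp add: G'_def)
  qed
  have Gle: "G x \<le> 0" if x: "R \<le> x" for x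
  proof (rule ccontr)
    assume "\<not> G x \<le> 0"
    then have Gx: "0 < G x" by simp
    have Gy: "G x \<le> G y" if "x \<le> y" for y
    proof (rule DERIV_nonneg_imp_nondecreasing[OF that])
      fix t assume "x \<le> t" "t \<le> y"
      then show "\<exists>l. (G has_real_derivative l) (at t) \<and> 0 \<le> l" using dG[of t] G'_nonneg[of t] x by auto
    qed
    have low: "G x / 2 \<le> (P y)\<^sup>2 + (Q y)\<^sup>2" if "x \<le> y" for y
    proof -
      have "G y \<le> (u y)\<^sup>2" by (simp add: G_def)
      also have "(u y)\<^sup>2 \<le> 2 * ((P y)\<^sup>2 + (Q y)\<^sup>2)"
        unfolding u_def using sum_squares_bound[of "P y" "Q y"] by (simp add: power2_sum)
      finally show ?thesis using Gy[OF that] by simp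
    qed
    have cPQ: "continuous_on S (\<lambda>x. (P x)\<^sup>2 + (Q x)\<^sup>2)" for S
      by (intro continuous_intros continuous_at_imp_continuous_on ballI DERIV_isCont[OF dP] DERIV_isCont[OF dQ])
    \<comment> \<open>The interval is so long that the constant lower bound \<open>G x / 2\<close>
      alone integrates to \<open>\<bar>M\<bar> + 1\<close>.\<close>
    define X where "X = x + 2 * (\<bar>M\<bar> + 1) / G x"
    have xX: "x \<le> X" "0 \<le> x" "0 \<le> X" using Gx R(1) x by (auto simp: X_def)
    have "(X - x) * (G x / 2) = integral {x..X} (\<lambda>y. G x / 2)" using xX by simp
    also have "\<dots> \<le> integral {x..X} (\<lambda>x. (P x)\<^sup>2 + (Q x)\<^sup>2)"
      by (intro integral_le integrable_continuous_interval cPQ continuous_intros low) auto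
    also have "\<dots> \<le> integral {0..X} (\<lambda>x. (P x)\<^sup>2 + (Q x)\<^sup>2)"
      using xX by (intro integral_subset_le integrable_continuous_interval cPQ) auto
    also have "\<dots> \<le> M" by (rule int[OF xX(3)])
    finally have "\<bar>M\<bar> + 1 \<le> M" using Gx by (simp add: X_def)
    then show False by linarith
  qed
  have "\<bar>u x\<bar> \<le> \<delta> * \<bar>v x\<bar>" if "R \<le> x" for x
  proof (rule power2_le_imp_le)
    show "\<bar>u x\<bar>\<^sup>2 \<le> (\<delta> * \<bar>v x\<bar>)\<^sup>2" using Gle[OF that] by (simp add: G_def power_mult_distrib)
  qed (use \<delta> in simp)
  then show ?thesis unfolding eventually_at_top_linorder u_def v_def by blast
qed

text \<open>The complex system is solved with the given data at 0; its restriction to the real axis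
  satisfies the same equations as \<open>P\<close> and \<open>Q\<close>, and uniqueness identifies
  them.\<close>

lemma holomorphic_extension:
  assumes sys: "real_system \<mu> \<epsilon> P Q" and pos: "0 < \<epsilon>" "0 < \<mu>"
  obtains p q where "\<And>z. z \<in> strip \<rho> \<Longrightarrow> (p has_field_derivative (of_real \<mu> - f z) / of_real \<epsilon> * q z) (at z)"
    "\<And>z. z \<in> strip \<rho> \<Longrightarrow> (q has_field_derivative (of_real \<mu> + f z) / of_real \<epsilon> * p z) (at z)"
    "\<And>x. p (of_real x) = of_real (P x)" "\<And>x. q (of_real x) = of_real (Q x)"
proof -
  have fC: "norm (f z) \<le> C" if "z \<in> strip \<rho>" for z
  proof -
    have "(1 + \<bar>Re z\<bar>) powr (-\<sigma>) \<le> 1" using \<sigma> powr_mono2'[of "-\<sigma>" 1 "1 + \<bar>Re z\<bar>"] by simp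
    then have "C * (1 + \<bar>Re z\<bar>) powr (-\<sigma>) \<le> C" using C_pos by (simp add: mult_left_le)
    then show ?thesis using f_le[OF that] by linarith
  qed
  obtain p q where p: "\<And>z. z \<in> strip \<rho> \<Longrightarrow> (p has_field_derivative (of_real \<mu> - f z) / of_real \<epsilon> * q z) (at z)"
    and q: "\<And>z. z \<in> strip \<rho> \<Longrightarrow> (q has_field_derivative (of_real \<mu> + f z) / of_real \<epsilon> * p z) (at z)"
    and pq0: "p 0 = of_real (P 0)" "q 0 = of_real (Q 0)"
  proof (rule holomorphic_linear_system[where S = "strip \<rho>" and K = "(\<mu> + C) / \<epsilon>" and ?p0.0 = "of_real (P 0)" and ?q0.0 = "of_real (Q 0)"
        and ?a1.0 = "\<lambda>z. (of_real \<mu> - f z) / of_real \<epsilon>" and ?a2.0 = "\<lambda>z. (of_real \<mu> + f z) / of_real \<epsilon>"])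
    show "(\<lambda>z. (of_real \<mu> - f z) / of_real \<epsilon>) holomorphic_on strip \<rho>" "(\<lambda>z. (of_real \<mu> + f z) / of_real \<epsilon>) holomorphic_on strip \<rho>"
      using pos by (auto intro!: holomorphic_intros hol)
    fix z assume z: "z \<in> strip \<rho>"
    have "norm (of_real \<mu> - f z) \<le> \<mu> + C" using norm_triangle_ineq4[of "of_real \<mu>" "f z"] fC[OF z] pos by simp
    then show "norm ((of_real \<mu> - f z) / of_real \<epsilon>) \<le> (\<mu> + C) / \<epsilon>" using pos by (simp add: norm_divide divide_right_mono)
    have "norm (of_real \<mu> + f z) \<le> \<mu> + C" using norm_triangle_ineq[of "of_real \<mu>" "f z"] fC[OF z] pos by simp
    then show "norm ((of_real \<mu> + f z) / of_real \<epsilon>) \<le> (\<mu> + C) / \<epsilon>" using pos by (simp add: norm_divide divide_right_mono)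
  qed (use \<rho> in auto)
  have of_real_chain: "((\<lambda>x. g (of_real x)) has_vector_derivative g') (at x)" if "(g has_field_derivative g') (at (of_real x))" for g :: "complex \<Rightarrow> complex" and g' and x :: real
    using horizontal_chain[of g g' x 0 UNIV UNIV] that by (simp add: complex_of_real_def)
  have eq: "p (of_real x) - of_real (P x) = 0 \<and> q (of_real x) - of_real (Q x) = 0" for x
  proof (rule zero_solution_unique[where c = "\<mu> / \<epsilon>" and B = "\<lambda>x. A x / \<epsilon>" and ?x0.0 = 0 and x = x
        and p = "\<lambda>x. p (of_real x) - of_real (P x)" and q = "\<lambda>x. q (of_real x) - of_real (Q x)"])
    fix y
    have P: "((\<lambda>x. complex_of_real (P x)) has_vector_derivative of_real ((\<mu> - A y) / \<epsilon> * Q y)) (at y)"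
      and Q: "((\<lambda>x. complex_of_real (Q x)) has_vector_derivative of_real ((\<mu> + A y) / \<epsilon> * P y)) (at y)"
      using has_vector_derivative_complex_of_real sys unfolding real_system_def by blast+
    have y: "of_real y \<in> strip \<rho>" using \<rho> by simp
    show "((\<lambda>x. p (of_real x) - of_real (P x)) has_vector_derivative of_real (\<mu> / \<epsilon> - A y / \<epsilon>) * (q (of_real y) - of_real (Q y))) (at y)"
      by (rule has_vector_derivative_eq_rhs[OF has_vector_derivative_diff[OF of_real_chain[OF p[OF y]] P]])
        (simp add: f_real right_diff_distrib diff_divide_distrib)
    show "((\<lambda>x. q (of_real x) - of_real (Q x)) has_vector_derivative of_real (\<mu> / \<epsilon> + A y / \<epsilon>) * (p (of_real y) - of_real (P y))) (at y)"
      by (rule has_vector_derivative_eq_rhs[OF has_vector_derivative_diff[OF of_real_chain[OF q[OF y]] Q]])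
        (simp add: f_real right_diff_distrib add_divide_distrib)
  qed (use pq0 pos in auto)
  show ?thesis using that[OF p q] eq by simp
qed

end

section \<open>The phase and the action\<close>

context analytic_well begin

lemma Im_kap_real:
  "0 < \<mu> \<Longrightarrow> Im (kap \<mu> (of_real x)) = (if A x \<le> \<mu> then 0 else sqrt ((A x)\<^sup>2 - \<mu>\<^sup>2))"
proof -
  assume \<mu>: "0 < \<mu>"
  have "symb \<mu> (of_real x) = of_real (\<mu>\<^sup>2 - (A x)\<^sup>2)" by (simp add: symb_def f_real)
  moreover have "0 \<le> \<mu>\<^sup>2 - (A x)\<^sup>2 \<longleftrightarrow> A x \<le> \<mu>"
    using power2_le_iff_abs_le[of \<mu> "A x"] \<mu> A_pos[of x] by simp
  ultimately show ?thesis unfolding kap_def by (simp only: rt_of_real) simp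
qed

lemma turning_point:
  assumes \<mu>: "0 < \<mu>" "\<mu> < A 0"
  shows "0 < xstar A \<mu>" "A (xstar A \<mu>) = \<mu>"
proof -
  obtain R where R: "0 < R" "\<And>x. R \<le> x \<Longrightarrow> A x \<le> \<mu>" using A_eventually_small[OF \<mu>(1)] by blast
  obtain x where x: "0 \<le> x" "x \<le> R" "A x = \<mu>"
    using IVT2'[of A R \<mu> 0] R \<mu> A_cont by (auto simp: less_imp_le)
  have x0: "0 < x" using x \<mu> by (cases "x = 0") auto
  have "\<exists>!x. 0 < x \<and> A x = \<mu>"
  proof (rule ex1I[of _ x])
    fix y assume y: "0 < y \<and> A y = \<mu>"
    then show "y = x" using A_strict[of x y] A_strict[of y x] x x0 by (metis less_irrefl linorder_neqE less_imp_le)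
  qed (use x x0 in auto)
  from theI'[OF this] show "0 < xstar A \<mu>" "A (xstar A \<mu>) = \<mu>" unfolding xstar_def by auto
qed

text \<open>Beyond the turning point \<open>kap\<close> is real and the integral stays constant; by
  evenness of \<open>A\<close> the half interval carries half the action. For
  \<open>\<mu> = A 0\<close> there is no positive turning point, and the integrand vanishes
  everywhere, in accordance with the value 0 of \<open>action\<close>.\<close>

lemma action_eventually:
  assumes \<mu>: "0 < \<mu>" "\<mu> \<le> A 0"
  shows "\<exists>X0. \<forall>X\<ge>X0. integral {0..X} (\<lambda>x. Im (kap \<mu> (of_real x))) = action A \<mu> / 2"
proof (cases "\<mu> = A 0")
  case True
  have "Im (kap \<mu> (of_real x)) = 0" for x
    using Im_kap_real[OF \<mu>(1), of x] A_le_A0[of x] True by simp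
  then show ?thesis using True by (simp add: action_def)
next
  case False
  define b where "b = xstar A \<mu>"
  have b: "0 < b" "A b = \<mu>" using turning_point[of \<mu>] \<mu> False by (auto simp: b_def)
  define h where "h = (\<lambda>x. sqrt ((A x)\<^sup>2 - \<mu>\<^sup>2))"
  define k where "k = (\<lambda>x. Im (kap \<mu> (of_real x)))"
  have k1: "k x = h x" if "0 \<le> x" "x \<le> b" for x
    using A_strict[of x b] that b Im_kap_real[OF \<mu>(1), of x] by (cases "x = b") (auto simp: k_def h_def)
  have k2: "k x = 0" if "b \<le> x" for x
    using A_strict[of b x] that b Im_kap_real[OF \<mu>(1), of x] by (cases "x = b") (auto simp: k_def)
  have cont: "continuous_on S h" for S unfolding h_def by (intro continuous_intros A_cont)
  have hint: "h integrable_on {c..e}" for c e by (intro integrable_continuous_interval cont)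
  have "integral {0..X} k = action A \<mu> / 2" if X: "b \<le> X" for X
  proof -
    have 1: "(k has_integral integral {0..b} h) {0..b}"
      by (rule has_integral_eq[OF _ integrable_integral[OF hint]]) (use k1 in auto)
    have 2: "(k has_integral 0) {b..X}"
      by (rule has_integral_is_0) (use k2 in auto)
    have "(k has_integral integral {0..b} h + 0) {0..X}"
      by (rule has_integral_combine[OF _ X 1 2]) (use b in simp)
    then have "integral {0..X} k = integral {0..b} h" by (simp add: integral_unique)
    moreover have "integral {-b..b} h = 2 * integral {0..b} h"
    proof -
      have "integral {-b..b} h = integral {-b..0} h + integral {0..b} h"
        by (rule Henstock_Kurzweil_Integration.integral_combine[symmetric]) (use b hint in auto)
      moreover have "integral {-b..0} h = integral {0..b} h"
        using Henstock_Kurzweil_Integration.integral_reflect_real[of b 0 h] by (simp add: h_def A_even)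
      ultimately show ?thesis by simp
    qed
    ultimately show ?thesis using False by (simp add: action_def b_def h_def)
  qed
  then show ?thesis unfolding k_def by blast
qed

end

context wkb_line begin

lemma halfstrip_strip: "z \<in> halfstrip \<Longrightarrow> z \<in> strip \<rho>"
  using \<eta> by (auto simp: halfstrip_def)

lemma convex_halfstrip: "convex halfstrip"
proof -
  have "halfstrip = {z. 0 \<le> Re z} \<inter> ({z. 0 \<le> Im z} \<inter> {z. Im z \<le> \<eta>})" by (auto simp: halfstrip_def)
  then show ?thesis by (simp add: convex_Int convex_halfspace_Re_ge convex_halfspace_Im_ge convex_halfspace_Im_le)
qed

lemma interior_halfstrip: "z \<in> interior halfstrip \<Longrightarrow> 0 < Re z \<and> 0 < Im z \<and> Im z \<le> \<eta>"
proof -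
  assume "z \<in> interior halfstrip"
  then obtain e where e: "0 < e" "cball z e \<subseteq> halfstrip" using mem_interior_cball by blast
  have "z - of_real e \<in> cball z e" "z - \<i> * of_real e \<in> cball z e" "z \<in> cball z e" using e(1) by (auto simp: dist_norm norm_mult)
  then have "z - of_real e \<in> halfstrip" "z - \<i> * of_real e \<in> halfstrip" "z \<in> halfstrip" using e(2) by blast+
  then show ?thesis using e(1) by (auto simp: halfstrip_def)
qed

lemma Complex_in_halfstrip: "0 \<le> X \<Longrightarrow> 0 \<le> y \<Longrightarrow> y \<le> \<eta> \<Longrightarrow> Complex X y \<in> halfstrip"
  by (simp add: halfstrip_def)

lemma f_vertical_small:
  assumes "0 < e"
  shows "eventually (\<lambda>X. 0 < X \<and> (\<forall>y. 0 \<le> y \<longrightarrow> y \<le> \<eta> \<longrightarrow> norm (f (Complex X y)) \<le> e)) at_top"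
proof -
  obtain R where R: "0 < R" "\<And>z. z \<in> strip \<rho> \<Longrightarrow> R \<le> \<bar>Re z\<bar> \<Longrightarrow> norm (f z) \<le> e"
    using small_far[OF assms] by blast
  show ?thesis
    unfolding eventually_at_top_linorder
  proof (intro exI[of _ R] allI impI conjI)
    fix X y assume "R \<le> X" "0 \<le> y" "y \<le> \<eta>"
    then show "norm (f (Complex X y)) \<le> e" using R \<eta> by (intro R(2)) auto
  qed (use R(1) in auto)
qed

context
  fixes \<mu> :: real
  assumes \<mu>: "a \<le> \<mu>" "\<mu> \<le> A 0"
begin

lemma mu_pos: "0 < \<mu>" using \<mu> a by linarith

lemma continuous_on_kap: "continuous_on halfstrip (kap \<mu>)"
  unfolding kap_def[abs_def]
proof (rule continuous_on_compose2[OF continuous_on_rt])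
  have "continuous_on halfstrip f"
    by (rule continuous_on_subset[OF holomorphic_on_imp_continuous_on[OF hol]]) (use halfstrip_strip in blast)
  then show "continuous_on halfstrip (symb \<mu>)" unfolding symb_def[abs_def] by (intro continuous_intros)
  show "symb \<mu> ` halfstrip \<subseteq> rt_dom" using symb_dom \<mu> unfolding halfstrip_def by blast
qed

text \<open>Turning points may lie on the real edge, where \<open>kap\<close> is continuous but not
  holomorphic. Cauchy's theorem for functions continuous on a convex set and holomorphic in its
  interior still gives a primitive up to the edges.\<close>

lemma kap_primitive:
  obtains \<Phi> where "\<And>z. z \<in> halfstrip \<Longrightarrow> (\<Phi> has_field_derivative kap \<mu> z) (at z within halfstrip)"
proof (rule holomorphic_convex_primitive[OF convex_halfstrip finite.emptyI continuous_on_kap])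
  fix z assume "z \<in> interior halfstrip - {}"
  then have z: "0 < Re z" "0 < Im z" "Im z \<le> \<eta>" using interior_halfstrip by auto
  then have "z \<in> strip \<rho>" using \<eta> by simp
  from DERIV_kap[OF this symb_dom symb_nz] z \<mu>
  show "kap \<mu> field_differentiable at z" unfolding field_differentiable_def by (metis less_imp_le)
qed blast

text \<open>The product of \<open>kap - \<mu>\<close> and \<open>kap + \<mu>\<close> is
  \<open>- (f z)\<^sup>2\<close>, and the second factor has norm at least \<mu> because
  \<open>Re kap\<close> is nonnegative.\<close>

lemma kap_near_mu: "z \<in> halfstrip \<Longrightarrow> norm (kap \<mu> z - of_real \<mu>) \<le> (norm (f z))\<^sup>2 / \<mu>"
proof -
  assume z: "z \<in> halfstrip"
  have "0 \<le> Re (kap \<mu> z)" unfolding kap_def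
    by (rule Re_rt_nonneg) (use symb_dom[of z \<mu>] z \<mu> in \<open>simp add: halfstrip_def\<close>)
  then have "\<mu> \<le> norm (kap \<mu> z + of_real \<mu>)" using complex_Re_le_cmod[of "kap \<mu> z + of_real \<mu>"] by simp
  then have "norm (kap \<mu> z - of_real \<mu>) * \<mu> \<le> norm (kap \<mu> z - of_real \<mu>) * norm (kap \<mu> z + of_real \<mu>)"
    by (intro mult_left_mono) auto
  also have "\<dots> = norm ((kap \<mu> z)\<^sup>2 - (of_real \<mu>)\<^sup>2)"
    by (simp add: norm_mult[symmetric] power2_eq_square algebra_simps)
  also have "\<dots> = (norm (f z))\<^sup>2" by (simp add: kap_power2 symb_def norm_power)
  finally show ?thesis using mu_pos by (simp add: field_simps)
qed

text \<open>The primitive is followed along the other three edges of a rectangle. On the left edge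
  \<open>f\<close> is real and at least \<mu>, so \<open>kap\<close> is imaginary and only the real
  part of \<open>\<Phi>\<close> moves; the bottom edge gives half the action; on the far right edge
  \<open>kap\<close> is nearly \<mu>, and going up contributes
  \<open>\<mu> * \<eta>\<close>.\<close>

lemma phase_tendsto:
  assumes \<Phi>: "\<And>z. z \<in> halfstrip \<Longrightarrow> (\<Phi> has_field_derivative kap \<mu> z) (at z within halfstrip)"
  shows "((\<lambda>X. Im (\<Phi> (Complex X \<eta>) - \<Phi> (Complex 0 \<eta>))) \<longlongrightarrow> action A \<mu> / 2 + \<mu> * \<eta>) at_top"
proof -
  have vert: "((\<lambda>y. \<Phi> (Complex X y)) has_vector_derivative \<i> * kap \<mu> (Complex X y)) (at y within {0..\<eta>})"
    if "0 \<le> X" "0 \<le> y" "y \<le> \<eta>" for X y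
    by (rule vertical_chain[OF \<Phi>]) (use that in \<open>auto simp: halfstrip_def\<close>)
  have left: "Im (\<Phi> (Complex 0 \<eta>)) = Im (\<Phi> (Complex 0 0))"
  proof -
    have "((\<lambda>y. Im (\<i> * kap \<mu> (Complex 0 y))) has_integral Im (\<Phi> (Complex 0 \<eta>)) - Im (\<Phi> (Complex 0 0))) {0..\<eta>}"
      by (rule fundamental_theorem_of_calculus) (use \<eta> bounded_linear.has_vector_derivative[OF bounded_linear_Im vert[of 0]] in auto)
    moreover have "((\<lambda>y. Im (\<i> * kap \<mu> (Complex 0 y))) has_integral 0) {0..\<eta>}"
    proof (rule has_integral_is_0)
      fix y assume y: "y \<in> {0..\<eta>}"
      define r where "r = Re (f (Complex 0 y))"
      have fr: "f (Complex 0 y) = of_real r" using f_imaginary_axis[of y] y \<eta> by (simp add: complex_eq_iff r_def)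
      have "\<mu>\<^sup>2 - r\<^sup>2 \<le> 0" using axis[of y] y \<mu> mu_pos by (auto simp: r_def intro!: power_mono)
      moreover have "symb \<mu> (Complex 0 y) = of_real (\<mu>\<^sup>2 - r\<^sup>2)" by (simp add: symb_def fr)
      ultimately show "Im (\<i> * kap \<mu> (Complex 0 y)) = 0" unfolding kap_def by (simp only: rt_of_real) auto
    qed
    ultimately have "Im (\<Phi> (Complex 0 \<eta>)) - Im (\<Phi> (Complex 0 0)) = 0" by (rule has_integral_unique)
    then show ?thesis by simp
  qed
  obtain X0 where X0: "\<And>X. X0 \<le> X \<Longrightarrow> integral {0..X} (\<lambda>x. Im (kap \<mu> (of_real x))) = action A \<mu> / 2"
    using action_eventually[OF mu_pos \<mu>(2)] by blast
  have bottom: "Im (\<Phi> (Complex X 0)) - Im (\<Phi> (Complex 0 0)) = action A \<mu> / 2" if X: "0 \<le> X" "X0 \<le> X" for X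
  proof -
    have "((\<lambda>x. \<Phi> (Complex x 0)) has_vector_derivative kap \<mu> (Complex x 0)) (at x within {0..X})" if "x \<in> {0..X}" for x
      by (rule horizontal_chain[OF \<Phi>]) (use that \<eta> in \<open>auto simp: halfstrip_def\<close>)
    then have "((\<lambda>x. Im (kap \<mu> (Complex x 0))) has_integral Im (\<Phi> (Complex X 0)) - Im (\<Phi> (Complex 0 0))) {0..X}"
      by (intro fundamental_theorem_of_calculus X bounded_linear.has_vector_derivative[OF bounded_linear_Im])
    then show ?thesis using X0[OF X(2)] by (simp add: integral_unique complex_of_real_def)
  qed
  have right: "((\<lambda>X. Im (\<Phi> (Complex X \<eta>)) - Im (\<Phi> (Complex X 0))) \<longlongrightarrow> \<mu> * \<eta>) at_top"
  proof (rule tendstoI)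
    fix e :: real assume e: "0 < e"
    \<comment> \<open>With \<open>norm f \<le> s\<close> the estimate \<open>kap_near_mu\<close>,
      integrated over the height \<eta>, gives at most \<open>e / 2\<close>.\<close>
    define s where "s = sqrt (e * \<mu> / (2 * \<eta>))"
    have s: "0 < s" "s\<^sup>2 / \<mu> * \<eta> = e / 2" using e mu_pos \<eta> by (simp_all add: s_def)
    show "eventually (\<lambda>X. dist (Im (\<Phi> (Complex X \<eta>)) - Im (\<Phi> (Complex X 0))) (\<mu> * \<eta>) < e) at_top"
      using f_vertical_small[OF s(1)]
    proof eventually_elim
      case (elim X)
      define g where "g = (\<lambda>y. \<Phi> (Complex X y) - \<i> * of_real \<mu> * of_real y)"
      have g: "(g has_vector_derivative \<i> * (kap \<mu> (Complex X y) - of_real \<mu>)) (at y within {0..\<eta>})" if "0 \<le> y" "y \<le> \<eta>" for y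
      proof -
        have "((\<lambda>y. \<i> * of_real \<mu> * of_real y) has_vector_derivative \<i> * of_real \<mu> * 1) (at y within {0..\<eta>})"
          by (intro has_vector_derivative_mult_right) (auto simp: has_vector_derivative_def scaleR_conv_of_real intro!: derivative_eq_intros)
        from has_vector_derivative_diff[OF vert[of X y] this] show ?thesis
          using elim that by (simp add: g_def right_diff_distrib)
      qed
      have "norm (g \<eta> - g 0) \<le> s\<^sup>2 / \<mu> * \<eta> - s\<^sup>2 / \<mu> * 0"
      proof (rule differentiable_bound_general[OF \<eta>(1)])
        show "continuous_on {0..\<eta>} g"
          by (auto simp: continuous_on_eq_continuous_within intro!: has_vector_derivative_continuous g)
        fix y assume y: "0 < y" "y < \<eta>"
        show "(g has_vector_derivative \<i> * (kap \<mu> (Complex X y) - of_real \<mu>)) (at y)"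
          using g[of y] y at_within_interior[of y "{0..\<eta>}"] by simp
        show "((\<lambda>y. s\<^sup>2 / \<mu> * y) has_vector_derivative s\<^sup>2 / \<mu>) (at y)"
          unfolding has_real_derivative_iff_has_vector_derivative[symmetric] by (auto intro!: derivative_eq_intros)
        have "norm (f (Complex X y)) \<le> s" using elim y by simp
        then have "(norm (f (Complex X y)))\<^sup>2 \<le> s\<^sup>2" by (intro power_mono) auto
        then have "norm (kap \<mu> (Complex X y) - of_real \<mu>) \<le> s\<^sup>2 / \<mu>"
          using kap_near_mu[OF Complex_in_halfstrip[of X y]] elim y mu_pos
          by (intro order_trans[OF kap_near_mu[OF Complex_in_halfstrip[of X y]]]) (auto intro!: divide_right_mono)
        then show "norm (\<i> * (kap \<mu> (Complex X y) - of_real \<mu>)) \<le> s\<^sup>2 / \<mu>" by (simp add: norm_mult)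
      qed (intro continuous_intros)
      then have "norm (g \<eta> - g 0) \<le> e / 2" unfolding s(2) by simp
      then have "\<bar>Im (g \<eta> - g 0)\<bar> \<le> e / 2" using abs_Im_le_cmod order_trans by blast
      then have "\<bar>Im (\<Phi> (Complex X \<eta>)) - Im (\<Phi> (Complex X 0)) - \<mu> * \<eta>\<bar> \<le> e / 2" by (simp add: g_def algebra_simps)
      then show ?case using e by (simp add: dist_real_def)
    qed
  qed
  have "((\<lambda>X. action A \<mu> / 2 + (Im (\<Phi> (Complex X \<eta>)) - Im (\<Phi> (Complex X 0)))) \<longlongrightarrow> action A \<mu> / 2 + \<mu> * \<eta>) at_top"
    by (intro tendsto_intros right)
  moreover have "eventually (\<lambda>X. action A \<mu> / 2 + (Im (\<Phi> (Complex X \<eta>)) - Im (\<Phi> (Complex X 0))) = Im (\<Phi> (Complex X \<eta>) - \<Phi> (Complex 0 \<eta>))) at_top"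
    using eventually_ge_at_top[of "max 0 X0"]
  proof eventually_elim
    case (elim X)
    then show ?case using bottom[of X] left by simp
  qed
  ultimately show ?thesis by (rule Lim_transform_eventually)
qed

end

end

section \<open>From the real axis to the line\<close>

text \<open>The energy of the pair grows at most at the rate \<open>2 * s\<close>; inserting the
  resulting bound into the derivatives gives a displacement with the extra factor
  \<open>s * \<eta>\<close>, small when the coupling is.\<close>

lemma coupled_growth:
  fixes v1 v2 w1 w2 :: "real \<Rightarrow> complex"
  assumes \<eta>: "0 < \<eta>" and s: "0 \<le> s"
    and v1: "\<And>y. 0 \<le> y \<Longrightarrow> y \<le> \<eta> \<Longrightarrow> (v1 has_vector_derivative w1 y) (at y)"
    and v2: "\<And>y. 0 \<le> y \<Longrightarrow> y \<le> \<eta> \<Longrightarrow> (v2 has_vector_derivative w2 y) (at y)"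
    and w1: "\<And>y. 0 \<le> y \<Longrightarrow> y \<le> \<eta> \<Longrightarrow> norm (w1 y) \<le> s * norm (v2 y)"
    and w2: "\<And>y. 0 \<le> y \<Longrightarrow> y \<le> \<eta> \<Longrightarrow> norm (w2 y) \<le> s * norm (v1 y)"
  shows "norm (v1 \<eta> - v1 0) \<le> s * \<eta> * exp (s * \<eta>) * (norm (v1 0) + norm (v2 0))"
    and "norm (v2 \<eta> - v2 0) \<le> s * \<eta> * exp (s * \<eta>) * (norm (v1 0) + norm (v2 0))"
proof -
  define N where "N = exp (s * \<eta>) * (norm (v1 0) + norm (v2 0))"
  define E where "E = (\<lambda>y. (norm (v1 y))\<^sup>2 + (norm (v2 y))\<^sup>2)"
  have c1: "continuous_on {0..y} v1" and c2: "continuous_on {0..y} v2" if "y \<le> \<eta>" for y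
    using that by (auto intro!: continuous_at_imp_continuous_on has_vector_derivative_continuous[OF v1] has_vector_derivative_continuous[OF v2])
  have N: "norm (v1 y) \<le> N \<and> norm (v2 y) \<le> N" if y: "0 \<le> y" "y \<le> \<eta>" for y
  proof -
    have "E y \<le> E 0 * exp (2 * s * y - 2 * s * 0)"
    proof (rule gronwall_forward[OF y(1), where E' = "\<lambda>y. 2 * (v1 y \<bullet> w1 y) + 2 * (v2 y \<bullet> w2 y)"])
      show "continuous_on {0..y} E" unfolding E_def by (intro continuous_intros c1 c2 y)
      show "continuous_on {0..y} (\<lambda>x. 2 * s * x)" by (intro continuous_intros)
      fix x assume "0 < x" "x < y"
      then have x: "0 \<le> x" "x \<le> \<eta>" using y by auto
      show "(E has_real_derivative 2 * (v1 x \<bullet> w1 x) + 2 * (v2 x \<bullet> w2 x)) (at x)"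
        unfolding E_def by (intro DERIV_add has_real_derivative_norm_power2 v1 v2 x)
      show "((\<lambda>x. 2 * s * x) has_real_derivative 2 * s) (at x)" by (auto intro!: derivative_eq_intros)
      have "v1 x \<bullet> w1 x \<le> norm (v1 x) * (s * norm (v2 x))"
        by (intro order_trans[OF norm_cauchy_schwarz] mult_left_mono w1 x) auto
      moreover have "v2 x \<bullet> w2 x \<le> norm (v2 x) * (s * norm (v1 x))"
        by (intro order_trans[OF norm_cauchy_schwarz] mult_left_mono w2 x) auto
      moreover have "s * (2 * norm (v1 x) * norm (v2 x)) \<le> s * E x"
        unfolding E_def by (intro mult_left_mono sum_squares_bound s)
      ultimately show "2 * (v1 x \<bullet> w1 x) + 2 * (v2 x \<bullet> w2 x) \<le> 2 * s * E x"
        by (simp add: algebra_simps)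
    qed
    also have "\<dots> \<le> E 0 * (exp (s * \<eta>))\<^sup>2"
    proof -
      have "exp (2 * s * y - 2 * s * 0) \<le> (exp (s * \<eta>))\<^sup>2"
        unfolding power2_eq_square exp_add[symmetric] using y s mult_left_mono[of y \<eta> s] by (simp add: mult.commute)
      then show ?thesis by (intro mult_left_mono) (simp_all add: E_def)
    qed
    also have "\<dots> \<le> (norm (v1 0) + norm (v2 0))\<^sup>2 * (exp (s * \<eta>))\<^sup>2"
      unfolding E_def by (intro mult_right_mono) (simp_all add: power2_sum)
    also have "\<dots> = N\<^sup>2" by (simp add: N_def power_mult_distrib)
    finally have "E y \<le> N\<^sup>2" .
    then have "(norm (v1 y))\<^sup>2 \<le> N\<^sup>2" "(norm (v2 y))\<^sup>2 \<le> N\<^sup>2" unfolding E_def by (smt (verit) zero_le_power2)+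
    moreover have "0 \<le> N" by (simp add: N_def)
    ultimately show ?thesis using power2_le_imp_le by blast
  qed
  have lin: "((\<lambda>y. s * N * y) has_vector_derivative s * N) (at y)" for y
    unfolding has_real_derivative_iff_has_vector_derivative[symmetric] by (auto intro!: derivative_eq_intros)
  have "norm (v1 \<eta> - v1 0) \<le> s * N * \<eta> - s * N * 0"
  proof (rule differentiable_bound_general[OF \<eta> c1[OF order_refl] _ v1 lin])
    fix y assume y: "0 < y" "y < \<eta>"
    then show "norm (w1 y) \<le> s * N" using w1[of y] N[of y] s mult_left_mono[of "norm (v2 y)" N s] by auto
  qed (auto intro: continuous_intros)
  then show "norm (v1 \<eta> - v1 0) \<le> s * \<eta> * exp (s * \<eta>) * (norm (v1 0) + norm (v2 0))"
    by (simp add: N_def mult_ac)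
  have "norm (v2 \<eta> - v2 0) \<le> s * N * \<eta> - s * N * 0"
  proof (rule differentiable_bound_general[OF \<eta> c2[OF order_refl] _ v2 lin])
    fix y assume y: "0 < y" "y < \<eta>"
    then show "norm (w2 y) \<le> s * N" using w2[of y] N[of y] s mult_left_mono[of "norm (v1 y)" N s] by auto
  qed (auto intro: continuous_intros)
  then show "norm (v2 \<eta> - v2 0) \<le> s * \<eta> * exp (s * \<eta>) * (norm (v1 0) + norm (v2 0))"
    by (simp add: N_def mult_ac)
qed

context wkb_line begin

context
  fixes \<mu> \<epsilon> :: real and P Q :: "real \<Rightarrow> real" and p q :: "complex \<Rightarrow> complex"
  assumes \<mu>: "a \<le> \<mu>" "\<mu> \<le> A 0" and \<epsilon>: "0 < \<epsilon>"
    and p: "\<And>z. z \<in> strip \<rho> \<Longrightarrow> (p has_field_derivative (of_real \<mu> - f z) / of_real \<epsilon> * q z) (at z)"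
    and q: "\<And>z. z \<in> strip \<rho> \<Longrightarrow> (q has_field_derivative (of_real \<mu> + f z) / of_real \<epsilon> * p z) (at z)"
begin

text \<open>For \<open>f = 0\<close> the components \<open>U\<close> and \<open>V\<close> would
  merely rotate, with opposite phases. Removing these phases leaves a purely off-diagonal system
  with coefficients of size \<open>norm f / \<epsilon>\<close>, to which
  \<open>coupled_growth\<close> applies.\<close>

lemma vertical_transport:
  assumes s: "\<And>y. 0 \<le> y \<Longrightarrow> y \<le> \<eta> \<Longrightarrow> norm (f (Complex X y)) \<le> s"
  defines "U \<equiv> \<lambda>y. p (Complex X y) + q (Complex X y)" and "V \<equiv> \<lambda>y. p (Complex X y) - q (Complex X y)"
  defines "\<theta> \<equiv> exp (- \<i> * of_real (\<mu> * \<eta> / \<epsilon>))" and "t \<equiv> s / \<epsilon> * \<eta>"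
  shows "norm (U \<eta> * \<theta> - U 0) \<le> t * exp t * (norm (U 0) + norm (V 0))"
    and "norm (V \<eta> - V 0 * \<theta>) \<le> t * exp t * (norm (U 0) + norm (V 0))"
proof -
  \<comment> \<open>\<open>e (-1)\<close> undoes the rotation of \<open>U\<close>, and
    \<open>e 1\<close> that of \<open>V\<close>.\<close>
  define e where "e = (\<lambda>c y. exp (\<i> * of_real (c * (\<mu> * y / \<epsilon>))))"
  have ne: "norm (e c y) = 1" for c y unfolding e_def by (rule norm_exp_i_times)
  have de: "(e c has_vector_derivative \<i> * of_real (c * \<mu> / \<epsilon>) * e c y) (at y)" for c y
  proof -
    have "((\<lambda>y. complex_of_real (c * (\<mu> * y / \<epsilon>))) has_vector_derivative of_real (c * \<mu> / \<epsilon>)) (at y)"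
      by (rule has_vector_derivative_complex_of_real) (use \<epsilon> in \<open>auto intro!: derivative_eq_intros\<close>)
    from field_vector_diff_chain_at[OF has_vector_derivative_mult_right[OF this, of \<i>] DERIV_exp]
    show ?thesis by (simp add: o_def e_def)
  qed
  have z: "Complex X y \<in> strip \<rho>" if "0 \<le> y" "y \<le> \<eta>" for y using that \<eta> by simp
  have dU: "(U has_vector_derivative \<i> * ((of_real \<mu> * U y + f (Complex X y) * V y) / of_real \<epsilon>)) (at y)" if "0 \<le> y" "y \<le> \<eta>" for y
    unfolding U_def
    by (rule has_vector_derivative_eq_rhs[OF vertical_chain[OF DERIV_add[OF p[OF z[OF that]] q[OF z[OF that]]], of UNIV]])
      (use \<epsilon> in \<open>simp_all add: V_def field_simps\<close>)
  have dV: "(V has_vector_derivative \<i> * ((- of_real \<mu> * V y - f (Complex X y) * U y) / of_real \<epsilon>)) (at y)" if "0 \<le> y" "y \<le> \<eta>" for y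
    unfolding V_def
    by (rule has_vector_derivative_eq_rhs[OF vertical_chain[OF DERIV_diff[OF p[OF z[OF that]] q[OF z[OF that]]], of UNIV]])
      (use \<epsilon> in \<open>simp_all add: U_def field_simps\<close>)
  define v1 where "v1 = (\<lambda>y. U y * e (-1) y)"
  define v2 where "v2 = (\<lambda>y. V y * e 1 y)"
  have d1: "(v1 has_vector_derivative \<i> * (f (Complex X y) / of_real \<epsilon>) * (V y * e (-1) y)) (at y)" if "0 \<le> y" "y \<le> \<eta>" for y
    unfolding v1_def
    by (rule has_vector_derivative_eq_rhs[OF has_vector_derivative_mult[OF dU[OF that] de]])
      (use \<epsilon> in \<open>simp add: field_simps\<close>)
  have d2: "(v2 has_vector_derivative - \<i> * (f (Complex X y) / of_real \<epsilon>) * (U y * e 1 y)) (at y)" if "0 \<le> y" "y \<le> \<eta>" for y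
    unfolding v2_def
    by (rule has_vector_derivative_eq_rhs[OF has_vector_derivative_mult[OF dV[OF that] de]])
      (use \<epsilon> in \<open>simp add: field_simps\<close>)
  have sf: "norm (f (Complex X y)) / \<epsilon> \<le> s / \<epsilon>" if "0 \<le> y" "y \<le> \<eta>" for y
    using s[OF that] \<epsilon> by (simp add: divide_right_mono)
  have s0: "0 \<le> s / \<epsilon>" using sf[of 0] \<epsilon> \<eta> norm_ge_zero[of "f (Complex X 0)"] by (smt (verit) divide_nonneg_pos)
  have b1: "norm (\<i> * (f (Complex X y) / of_real \<epsilon>) * (V y * e (-1) y)) \<le> s / \<epsilon> * norm (v2 y)" if "0 \<le> y" "y \<le> \<eta>" for y
    using mult_right_mono[OF sf[OF that], of "norm (V y)"] \<epsilon> by (simp add: v2_def norm_mult norm_divide ne)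
  have b2: "norm (- \<i> * (f (Complex X y) / of_real \<epsilon>) * (U y * e 1 y)) \<le> s / \<epsilon> * norm (v1 y)" if "0 \<le> y" "y \<le> \<eta>" for y
    using mult_right_mono[OF sf[OF that], of "norm (U y)"] \<epsilon> by (simp add: v1_def norm_mult norm_divide ne)
  note cg = coupled_growth[OF \<eta>(1) s0 d1 d2 b1 b2]
  have v0: "v1 0 = U 0" "v2 0 = V 0" by (simp_all add: v1_def v2_def e_def)
  have v\<eta>: "v1 \<eta> = U \<eta> * \<theta>" "v2 \<eta> = V \<eta> * e 1 \<eta>" by (simp_all add: v1_def v2_def e_def \<theta>_def)
  show "norm (U \<eta> * \<theta> - U 0) \<le> t * exp t * (norm (U 0) + norm (V 0))"
    using cg(1) unfolding v0 v\<eta> t_def by simp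
  have e\<theta>: "e 1 \<eta> * \<theta> = 1" by (simp add: e_def \<theta>_def exp_add[symmetric])
  have n\<theta>: "norm \<theta> = 1" using ne[of "-1" \<eta>] by (simp add: e_def \<theta>_def)
  have "norm (V \<eta> - V 0 * \<theta>) = norm ((V \<eta> * e 1 \<eta> - V 0) * \<theta>)"
  proof -
    have "(V \<eta> * e 1 \<eta> - V 0) * \<theta> = V \<eta> * (e 1 \<eta> * \<theta>) - V 0 * \<theta>" by (simp add: algebra_simps)
    then show ?thesis unfolding e\<theta> by simp
  qed
  also have "\<dots> = norm (V \<eta> * e 1 \<eta> - V 0)" by (simp add: norm_mult n\<theta>)
  finally show "norm (V \<eta> - V 0 * \<theta>) \<le> t * exp t * (norm (U 0) + norm (V 0))"
    using cg(2) unfolding v0 v\<eta> t_def by simp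
qed

text \<open>Everything is measured against \<open>P X - Q X\<close>, the decaying combination on the
  real axis. There the growing one is relatively negligible, and with \<epsilon> fixed the transport
  error vanishes together with \<open>f\<close>.\<close>

lemma vertical_limit:
  assumes Preal: "\<And>x. p (of_real x) = of_real (P x)" and Qreal: "\<And>x. q (of_real x) = of_real (Q x)"
    and ratio: "\<And>\<delta>. 0 < \<delta> \<Longrightarrow> \<delta> \<le> 1 \<Longrightarrow> eventually (\<lambda>x. \<bar>P x + Q x\<bar> \<le> \<delta> * \<bar>P x - Q x\<bar>) at_top"
    and nz: "\<And>x. P x \<noteq> 0 \<or> Q x \<noteq> 0"
  shows "((\<lambda>X. (p (Complex X \<eta>) + q (Complex X \<eta>)) / of_real (P X - Q X)) \<longlongrightarrow> 0) at_top"
    and "((\<lambda>X. (p (Complex X \<eta>) - q (Complex X \<eta>)) / of_real (P X - Q X)) \<longlongrightarrow> exp (- \<i> * of_real (\<mu> * \<eta> / \<epsilon>))) at_top"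
    and "eventually (\<lambda>X. P X - Q X \<noteq> 0) at_top"
proof -
  define \<theta> where "\<theta> = exp (- \<i> * of_real (\<mu> * \<eta> / \<epsilon>))"
  have n\<theta>: "norm \<theta> = 1" using norm_exp_i_times[of "- (\<mu> * \<eta> / \<epsilon>)"] by (simp add: \<theta>_def)
  show ev_nz: "eventually (\<lambda>X. P X - Q X \<noteq> 0) at_top"
    using ratio[of 1] by (rule eventually_mono) (use nz in \<open>force\<close>)+
  have key: "eventually (\<lambda>X. norm ((p (Complex X \<eta>) + q (Complex X \<eta>)) / of_real (P X - Q X)) < e \<and>
     norm ((p (Complex X \<eta>) - q (Complex X \<eta>)) / of_real (P X - Q X) - \<theta>) < e) at_top" if e: "0 < e" for e
  proof -
    define \<delta> where "\<delta> = min 1 (e / 2)"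
    \<comment> \<open>The cap 1 bounds \<open>exp t\<close> by \<open>exp 1\<close>; the shares
      \<open>e / 2\<close> from the initial ratio and \<open>e / 4\<close> from the transport stay
      below \<open>e\<close> together.\<close>
    define t where "t = min 1 (e / (8 * exp 1))"
    have \<delta>: "0 < \<delta>" "\<delta> \<le> 1" "\<delta> \<le> e / 2" and t: "0 < t" "t \<le> 1" using e by (auto simp: \<delta>_def t_def)
    have "t * exp t \<le> e / (8 * exp 1) * exp 1" using t e by (intro mult_mono) (auto simp: t_def)
    then have te: "t * exp t \<le> e / 8" by simp
    define s where "s = t * \<epsilon> / \<eta>"
    have s: "0 < s" "s / \<epsilon> * \<eta> = t" using t \<epsilon> \<eta> by (auto simp: s_def)
    show ?thesis
      using ratio[OF \<delta>(1,2)] ev_nz f_vertical_small[OF s(1)]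
    proof eventually_elim
      case (elim X)
      define D where "D = \<bar>P X - Q X\<bar>"
      have D: "0 < D" using elim by (simp add: D_def)
      define U where "U = (\<lambda>y. p (Complex X y) + q (Complex X y))"
      define V where "V = (\<lambda>y. p (Complex X y) - q (Complex X y))"
      have U0: "U 0 = of_real (P X + Q X)" and V0: "V 0 = of_real (P X - Q X)"
        using Preal[of X] Qreal[of X] by (simp_all add: U_def V_def complex_of_real_def complex_eq_iff)
      have nU0: "norm (U 0) \<le> e / 2 * D"
      proof -
        have "norm (U 0) \<le> \<delta> * D" using elim(1) unfolding U0 D_def norm_of_real .
        also have "\<dots> \<le> e / 2 * D" using \<delta> D by (intro mult_right_mono) auto
        finally show ?thesis .
      qed
      have nU0': "norm (U 0) \<le> D"
      proof -
        have "norm (U 0) \<le> \<delta> * D" using elim(1) unfolding U0 D_def norm_of_real .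
        also have "\<dots> \<le> 1 * D" using \<delta> D by (intro mult_right_mono) auto
        finally show ?thesis by simp
      qed
      have nV0: "norm (V 0) = D" unfolding V0 D_def norm_of_real ..
      have "t * exp t * (norm (U 0) + norm (V 0)) \<le> e / 8 * (D + D)"
        using te t e D nU0' nV0 by (intro mult_mono) auto
      then have small: "t * exp t * (norm (U 0) + norm (V 0)) \<le> e / 4 * D" by (simp add: mult.commute)
      have vt: "norm (U \<eta> * \<theta> - U 0) \<le> e / 4 * D" "norm (V \<eta> - V 0 * \<theta>) \<le> e / 4 * D"
        using vertical_transport[of X s] elim small unfolding U_def V_def \<theta>_def s(2) by (auto intro: order_trans)
      have "norm (U \<eta>) = norm (U \<eta> * \<theta>)" by (simp add: norm_mult n\<theta>)
      also have "\<dots> \<le> norm (U 0) + norm (U \<eta> * \<theta> - U 0)" by (rule norm_triangle_sub)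
      also have "\<dots> \<le> e / 2 * D + e / 4 * D" using nU0 vt by (intro add_mono)
      also have "\<dots> < e * D" using e D by simp
      finally have 1: "norm (U \<eta> / of_real (P X - Q X)) < e"
        using D by (simp add: norm_divide D_def pos_divide_less_eq del: of_real_diff)
      have "V \<eta> / of_real (P X - Q X) - \<theta> = (V \<eta> - V 0 * \<theta>) / of_real (P X - Q X)"
        using elim by (simp add: V0 diff_divide_distrib del: of_real_diff)
      also have "norm \<dots> \<le> e / 4 * D / D" unfolding norm_divide norm_of_real D_def[symmetric]
        using vt D by (intro divide_right_mono) auto
      also have "\<dots> < e" using e D by simp
      finally have 2: "norm (V \<eta> / of_real (P X - Q X) - \<theta>) < e" .
      show ?case using 1 2 unfolding U_def V_def ..
    qed
  qed
  show "((\<lambda>X. (p (Complex X \<eta>) + q (Complex X \<eta>)) / of_real (P X - Q X)) \<longlongrightarrow> 0) at_top"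
    by (rule tendstoI, drule key, erule eventually_mono) (simp add: dist_norm del: of_real_diff)
  show "((\<lambda>X. (p (Complex X \<eta>) - q (Complex X \<eta>)) / of_real (P X - Q X)) \<longlongrightarrow> exp (- \<i> * of_real (\<mu> * \<eta> / \<epsilon>))) at_top"
    unfolding \<theta>_def[symmetric] by (rule tendstoI, drule key, erule eventually_mono) (simp add: dist_norm del: of_real_diff)
qed

end

lemma f_line_tendsto: "((\<lambda>X. f (Complex X \<eta>)) \<longlongrightarrow> 0) at_top"
proof (rule tendstoI)
  fix e :: real assume "0 < e"
  then have "0 < e / 2" by simp
  from f_vertical_small[OF this]
  show "eventually (\<lambda>X. dist (f (Complex X \<eta>)) 0 < e) at_top"
  proof eventually_elim
    case (elim X)
    then have "norm (f (Complex X \<eta>)) \<le> e / 2" using \<eta> by simp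
    then show ?case using \<open>0 < e\<close> by (simp add: dist_norm)
  qed
qed

lemma amp_tendsto:
  assumes \<mu>: "a \<le> \<mu>" "\<mu> \<le> A 0"
  shows "((\<lambda>X. amp \<mu> (Complex X \<eta>)) \<longlongrightarrow> 1) at_top"
proof -
  have mu: "0 < \<mu>" using \<mu> a by linarith
  have "((\<lambda>X. kap \<mu> (Complex X \<eta>)) \<longlongrightarrow> rt (of_real (\<mu>\<^sup>2))) at_top"
    unfolding kap_def symb_def
  proof (rule isCont_tendsto_compose[of _ rt])
    show "isCont rt (of_real (\<mu>\<^sup>2))"
      by (rule DERIV_isCont[OF has_field_derivative_rt]) (use mu in auto)
    have "((\<lambda>X. (of_real \<mu>)\<^sup>2 - (f (Complex X \<eta>))\<^sup>2) \<longlongrightarrow> (of_real \<mu>)\<^sup>2 - 0\<^sup>2) at_top"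
      by (intro tendsto_intros f_line_tendsto)
    then show "((\<lambda>X. (of_real \<mu>)\<^sup>2 - (f (Complex X \<eta>))\<^sup>2) \<longlongrightarrow> of_real (\<mu>\<^sup>2)) at_top" by simp
  qed
  moreover have "rt (of_real (\<mu>\<^sup>2)) = of_real \<mu>" unfolding rt_of_real using mu by simp
  ultimately have k: "((\<lambda>X. kap \<mu> (Complex X \<eta>)) \<longlongrightarrow> of_real \<mu>) at_top" by simp
  have "((\<lambda>X. kap \<mu> (Complex X \<eta>) / (of_real \<mu> + f (Complex X \<eta>))) \<longlongrightarrow> of_real \<mu> / (of_real \<mu> + 0)) at_top"
    by (intro tendsto_intros k f_line_tendsto) (use mu in simp)
  then have "((\<lambda>X. kap \<mu> (Complex X \<eta>) / (of_real \<mu> + f (Complex X \<eta>))) \<longlongrightarrow> 1) at_top" using mu by simp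
  then have "((\<lambda>X. csqrt (kap \<mu> (Complex X \<eta>) / (of_real \<mu> + f (Complex X \<eta>)))) \<longlongrightarrow> csqrt 1) at_top"
    by (rule isCont_tendsto_compose[OF continuous_at_csqrt, rotated]) simp
  then show ?thesis by (simp add: amp_def)
qed

end

section \<open>Eigenvalues\<close>

context wkb_line begin

text \<open>Reflection symmetry and oddness of \<open>p * q\<close> meet on the imaginary axis,
  where \<open>cnj z = - z\<close>.\<close>

lemma product_imaginary:
  assumes p: "\<And>z. z \<in> strip \<rho> \<Longrightarrow> (p has_field_derivative p' z) (at z)" and q: "\<And>z. z \<in> strip \<rho> \<Longrightarrow> (q has_field_derivative q' z) (at z)"
    and Preal: "\<And>x. p (of_real x) = of_real (P x)" and Qreal: "\<And>x. q (of_real x) = of_real (Q x)"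
    and odd: "\<And>x. P (- x) * Q (- x) = - (P x * Q x)"
  shows "Re (p (Complex 0 \<eta>) * q (Complex 0 \<eta>)) = 0"
proof -
  define F where "F = (\<lambda>z. p z * q z)"
  have hol: "F holomorphic_on strip \<rho>"
    unfolding F_def using p q by (intro holomorphic_on_mult) (auto simp: holomorphic_on_open)
  have real: "F (of_real x) = of_real (P x * Q x)" for x by (simp add: F_def Preal Qreal)
  let ?z = "Complex 0 \<eta>"
  have z: "?z \<in> strip \<rho>" using \<eta> by simp
  have "cnj (F ?z) = F (cnj ?z)" using strip_cnj[OF \<rho> hol real z] by simp
  also have "cnj ?z = - ?z" by (simp add: complex_eq_iff)
  also have "F (- ?z) = - F ?z" by (rule strip_odd[OF \<rho> hol real odd z])
  finally have "Re (cnj (F ?z)) = Re (- F ?z)" by (rule arg_cong)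
  then show ?thesis by (simp add: F_def)
qed

text \<open>At height \<eta> on the imaginary axis \<open>p * q\<close> equals
  \<open>(ap 0)\<^sup>2 - (am 0)\<^sup>2\<close> and has zero real part. Relative to
  \<open>N X\<close>, by \<open>connection\<close>, \<open>ap 0\<close> is small and
  \<open>am 0\<close> is close to the recessive amplitude at \<open>X\<close>, so the square of the
  latter must be almost imaginary. The limit in \<open>X\<close> identifies its phase as
  \<open>S / \<epsilon>\<close>.\<close>

lemma eigenvalue_phase:
  assumes \<mu>: "a \<le> \<mu>" "\<mu> \<le> A 0" and \<epsilon>: "0 < \<epsilon>" "\<epsilon> \<le> 1"
    and ev: "is_eigenvalue A \<epsilon> (\<i> * of_real \<mu>)"
  shows "\<bar>cos (action A \<mu> / \<epsilon>)\<bar> \<le> (2 * GG\<^sup>2 + 2 * GG) * \<epsilon>"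
proof -
  have mu: "0 < \<mu>" using \<mu> a by linarith
  obtain P Q M x0 where sys: "real_system \<mu> \<epsilon> P Q" and nz0: "P x0 \<noteq> 0 \<or> Q x0 \<noteq> 0"
    and odd: "\<And>x. P (- x) * Q (- x) = - (P x * Q x)"
    and int: "\<And>X. 0 \<le> X \<Longrightarrow> integral {0..X} (\<lambda>x. (P x)\<^sup>2 + (Q x)\<^sup>2) \<le> M"
    by (rule eigenfunction_real_symmetric[OF ev \<epsilon>(1)]) (rule that; assumption)
  obtain p q where p: "\<And>z. z \<in> strip \<rho> \<Longrightarrow> (p has_field_derivative (of_real \<mu> - f z) / of_real \<epsilon> * q z) (at z)"
    and q: "\<And>z. z \<in> strip \<rho> \<Longrightarrow> (q has_field_derivative (of_real \<mu> + f z) / of_real \<epsilon> * p z) (at z)"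
    and Preal: "\<And>x. p (of_real x) = of_real (P x)" and Qreal: "\<And>x. q (of_real x) = of_real (Q x)"
    by (rule holomorphic_extension[OF sys \<epsilon>(1) mu]) (rule that; assumption)
  obtain \<Phi> where \<Phi>: "\<And>z. z \<in> halfstrip \<Longrightarrow> (\<Phi> has_field_derivative kap \<mu> z) (at z within halfstrip)"
    by (rule kap_primitive[OF \<mu>]) (rule that; assumption)
  note nz = real_system_nonzero[OF sys \<epsilon>(1) mu nz0]
  define \<theta> where "\<theta> = exp (- \<i> * of_real (\<mu> * \<eta> / \<epsilon>))"
  define D where "D = (\<lambda>X. complex_of_real (P X - Q X))"
  define w where "w = (\<lambda>X. \<Phi> (Complex X \<eta>) - \<Phi> (Complex 0 \<eta>))"
  define E where "E = (\<lambda>x. exp (w x / of_real \<epsilon>))"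
  define c where "c = (\<lambda>X. amp \<mu> (Complex X \<eta>))"
  define ap where "ap = (\<lambda>x. E x * ((c x * q (Complex x \<eta>) + p (Complex x \<eta>) / c x) / 2))"
  define am where "am = (\<lambda>x. E x * ((c x * q (Complex x \<eta>) - p (Complex x \<eta>) / c x) / 2))"
  have conn: "norm (ap 0) \<le> GG * (norm (ap X) + \<epsilon> * norm (am X))"
    "norm (am 0 - am X) \<le> GG * (norm (ap X) + \<epsilon> * norm (am X))" if "0 < X" for X
    using connection[OF \<mu> \<epsilon> p q \<Phi> that] unfolding ap_def am_def E_def c_def w_def by auto
  define r1 where "r1 = (\<lambda>X. (p (Complex X \<eta>) + q (Complex X \<eta>)) / D X)"
  define r2 where "r2 = (\<lambda>X. (p (Complex X \<eta>) - q (Complex X \<eta>)) / D X)"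
  note vl = vertical_limit[OF \<mu> \<epsilon>(1) p q Preal Qreal recessive_ratio[OF sys \<epsilon>(1) mu int] nz]
  have r1: "(r1 \<longlongrightarrow> 0) at_top" and r2: "(r2 \<longlongrightarrow> \<theta>) at_top" and Dnz: "eventually (\<lambda>X. D X \<noteq> 0) at_top"
    using vl unfolding r1_def r2_def \<theta>_def D_def by auto
  have c1: "(c \<longlongrightarrow> 1) at_top" unfolding c_def by (rule amp_tendsto[OF \<mu>])
  \<comment> \<open>A common normalising factor of uncontrolled modulus; as \<open>D X\<close> is
    real, the argument of its square comes from \<open>E\<close> alone.\<close>
  define N where "N = (\<lambda>X. E X * D X)"
  define pa where "pa = (\<lambda>X. (c X + 1 / c X) / 4 * r1 X + (1 / c X - c X) / 4 * r2 X)"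
  define pm where "pm = (\<lambda>X. (c X - 1 / c X) / 4 * r1 X - (c X + 1 / c X) / 4 * r2 X)"
  have pa_eq: "ap X = N X * pa X" and pm_eq: "am X = N X * pm X" if "D X \<noteq> 0" for X
  proof -
    have alg: "d * ((c + k) / 4 * (u / d) + (k - c) / 4 * (v / d)) = (c * (u - v) + (u + v) * k) / 4"
       "d * ((c - k) / 4 * (u / d) - (c + k) / 4 * (v / d)) = (c * (u - v) - (u + v) * k) / 4" if "d \<noteq> 0" for c k d u v :: complex
      using that by (simp_all add: field_simps)
    have alg2: "(c * ((u + v) - (u - v)) + ((u + v) + (u - v)) * (1 / c)) / 4 = (c * v + u / c) / 2"
      "(c * ((u + v) - (u - v)) - ((u + v) + (u - v)) * (1 / c)) / 4 = (c * v - u / c) / 2" for c u v :: complex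
      by (cases "c = 0"; simp add: field_simps)+
    show "ap X = N X * pa X" "am X = N X * pm X"
      unfolding N_def pa_def pm_def r1_def r2_def mult.assoc[of "E X"] alg[OF that] ap_def am_def alg2 by (rule refl)+
  qed
  have "((\<lambda>X. (c X + 1 / c X) / 4 * r1 X + (1 / c X - c X) / 4 * r2 X) \<longlongrightarrow> (1 + 1 / 1) / 4 * 0 + (1 / 1 - 1) / 4 * \<theta>) at_top"
    by (intro tendsto_intros c1 r1 r2) simp_all
  then have pa: "(pa \<longlongrightarrow> 0) at_top" by (simp add: pa_def)
  have "((\<lambda>X. (c X - 1 / c X) / 4 * r1 X - (c X + 1 / c X) / 4 * r2 X) \<longlongrightarrow> (1 - 1 / 1) / 4 * 0 - (1 + 1 / 1) / 4 * \<theta>) at_top"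
    by (intro tendsto_intros c1 r1 r2) simp_all
  then have pm: "(pm \<longlongrightarrow> - \<theta> / 2) at_top" by (simp add: pm_def)
  define t where "t = (\<lambda>X. GG * (norm (pa X) + \<epsilon> * norm (pm X)))"
  have n\<theta>: "norm \<theta> = 1" using norm_exp_i_times[of "- (\<mu> * \<eta> / \<epsilon>)"] by (simp add: \<theta>_def)
  have t: "(t \<longlongrightarrow> GG * (\<epsilon> / 2)) at_top"
  proof -
    have "(t \<longlongrightarrow> GG * (norm (0::complex) + \<epsilon> * norm (- \<theta> / 2))) at_top"
      unfolding t_def by (intro tendsto_intros pa pm)
    then show ?thesis by (simp add: norm_divide n\<theta>)
  qed
  define S where "S = action A \<mu>"
  \<comment> \<open>The phase factor of \<open>(N X)\<^sup>2\<close>; its limit contains the action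
    together with \<open>2 * \<mu> * \<eta>\<close>.\<close>
  define T where "T = (\<lambda>X. exp (\<i> * of_real (2 * Im (w X) / \<epsilon>)))"
  have nT: "norm (T X) = 1" for X unfolding T_def by (rule norm_exp_i_times)
  have T: "(T \<longlongrightarrow> exp (\<i> * of_real (2 * (S / 2 + \<mu> * \<eta>) / \<epsilon>))) at_top"
    unfolding T_def w_def S_def using \<epsilon> by (intro tendsto_intros phase_tendsto[OF \<mu> \<Phi>]) auto
  have N2: "(N X)\<^sup>2 = of_real ((norm (N X))\<^sup>2) * T X" for X
  proof -
    have "(E X)\<^sup>2 = exp (2 * w X / of_real \<epsilon>)" unfolding E_def exp_double[symmetric] by simp
    also have "2 * w X / of_real \<epsilon> = of_real (2 * Re (w X) / \<epsilon>) + \<i> * of_real (2 * Im (w X) / \<epsilon>)"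
      using \<epsilon> by (simp add: complex_eq_iff)
    also have "exp \<dots> = of_real (exp (2 * Re (w X) / \<epsilon>)) * T X" by (simp only: exp_add T_def exp_of_real)
    also have "exp (2 * Re (w X) / \<epsilon>) = (norm (E X))\<^sup>2"
    proof -
      have "norm (E X) = exp (Re (w X) / \<epsilon>)" by (simp add: E_def)
      moreover have "2 * Re (w X) / \<epsilon> = 2 * (Re (w X) / \<epsilon>)" by simp
      ultimately show ?thesis by (simp only: exp_double)
    qed
    finally have "(E X)\<^sup>2 = of_real ((norm (E X))\<^sup>2) * T X" .
    moreover have "(D X)\<^sup>2 = of_real ((norm (D X))\<^sup>2)" unfolding D_def by (simp add: power2_abs flip: of_real_power del: of_real_diff)
    ultimately show ?thesis by (simp add: N_def power_mult_distrib norm_mult)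
  qed
  \<comment> \<open>\<open>E 0 = 1\<close>, and \<open>amp\<close> cancels in the difference of the
    squares.\<close>
  have F: "Re ((ap 0)\<^sup>2 - (am 0)\<^sup>2) = 0"
  proof -
    have "c 0 \<noteq> 0" unfolding c_def by (rule amp_nz[OF \<mu>]) simp
    then have "(ap 0)\<^sup>2 - (am 0)\<^sup>2 = p (Complex 0 \<eta>) * q (Complex 0 \<eta>)"
      by (simp add: ap_def am_def E_def w_def power2_eq_square field_simps)
    then show ?thesis using product_imaginary[OF p q Preal Qreal odd] by simp
  qed
  have "eventually (\<lambda>X. \<bar>Re (T X * (pm X)\<^sup>2)\<bar> \<le> t X * (t X + 2 * norm (pm X)) + (t X)\<^sup>2) at_top"
    using Dnz eventually_gt_at_top[of 0]
  proof eventually_elim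
    case (elim X)
    have nN: "0 < norm (N X)" using elim by (simp add: N_def E_def)
    define \<alpha> where "\<alpha> = ap 0 / N X"
    define \<beta> where "\<beta> = am 0 / N X"
    have ab: "ap 0 = N X * \<alpha>" "am 0 = N X * \<beta>" using nN by (simp_all add: \<alpha>_def \<beta>_def)
    have tt: "GG * (norm (ap X) + \<epsilon> * norm (am X)) = norm (N X) * t X"
      unfolding t_def pa_eq[OF elim(1)] pm_eq[OF elim(1)] by (simp add: norm_mult algebra_simps)
    have "norm (N X) * norm \<alpha> \<le> norm (N X) * t X" using conn(1)[OF elim(2)] unfolding tt ab norm_mult .
    then have \<alpha>: "norm \<alpha> \<le> t X" using nN by simp
    have "am 0 - am X = N X * (\<beta> - pm X)" by (simp add: ab pm_eq[OF elim(1)] right_diff_distrib)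
    then have "norm (N X) * norm (\<beta> - pm X) \<le> norm (N X) * t X"
      using conn(2)[OF elim(2)] unfolding tt by (simp add: norm_mult)
    then have \<beta>: "norm (\<beta> - pm X) \<le> t X" using nN by simp
    have t0: "0 \<le> t X" using \<alpha> norm_ge_zero order_trans by blast
    have "(ap 0)\<^sup>2 - (am 0)\<^sup>2 = of_real ((norm (N X))\<^sup>2) * (T X * (\<alpha>\<^sup>2 - \<beta>\<^sup>2))"
      unfolding ab power_mult_distrib N2 by (simp add: algebra_simps)
    then have "(norm (N X))\<^sup>2 * Re (T X * (\<alpha>\<^sup>2 - \<beta>\<^sup>2)) = 0" using F by (simp del: of_real_power)
    then have R0: "Re (T X * (\<alpha>\<^sup>2 - \<beta>\<^sup>2)) = 0" using nN by simp
    \<comment> \<open>The exact relation between \<open>\<alpha>\<close> and \<open>\<beta>\<close>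
      is compared with the ideal values \<open>\<alpha> = 0\<close> and
      \<open>\<beta> = pm X\<close>, from which each differs by at most \<open>t X\<close>.\<close>
    have "T X * (pm X)\<^sup>2 = T X * (((pm X)\<^sup>2 - \<beta>\<^sup>2) + \<alpha>\<^sup>2) - T X * (\<alpha>\<^sup>2 - \<beta>\<^sup>2)" by (simp add: algebra_simps)
    then have "\<bar>Re (T X * (pm X)\<^sup>2)\<bar> = \<bar>Re (T X * (((pm X)\<^sup>2 - \<beta>\<^sup>2) + \<alpha>\<^sup>2))\<bar>" using R0 by simp
    also have "\<dots> \<le> norm (T X * (((pm X)\<^sup>2 - \<beta>\<^sup>2) + \<alpha>\<^sup>2))" by (rule abs_Re_le_cmod)
    also have "\<dots> = norm (((pm X)\<^sup>2 - \<beta>\<^sup>2) + \<alpha>\<^sup>2)" by (simp add: norm_mult nT)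
    also have "\<dots> \<le> norm ((pm X)\<^sup>2 - \<beta>\<^sup>2) + norm (\<alpha>\<^sup>2)" by (rule norm_triangle_ineq)
    also have "(pm X)\<^sup>2 - \<beta>\<^sup>2 = (pm X - \<beta>) * (2 * pm X + (\<beta> - pm X))" by (simp add: power2_eq_square algebra_simps)
    also have "norm \<dots> \<le> t X * (t X + 2 * norm (pm X))"
      unfolding norm_mult
    proof (rule mult_mono)
      show "norm (pm X - \<beta>) \<le> t X" using \<beta> by (simp add: norm_minus_commute)
      show "norm (2 * pm X + (\<beta> - pm X)) \<le> t X + 2 * norm (pm X)"
        using norm_triangle_ineq[of "2 * pm X" "\<beta> - pm X"] \<beta> by (simp add: norm_mult)
    qed (use t0 in auto)
    also have "norm (\<alpha>\<^sup>2) \<le> (t X)\<^sup>2" unfolding norm_power using \<alpha> by (intro power_mono) auto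
    finally show ?case by simp
  qed
  moreover have "((\<lambda>X. \<bar>Re (T X * (pm X)\<^sup>2)\<bar>) \<longlongrightarrow> \<bar>Re (exp (\<i> * of_real (2 * (S / 2 + \<mu> * \<eta>) / \<epsilon>)) * (- \<theta> / 2)\<^sup>2)\<bar>) at_top"
    by (intro tendsto_intros T pm)
  moreover have "((\<lambda>X. t X * (t X + 2 * norm (pm X)) + (t X)\<^sup>2) \<longlongrightarrow> GG * (\<epsilon> / 2) * (GG * (\<epsilon> / 2) + 2 * norm (- \<theta> / 2)) + (GG * (\<epsilon> / 2))\<^sup>2) at_top"
    by (intro tendsto_intros t pm)
  ultimately have le: "\<bar>Re (exp (\<i> * of_real (2 * (S / 2 + \<mu> * \<eta>) / \<epsilon>)) * (- \<theta> / 2)\<^sup>2)\<bar>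
     \<le> GG * (\<epsilon> / 2) * (GG * (\<epsilon> / 2) + 2 * norm (- \<theta> / 2)) + (GG * (\<epsilon> / 2))\<^sup>2"
    using tendsto_le[OF trivial_limit_at_top_linorder] by blast
  \<comment> \<open>The square of the rotation \<open>\<theta>\<close> removes the term
    \<open>2 * \<mu> * \<eta> / \<epsilon>\<close>, so that only the action remains.\<close>
  have eq1: "exp (\<i> * of_real (2 * (S / 2 + \<mu> * \<eta>) / \<epsilon>)) * (- \<theta> / 2)\<^sup>2 = exp (\<i> * of_real (S / \<epsilon>)) / 4"
  proof -
    have "\<theta>\<^sup>2 = exp (2 * (- \<i> * of_real (\<mu> * \<eta> / \<epsilon>)))" unfolding \<theta>_def by (rule exp_double[symmetric])
    moreover have "\<i> * of_real (2 * (S / 2 + \<mu> * \<eta>) / \<epsilon>) + 2 * (- \<i> * of_real (\<mu> * \<eta> / \<epsilon>)) = \<i> * of_real (S / \<epsilon>)"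
      using \<epsilon> by (simp add: complex_eq_iff field_simps)
    ultimately have "exp (\<i> * of_real (2 * (S / 2 + \<mu> * \<eta>) / \<epsilon>)) * \<theta>\<^sup>2 = exp (\<i> * of_real (S / \<epsilon>))"
      by (simp only: exp_add[symmetric])
    then show ?thesis by (simp add: power_divide)
  qed
  have eq2: "Re (exp (\<i> * of_real (S / \<epsilon>)) / 4) = cos (S / \<epsilon>) / 4" by (simp add: Re_exp)
  have "norm (- \<theta> / 2) = 1 / 2" by (simp add: norm_divide n\<theta>)
  then have "\<bar>cos (S / \<epsilon>)\<bar> / 4 \<le> GG * (\<epsilon> / 2) * (GG * (\<epsilon> / 2) + 1) + (GG * (\<epsilon> / 2))\<^sup>2"
    using le unfolding eq1 eq2 by simp
  then have "\<bar>cos (S / \<epsilon>)\<bar> \<le> 2 * GG\<^sup>2 * (\<epsilon> * \<epsilon>) + 2 * GG * \<epsilon>" by (simp add: power2_eq_square algebra_simps)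
  also have "\<dots> \<le> 2 * GG\<^sup>2 * (\<epsilon> * 1) + 2 * GG * \<epsilon>"
    using \<epsilon> by (intro add_right_mono mult_left_mono) auto
  finally show ?thesis by (simp add: S_def algebra_simps)
qed

end

section \<open>The function \<open>m\<close> and the uniformity in \<mu>\<close>

theorem theorem2p2:
  fixes A :: "real \<Rightarrow> real"
  assumes A_pos: "\<And>x. A x > 0"
    and A_smooth: "\<And>n x. ((deriv ^^ n) A) differentiable (at x)"
    and A_hol: "\<exists>\<rho>0 \<theta>0 \<tau> (Ac :: complex \<Rightarrow> complex).
        \<rho>0 > 0 \<and> \<theta>0 > 0 \<and> \<theta>0 < pi / 2 \<and> \<tau> > 0 \<and>
        Ac holomorphic_on sectorD \<rho>0 \<theta>0 \<and>
        (\<forall>x. Ac (complex_of_real x) = complex_of_real (A x)) \<and>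
        (\<exists>C R. \<forall>z \<in> sectorD \<rho>0 \<theta>0. norm z \<ge> R \<longrightarrow> norm (Ac z) \<le> C * norm z powr (-1 - \<tau>))"
    and A_even: "\<And>x. A (-x) = A x"
    and A_decr: "\<And>x. x > 0 \<Longrightarrow> deriv A x < 0"
    and A_2: "deriv (deriv A) 0 < 0"
  shows "\<exists>m :: real \<Rightarrow> real \<Rightarrow> complex.
           \<forall>a b. 0 < a \<and> a \<le> b \<and> b \<le> A 0 \<longrightarrow>
             (\<exists>C \<epsilon>0. \<epsilon>0 > 0 \<and>
               (\<forall>\<epsilon> \<mu>. 0 < \<epsilon> \<and> \<epsilon> < \<epsilon>0 \<and> \<mu> \<in> {a..b} \<longrightarrow>
                  norm (m \<mu> \<epsilon> + 1) \<le> C * \<epsilon> \<and>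
                  (is_eigenvalue A \<epsilon> (\<i> * complex_of_real \<mu>) \<longleftrightarrow>
                   m \<mu> \<epsilon> * exp (2 * \<i> * complex_of_real (action A \<mu>) / complex_of_real \<epsilon>) = 1)))"
proof -
  obtain \<rho>0 \<theta>0 \<tau> C0 R f where \<rho>0: "0 < \<rho>0" and \<tau>: "0 < \<tau>" and hol0: "f holomorphic_on sectorD \<rho>0 \<theta>0"
    and real: "\<And>x. f (of_real x) = of_real (A x)"
    and dec0: "\<And>z. z \<in> sectorD \<rho>0 \<theta>0 \<Longrightarrow> R \<le> norm z \<Longrightarrow> norm (f z) \<le> C0 * norm z powr (-1 - \<tau>)"
    using A_hol by blast
  define \<sigma> where "\<sigma> = 1 + \<tau>"
  have hol1: "f holomorphic_on strip \<rho>0" by (rule holomorphic_on_subset[OF hol0 strip_subset_sectorD])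
  have \<sigma>: "0 \<le> \<sigma>" using \<tau> by (simp add: \<sigma>_def)
  have decf: "norm (f z) \<le> C0 * norm z powr (-\<sigma>)" if "z \<in> strip \<rho>0" "R \<le> norm z" for z
    using dec0[of z] that strip_subset_sectorD unfolding \<sigma>_def by (auto simp: minus_diff_commute)
  have decay: "\<exists>D. \<forall>z \<in> strip (\<rho>0/4). norm ((deriv ^^ n) f z) \<le> D * (1 + \<bar>Re z\<bar>) powr (-\<sigma>)" for n
    by (rule strip_derivative_decay[OF \<rho>0 \<sigma> hol1 decf])
  obtain D0 D1 D2 where
    D0: "\<And>z. z \<in> strip (\<rho>0/4) \<Longrightarrow> norm (f z) \<le> D0 * (1 + \<bar>Re z\<bar>) powr (-\<sigma>)" and
    D1: "\<And>z. z \<in> strip (\<rho>0/4) \<Longrightarrow> norm (deriv f z) \<le> D1 * (1 + \<bar>Re z\<bar>) powr (-\<sigma>)" and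
    D2: "\<And>z. z \<in> strip (\<rho>0/4) \<Longrightarrow> norm (deriv (deriv f) z) \<le> D2 * (1 + \<bar>Re z\<bar>) powr (-\<sigma>)"
    using decay[of 0] decay[of 1] decay[of 2] unfolding numeral_2_eq_2 One_nat_def funpow.simps o_apply id_apply by blast
  define C where "C = max D0 (max D1 D2)"
  have CD: "D0 \<le> C" "D1 \<le> C" "D2 \<le> C" by (auto simp: C_def)
  interpret analytic_well A f "\<rho>0/4" \<sigma> C
  proof
    show "0 < \<rho>0 / 4" "1 < \<sigma>" using \<rho>0 \<tau> by (auto simp: \<sigma>_def)
    show "f holomorphic_on strip (\<rho>0/4)" by (rule holomorphic_on_subset[OF hol1]) (use \<rho>0 in auto)
    fix z assume z: "z \<in> strip (\<rho>0/4)"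
    show "norm (f z) \<le> C * (1 + \<bar>Re z\<bar>) powr (-\<sigma>)"
      by (rule order_trans[OF D0[OF z] mult_right_mono[OF CD(1)]]) simp
    show "norm (deriv f z) \<le> C * (1 + \<bar>Re z\<bar>) powr (-\<sigma>)"
      by (rule order_trans[OF D1[OF z] mult_right_mono[OF CD(2)]]) simp
    show "norm (deriv (deriv f) z) \<le> C * (1 + \<bar>Re z\<bar>) powr (-\<sigma>)"
      by (rule order_trans[OF D2[OF z] mult_right_mono[OF CD(3)]]) simp
  qed (use real A_pos A_even A_decr A_2 in auto)
  \<comment> \<open>\<open>K\<close> depends on the lower end \<open>a\<close> only; an interval
    ending below \<open>A 0\<close> inherits it from the range up to \<open>A 0\<close>.\<close>
  have key: "\<exists>K\<ge>0. \<forall>\<mu> \<epsilon>. a \<le> \<mu> \<and> \<mu> \<le> A 0 \<and> 0 < \<epsilon> \<and> \<epsilon> \<le> 1 \<and> is_eigenvalue A \<epsilon> (\<i> * of_real \<mu>) \<longrightarrow> \<bar>cos (action A \<mu> / \<epsilon>)\<bar> \<le> K * \<epsilon>"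
    if a: "0 < a" "a \<le> A 0" for a
  proof -
    obtain \<eta> d where "wkb_line A f (\<rho>0/4) \<sigma> C a \<eta> d" using wkb_line_exists[OF a] by blast
    then interpret wkb_line A f "\<rho>0/4" \<sigma> C a \<eta> d .
    have "0 \<le> 2 * GG\<^sup>2 + 2 * GG" using constants_nonneg(7) by simp
    then show ?thesis using eigenvalue_phase by blast
  qed
  define ph where "ph = (\<lambda>\<mu> \<epsilon>. exp (2 * \<i> * complex_of_real (action A \<mu>) / complex_of_real \<epsilon>))"
  have ph_fold: "exp (2 * \<i> * complex_of_real (action A \<mu>) / complex_of_real \<epsilon>) = ph \<mu> \<epsilon>" for \<mu> \<epsilon>
    by (simp add: ph_def)
  \<comment> \<open>The value -1 satisfies the quantization condition exactly when
    \<open>ph \<mu> \<epsilon> = -1\<close>; without an eigenvalue it is then moved by \<epsilon>,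
    which breaks the equation at a cost of O(\<epsilon>). Neither \<open>a\<close> nor
    \<open>b\<close> enters, so one \<open>m\<close> serves every interval.\<close>
  define m where "m = (\<lambda>\<mu> \<epsilon>. if is_eigenvalue A \<epsilon> (\<i> * complex_of_real \<mu>) then inverse (ph \<mu> \<epsilon>)
      else if ph \<mu> \<epsilon> = -1 then -1 + of_real \<epsilon> else -1)"
  \<comment> \<open>With \<open>y = action A \<mu> / \<epsilon>\<close>, half of the phase factors
    out of \<open>1 + exp (- 2 * \<i> * y)\<close> and leaves \<open>2 * cos y\<close>.\<close>
  have ph_cos: "norm (inverse (ph \<mu> \<epsilon>) + 1) = 2 * \<bar>cos (action A \<mu> / \<epsilon>)\<bar>" for \<mu> \<epsilon>
  proof -
    define y where "y = action A \<mu> / \<epsilon>"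
    have eq: "2 * \<i> * complex_of_real (action A \<mu>) / complex_of_real \<epsilon> = \<i> * of_real y + \<i> * of_real y" by (simp add: y_def)
    then have ph: "inverse (ph \<mu> \<epsilon>) = exp (- (\<i> * of_real y)) * exp (- (\<i> * of_real y))"
      unfolding ph_def eq exp_add exp_minus by simp
    have "inverse (ph \<mu> \<epsilon>) + 1 = exp (- (\<i> * of_real y)) * (exp (\<i> * of_real y) + exp (- (\<i> * of_real y)))"
      unfolding ph by (simp add: distrib_left exp_minus)
    also have "exp (\<i> * of_real y) + exp (- (\<i> * of_real y)) = 2 * of_real (cos y)"
      by (simp add: complex_eq_iff Re_exp Im_exp)
    finally have "norm (inverse (ph \<mu> \<epsilon>) + 1) = norm (exp (\<i> * of_real (- y))) * (2 * \<bar>cos y\<bar>)"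
      by (simp add: norm_mult del: norm_exp_eq_Re)
    then show ?thesis unfolding norm_exp_i_times by (simp add: y_def)
  qed
  show ?thesis
  proof (intro exI[of _ m] allI impI)
    fix a b :: real assume ab: "0 < a \<and> a \<le> b \<and> b \<le> A 0"
    then obtain K where K: "0 \<le> K" "\<And>\<mu> \<epsilon>. a \<le> \<mu> \<Longrightarrow> \<mu> \<le> A 0 \<Longrightarrow> 0 < \<epsilon> \<Longrightarrow> \<epsilon> \<le> 1 \<Longrightarrow> is_eigenvalue A \<epsilon> (\<i> * of_real \<mu>) \<Longrightarrow> \<bar>cos (action A \<mu> / \<epsilon>)\<bar> \<le> K * \<epsilon>"
      using key[of a] by auto
    show "\<exists>C \<epsilon>0. \<epsilon>0 > 0 \<and>
               (\<forall>\<epsilon> \<mu>. 0 < \<epsilon> \<and> \<epsilon> < \<epsilon>0 \<and> \<mu> \<in> {a..b} \<longrightarrow>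
                  norm (m \<mu> \<epsilon> + 1) \<le> C * \<epsilon> \<and>
                  (is_eigenvalue A \<epsilon> (\<i> * complex_of_real \<mu>) \<longleftrightarrow>
                   m \<mu> \<epsilon> * exp (2 * \<i> * complex_of_real (action A \<mu>) / complex_of_real \<epsilon>) = 1))"
      unfolding ph_fold
    \<comment> \<open>\<open>2 * K\<close> covers the eigenvalues through \<open>ph_cos\<close>, the
      summand 1 covers the shift by \<epsilon>; the range of \<epsilon> below 1 is where the bound
      by \<open>K\<close> holds.\<close>
    proof (rule exI[of _ "2 * K + 1"], rule exI[of _ "1::real"], intro conjI allI impI)
      fix \<epsilon> \<mu> :: real assume "0 < \<epsilon> \<and> \<epsilon> < 1 \<and> \<mu> \<in> {a..b}"
      then have \<epsilon>: "0 < \<epsilon>" "\<epsilon> \<le> 1" and \<mu>: "a \<le> \<mu>" "\<mu> \<le> A 0" using ab by auto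
      show "norm (m \<mu> \<epsilon> + 1) \<le> (2 * K + 1) * \<epsilon>"
      proof (cases "is_eigenvalue A \<epsilon> (\<i> * complex_of_real \<mu>)")
        case True
        then show ?thesis using K(2)[OF \<mu> \<epsilon> True] ph_cos[of \<mu> \<epsilon>] \<epsilon> by (simp add: m_def distrib_right)
      next
        case False
        then show ?thesis using K(1) \<epsilon> by (simp add: m_def)
      qed
      show "is_eigenvalue A \<epsilon> (\<i> * complex_of_real \<mu>) \<longleftrightarrow> m \<mu> \<epsilon> * ph \<mu> \<epsilon> = 1"
        using \<epsilon> by (auto simp: m_def ph_def algebra_simps minus_equation_iff)
    qed simp
  qed
qed

end
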